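(* Let $\Bbbk=\mathbb{C}(q)$ and $z=q-q^{-1}$. For each $n\in\mathbb{N}$ there exists a unique monoidal superfunctor $\mathbf{F}_n\colon\mathcal{Q}(z)\to U_q\text{-smod}$ (where $U_q=U_q(\mathfrak{q}_n)$) such that $$\mathbf{F}_n(\uparrow)=V,\quad \mathbf{F}_n(\downarrow)=V^*,\quad \mathbf{F}_n(u^+)=T,\quad \mathbf{F}_n(\mathrm{cap}_L)=\mathrm{ev},\quad \mathbf{F}_n(c)=J.$$ Furthermore, $\mathbf{F}_n(u^-)=T^{-1}$, $\mathbf{F}_n(\mathrm{cup}_L)=\mathrm{coev}$, and $\mathbf{F}_n(r^-)\colon V\otimes V^*\to V^*\otimes V$ is given, for $i,j\in\mathtt{I}$, by $$v_i\otimes v_j^*\mapsto (-1)^{p(i)p(j)}q^{-\varphi(i,j)}v_j^*\otimes v_i - z\,\delta_{ij}\sum_{k>i}(-1)^{p(i,k)}q^{2|i|-2|k|}v_k^*\otimes v_k - z\,\delta_{i,-j}\sum_{k>j}(-1)^{p(k)}q^{2|i|-2|k|}v_k^*\otimes v_{-k}.$$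
   Context: $\mathbb{N}$ is the set of nonnegative integers. Everything is $\Bbbk$-linear. A supercategory is a category enriched in vector superspaces with parity-preserving maps; $\bar f$ is the parity of a homogeneous $f$. In a strict monoidal supercategory (unit $\mathbb{1}$, identities $1_X$) the super interchange law holds: $(f'\otimes g)\circ(f\otimes g')=(-1)^{\bar f\bar g}(f'\circ f)\otimes(g\circ g')$. Associativity isomorphisms of tensor products of supermodules are suppressed. **The supercategory $\mathcal{Q}(z)$.** It is the strict monoidal supercategory generated by objects $\uparrow,\downarrow$; even morphisms $u^+,u^-\colon\uparrow\otimes\uparrow\to\uparrow\otimes\uparrow$, $r^-\colon\uparrow\otimes\downarrow\to\downarrow\otimes\uparrow$, $\mathrm{cap}_L\colon\downarrow\otimes\uparrow\to\mathbb{1}$, $\mathrm{cup}_L\colon\mathbb{1}\to\uparrow\otimes\downarrow$; and an odd morphism $c\colon\uparrow\to\uparrow$; subject to: $u^-u^+=1=u^+u^-$; $l^+r^-=1_{\uparrow\otimes\downarrow}$; $r^-l^+=1_{\downarrow\otimes\uparrow}$; $(u^+\otimes1_\uparrow)(1_\uparrow\otimes u^+)(u^+\otimes1_\uparrow)=(1_\uparrow\otimes u^+)(u^+\otimes1_\uparrow)(1_\uparrow\otimes u^+)$; $u^+-u^-=z\,1_{\uparrow\otimes\uparrow}$; $c^2=-1_\uparrow$; $u^+(c\otimes1_\uparrow)=(1_\uparrow\otimes c)u^+$; $\mathrm{cap}_R(c\otimes1_\downarrow)\mathrm{cup}_L=0=\mathrm{cap}_R\,\mathrm{cup}_L$; $(1_\uparrow\otimes\mathrm{cap}_L)(\mathrm{cup}_L\otimes1_\uparrow)=1_\uparrow$;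 $(\mathrm{cap}_L\otimes1_\downarrow)(1_\downarrow\otimes\mathrm{cup}_L)=1_\downarrow$, where $l^+:=(\mathrm{cap}_L\otimes1_\uparrow\otimes1_\downarrow)(1_\downarrow\otimes u^+\otimes1_\downarrow)(1_\downarrow\otimes1_\uparrow\otimes\mathrm{cup}_L)\colon\downarrow\otimes\uparrow\to\uparrow\otimes\downarrow$ and $\mathrm{cap}_R:=\mathrm{cap}_L\circ r^-\colon\uparrow\otimes\downarrow\to\mathbb{1}$. **The superalgebra $U_q$.** $\mathtt{I}=\{1,\dots,n,-1,\dots,-n\}$, ordered as integers. For $i,j\in\mathtt{I}$: $p(i)=0$ if $i>0$ and $p(i)=1$ if $i<0$; $p(i,j)=p(i)+p(j)$; $\mathrm{sgn}(i)=(-1)^{p(i)}$; $\varphi(i,j)=\delta_{|i|,|j|}\,\mathrm{sgn}(j)$. $V$ has $\Bbbk$-basis $v_i$ ($i\in\mathtt{I}$) with $v_i$ of parity $p(i)$; $E_{ij}\in\mathrm{End}_\Bbbk(V)$ are the matrix units ($E_{ij}v_k=\delta_{jk}v_i$), of parity $p(i,j)$. Tensor products of superalgebras are multiplied by $(a'\otimes b)(a\otimes b')=(-1)^{\bar a\bar b}a'a\otimes bb'$, and $(A\otimes B)(v\otimes w)=(-1)^{\bar B\bar v}Av\otimes Bw$. Set $$\Theta=\sum_{i,j}q^{\varphi(i,j)}E_{ii}\otimes E_{jj}+z\sum_{i<j}(-1)^{p(i)}(E_{ji}+E_{-j,-i})\otimes E_{ij}=\sum_{i,j}\Theta_{ij}\otimes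 E_{ij},$$ which is invertible. $U_q=U_q(\mathfrak{q}_n)$ (the quantum isomeric superalgebra) is the unital associative $\Bbbk$-superalgebra generated by $u_{ij}$, $i\le j$, of parity $p(i,j)$, subject to $u_{ii}u_{-i,-i}=1=u_{-i,-i}u_{ii}$ and $L^{12}L^{13}\Theta^{23}=\Theta^{23}L^{13}L^{12}$ in $U_q\otimes\mathrm{End}_\Bbbk(V)^{\otimes2}$, where $L=\sum_{i\le j}u_{ij}\otimes E_{ij}$, $L^{12}=L\otimes 1$, $L^{13}=\sum u_{ij}\otimes1\otimes E_{ij}$, $\Theta^{23}=1\otimes\Theta$. It is a Hopf superalgebra with $\Delta(u_{ij})=\sum_{i\le k\le j}u_{ik}\otimes u_{kj}$, $\varepsilon(u_{ij})=\delta_{ij}$, and antipode $S$ determined by $\sum_{i\le j}S(u_{ij})\otimes E_{ij}=L^{-1}$. $U_q\text{-smod}$ is the monoidal supercategory of finite-dimensional $U_q$-supermodules, with morphisms all (even and odd) linear maps $f$ with $f(xm)=(-1)^{\bar f\bar x}xf(m)$. $V$ is a $U_q$-supermodule via $u_{ij}\mapsto\Theta_{ij}$; $V^*=\mathrm{Hom}_\Bbbk(V,\Bbbk)$ has action $(xf)(v)=(-1)^{\bar x\bar f}f(S(x)v)$, with dual basis $v_i^*$, $v_i^*(v_j)=\delta_{ij}$. **Maps.** $\mathrm{flip}(v\otimes w)=(-1)^{\bar v\bar w}w\otimes v$; $T=\mathrm{flip}\circ\Theta\colon V\otimes V\to V\otimes V$; $\mathrm{ev}\colon V^*\otimes V\to\Bbbk$,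 $f\otimes v\mapsto f(v)$; $\mathrm{coev}\colon\Bbbk\to V\otimes V^*$, $1\mapsto\sum_{i\in\mathtt{I}}v_i\otimes v_i^*$; $J=\sum_{i\in\mathtt{I}}(-1)^{p(i)}E_{-i,i}$ (odd). *)

theory Defs
  imports
    "HOL-Computational_Algebra.Computational_Algebra"
    "HOL-Library.Poly_Mapping"
    "HOL-Library.Z2"
begin

section \<open>Ground field and parities\<close>

type_synonym Cq = "complex poly fract"

definition qvar :: Cq  (* the indeterminate q of C(q) *)
  where "qvar = Fraction_Field.Fract [:0, 1:] 1"

definition zvar :: Cq  (* z = q - 1/q *)
  where "zvar = qvar - inverse qvar"

text \<open>Parities live in the two-element field, so that the exponent of a Koszul sign
  is an ordinary sum of products of parities; \<open>psign e\<close> is \<open>(-1)^e\<close>.\<close>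

definition psign :: "bit \<Rightarrow> 'a::ring_1"
  where "psign e = (if e = 0 then 1 else - 1)"


section \<open>Monoidal supercategories and superfunctors\<close>

text \<open>A vector superspace is encoded as the pair of its even and its odd part:
  \<open>Hom C X Y e\<close> is the space of homogeneous morphisms \<open>X \<rightarrow> Y\<close> of parity \<open>e\<close>, and the full
  morphism superspace is \<open>Hom C X Y 0 \<oplus> Hom C X Y 1\<close>.  A parity-preserving linear map of
  superspaces is exactly a pair of linear maps between the even and the odd parts.
  Addition is only meaningful for two morphisms of the same parity and same (co)domain.\<close>

record ('o, 'm, 'k) monoidal_supercat =
  Ob :: "'o set"
  Hom :: "'o \<Rightarrow> 'o \<Rightarrow> bit \<Rightarrow> 'm set"
  Plus :: "'m \<Rightarrow> 'm \<Rightarrow> 'm"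
  Scale :: "'k \<Rightarrow> 'm \<Rightarrow> 'm"
  Idt :: "'o \<Rightarrow> 'm"
  Comp :: "'m \<Rightarrow> 'm \<Rightarrow> 'm"
  UnitO :: "'o"
  TensO :: "'o \<Rightarrow> 'o \<Rightarrow> 'o"
  TensM :: "'m \<Rightarrow> 'm \<Rightarrow> 'm"

text \<open>Both categories below are strict monoidal, so a monoidal superfunctor preserves unit
  object and tensor products on the nose.\<close>

definition monoidal_superfunctor ::
  "('o, 'm, 'k) monoidal_supercat \<Rightarrow> ('p, 'n, 'k) monoidal_supercat \<Rightarrow>
   ('o \<Rightarrow> 'p) \<Rightarrow> ('m \<Rightarrow> 'n) \<Rightarrow> bool"
where
  "monoidal_superfunctor C D FO FM \<longleftrightarrow>
     (\<forall>X\<in>Ob C. FO X \<in> Ob D) \<and>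
     (\<forall>X\<in>Ob C. \<forall>Y\<in>Ob C. \<forall>e. \<forall>f\<in>Hom C X Y e. FM f \<in> Hom D (FO X) (FO Y) e) \<and>
     (\<forall>X\<in>Ob C. \<forall>Y\<in>Ob C. \<forall>e. \<forall>f\<in>Hom C X Y e. \<forall>g\<in>Hom C X Y e.
        FM (Plus C f g) = Plus D (FM f) (FM g)) \<and>
     (\<forall>X\<in>Ob C. \<forall>Y\<in>Ob C. \<forall>e. \<forall>f\<in>Hom C X Y e. \<forall>a.
        FM (Scale C a f) = Scale D a (FM f)) \<and>
     (\<forall>X\<in>Ob C. FM (Idt C X) = Idt D (FO X)) \<and>
     (\<forall>X\<in>Ob C. \<forall>Y\<in>Ob C. \<forall>Z\<in>Ob C. \<forall>d e. \<forall>g\<in>Hom C Y Z d. \<forall>f\<in>Hom C X Y e.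
        FM (Comp C g f) = Comp D (FM g) (FM f)) \<and>
     FO (UnitO C) = UnitO D \<and>
     (\<forall>X\<in>Ob C. \<forall>Y\<in>Ob C. FO (TensO C X Y) = TensO D (FO X) (FO Y)) \<and>
     (\<forall>X\<in>Ob C. \<forall>Y\<in>Ob C. \<forall>X'\<in>Ob C. \<forall>Y'\<in>Ob C. \<forall>d e.
        \<forall>f\<in>Hom C X Y d. \<forall>g\<in>Hom C X' Y' e.
        FM (TensM C f g) = TensM D (FM f) (FM g))"


section \<open>The supercategory \<open>Q(z)\<close>\<close>

text \<open>Objects are words in the two generating objects.  Morphisms are formal homogeneous
  terms modulo the smallest congruence containing the axioms of a strict monoidal
  supercategory and the defining relations.\<close>

datatype updown = Up | Dn

datatype qgen = UPlus | UMinus | RMinus | CapL | CupL | Cdot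

datatype 'k qterm =
    QGen qgen
  | QId "updown list"
  | QZero "updown list" "updown list" bit
  | QAdd "'k qterm" "'k qterm"
  | QScale 'k "'k qterm"
  | QComp "'k qterm" "'k qterm"  (infixr \<open>\<circ>\<^sub>Q\<close> 70)
  | QTens "'k qterm" "'k qterm"  (infixr \<open>\<otimes>\<^sub>Q\<close> 75)

fun gdom :: "qgen \<Rightarrow> updown list" where
  "gdom UPlus = [Up, Up]" | "gdom UMinus = [Up, Up]" | "gdom RMinus = [Up, Dn]"
| "gdom CapL = [Dn, Up]" | "gdom CupL = []" | "gdom Cdot = [Up]"

fun gcod :: "qgen \<Rightarrow> updown list" where
  "gcod UPlus = [Up, Up]" | "gcod UMinus = [Up, Up]" | "gcod RMinus = [Dn, Up]"
| "gcod CapL = []" | "gcod CupL = [Up, Dn]" | "gcod Cdot = [Up]"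

definition gpar :: "qgen \<Rightarrow> bit"
  where "gpar g = (if g = Cdot then 1 else 0)"

primrec qdom :: "'k qterm \<Rightarrow> updown list" where
  "qdom (QGen g) = gdom g"
| "qdom (QId X) = X"
| "qdom (QZero X Y e) = X"
| "qdom (QAdd s t) = qdom s"
| "qdom (QScale a t) = qdom t"
| "qdom (s \<circ>\<^sub>Q t) = qdom t"
| "qdom (s \<otimes>\<^sub>Q t) = qdom s @ qdom t"

primrec qcod :: "'k qterm \<Rightarrow> updown list" where
  "qcod (QGen g) = gcod g"
| "qcod (QId X) = X"
| "qcod (QZero X Y e) = Y"
| "qcod (QAdd s t) = qcod s"
| "qcod (QScale a t) = qcod t"
| "qcod (s \<circ>\<^sub>Q t) = qcod s"
| "qcod (s \<otimes>\<^sub>Q t) = qcod s @ qcod t"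

primrec qpar :: "'k qterm \<Rightarrow> bit" where
  "qpar (QGen g) = gpar g"
| "qpar (QId X) = 0"
| "qpar (QZero X Y e) = e"
| "qpar (QAdd s t) = qpar s"
| "qpar (QScale a t) = qpar t"
| "qpar (s \<circ>\<^sub>Q t) = qpar s + qpar t"
| "qpar (s \<otimes>\<^sub>Q t) = qpar s + qpar t"

primrec qwf :: "'k qterm \<Rightarrow> bool" where
  "qwf (QGen g) \<longleftrightarrow> True"
| "qwf (QId X) \<longleftrightarrow> True"
| "qwf (QZero X Y e) \<longleftrightarrow> True"
| "qwf (QAdd s t) \<longleftrightarrow> qwf s \<and> qwf t \<and> qdom s = qdom t \<and> qcod s = qcod t \<and> qpar s = qpar t"
| "qwf (QScale a t) \<longleftrightarrow> qwf t"
| "qwf (s \<circ>\<^sub>Q t) \<longleftrightarrow> qwf s \<and> qwf t \<and> qdom s = qcod t"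
| "qwf (s \<otimes>\<^sub>Q t) \<longleftrightarrow> qwf s \<and> qwf t"

abbreviation "q1up \<equiv> QId [Up]"
abbreviation "q1dn \<equiv> QId [Dn]"

definition lplus :: "'k qterm" where
  "lplus = (QGen CapL \<otimes>\<^sub>Q q1up \<otimes>\<^sub>Q q1dn) \<circ>\<^sub>Q (q1dn \<otimes>\<^sub>Q QGen UPlus \<otimes>\<^sub>Q q1dn)
             \<circ>\<^sub>Q (q1dn \<otimes>\<^sub>Q q1up \<otimes>\<^sub>Q QGen CupL)"

definition capR :: "'k qterm" where
  "capR = QGen CapL \<circ>\<^sub>Q QGen RMinus"

text \<open>The equations are listed for raw terms; \<open>qeq\<close> only uses those instances of which both
  sides are well-formed.\<close>

inductive qax :: "'k::field \<Rightarrow> 'k qterm \<Rightarrow> 'k qterm \<Rightarrow> bool" for z :: 'k where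
  \<comment> \<open>morphism spaces are vector spaces\<close>
  "qax z (QAdd (QAdd r s) t) (QAdd r (QAdd s t))"
| "qax z (QAdd s t) (QAdd t s)"
| "qax z (QAdd t (QZero (qdom t) (qcod t) (qpar t))) t"
| "qax z (QAdd t (QScale (-1) t)) (QZero (qdom t) (qcod t) (qpar t))"
| "qax z (QScale a (QAdd s t)) (QAdd (QScale a s) (QScale a t))"
| "qax z (QScale (a + b) t) (QAdd (QScale a t) (QScale b t))"
| "qax z (QScale (a * b) t) (QScale a (QScale b t))"
| "qax z (QScale 1 t) t"
  \<comment> \<open>composition and tensor product are bilinear\<close>
| "qax z (QAdd r s \<circ>\<^sub>Q t) (QAdd (r \<circ>\<^sub>Q t) (s \<circ>\<^sub>Q t))"
| "qax z (r \<circ>\<^sub>Q QAdd s t) (QAdd (r \<circ>\<^sub>Q s) (r \<circ>\<^sub>Q t))"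
| "qax z (QScale a s \<circ>\<^sub>Q t) (QScale a (s \<circ>\<^sub>Q t))"
| "qax z (s \<circ>\<^sub>Q QScale a t) (QScale a (s \<circ>\<^sub>Q t))"
| "qax z (QAdd r s \<otimes>\<^sub>Q t) (QAdd (r \<otimes>\<^sub>Q t) (s \<otimes>\<^sub>Q t))"
| "qax z (r \<otimes>\<^sub>Q QAdd s t) (QAdd (r \<otimes>\<^sub>Q s) (r \<otimes>\<^sub>Q t))"
| "qax z (QScale a s \<otimes>\<^sub>Q t) (QScale a (s \<otimes>\<^sub>Q t))"
| "qax z (s \<otimes>\<^sub>Q QScale a t) (QScale a (s \<otimes>\<^sub>Q t))"
  \<comment> \<open>strict monoidal supercategory\<close>
| "qax z ((r \<circ>\<^sub>Q s) \<circ>\<^sub>Q t) (r \<circ>\<^sub>Q (s \<circ>\<^sub>Q t))"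
| "qax z (QId (qcod t) \<circ>\<^sub>Q t) t"
| "qax z (t \<circ>\<^sub>Q QId (qdom t)) t"
| "qax z ((r \<otimes>\<^sub>Q s) \<otimes>\<^sub>Q t) (r \<otimes>\<^sub>Q (s \<otimes>\<^sub>Q t))"
| "qax z (QId [] \<otimes>\<^sub>Q t) t"
| "qax z (t \<otimes>\<^sub>Q QId []) t"
| "qax z (QId X \<otimes>\<^sub>Q QId Y) (QId (X @ Y))"
| interchange:
  "qax z ((f' \<otimes>\<^sub>Q g) \<circ>\<^sub>Q (f \<otimes>\<^sub>Q g'))
         (QScale (psign (qpar f * qpar g)) ((f' \<circ>\<^sub>Q f) \<otimes>\<^sub>Q (g \<circ>\<^sub>Q g')))"
  \<comment> \<open>defining relations\<close>
| "qax z (QGen UMinus \<circ>\<^sub>Q QGen UPlus) (QId [Up, Up])"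
| "qax z (QGen UPlus \<circ>\<^sub>Q QGen UMinus) (QId [Up, Up])"
| "qax z (lplus \<circ>\<^sub>Q QGen RMinus) (QId [Up, Dn])"
| "qax z (QGen RMinus \<circ>\<^sub>Q lplus) (QId [Dn, Up])"
| "qax z ((QGen UPlus \<otimes>\<^sub>Q q1up) \<circ>\<^sub>Q (q1up \<otimes>\<^sub>Q QGen UPlus) \<circ>\<^sub>Q (QGen UPlus \<otimes>\<^sub>Q q1up))
         ((q1up \<otimes>\<^sub>Q QGen UPlus) \<circ>\<^sub>Q (QGen UPlus \<otimes>\<^sub>Q q1up) \<circ>\<^sub>Q (q1up \<otimes>\<^sub>Q QGen UPlus))"
| "qax z (QAdd (QGen UPlus) (QScale (-1) (QGen UMinus))) (QScale z (QId [Up, Up]))"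
| "qax z (QGen Cdot \<circ>\<^sub>Q QGen Cdot) (QScale (-1) q1up)"
| "qax z (QGen UPlus \<circ>\<^sub>Q (QGen Cdot \<otimes>\<^sub>Q q1up)) ((q1up \<otimes>\<^sub>Q QGen Cdot) \<circ>\<^sub>Q QGen UPlus)"
| "qax z (capR \<circ>\<^sub>Q (QGen Cdot \<otimes>\<^sub>Q q1dn) \<circ>\<^sub>Q QGen CupL) (QZero [] [] 1)"
| "qax z (capR \<circ>\<^sub>Q QGen CupL) (QZero [] [] 0)"
| "qax z ((q1up \<otimes>\<^sub>Q QGen CapL) \<circ>\<^sub>Q (QGen CupL \<otimes>\<^sub>Q q1up)) q1up"
| "qax z ((QGen CapL \<otimes>\<^sub>Q q1dn) \<circ>\<^sub>Q (q1dn \<otimes>\<^sub>Q QGen CupL)) q1dn"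

inductive qeq :: "'k::field \<Rightarrow> 'k qterm \<Rightarrow> 'k qterm \<Rightarrow> bool" for z :: 'k where
  ax: "qax z s t \<Longrightarrow> qwf s \<Longrightarrow> qwf t \<Longrightarrow> qeq z s t"
| refl: "qwf t \<Longrightarrow> qeq z t t"
| sym: "qeq z s t \<Longrightarrow> qeq z t s"
| trans: "qeq z r s \<Longrightarrow> qeq z s t \<Longrightarrow> qeq z r t"
| add: "qeq z s s' \<Longrightarrow> qeq z t t' \<Longrightarrow> qwf (QAdd s t) \<Longrightarrow> qeq z (QAdd s t) (QAdd s' t')"
| scale: "qeq z t t' \<Longrightarrow> qeq z (QScale a t) (QScale a t')"
| comp: "qeq z s s' \<Longrightarrow> qeq z t t' \<Longrightarrow> qwf (s \<circ>\<^sub>Q t) \<Longrightarrow> qeq z (s \<circ>\<^sub>Q t) (s' \<circ>\<^sub>Q t')"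
| tens: "qeq z s s' \<Longrightarrow> qeq z t t' \<Longrightarrow> qeq z (s \<otimes>\<^sub>Q t) (s' \<otimes>\<^sub>Q t')"

lemma qax_typed:
  "qax z s t \<Longrightarrow> qwf s \<Longrightarrow> qwf t \<Longrightarrow> qdom s = qdom t \<and> qcod s = qcod t \<and> qpar s = qpar t"
  by (induction rule: qax.induct) (auto simp: lplus_def capR_def gpar_def ac_simps)

lemma qeq_typed:
  "qeq z s t \<Longrightarrow> qwf s \<and> qwf t \<and> qdom s = qdom t \<and> qcod s = qcod t \<and> qpar s = qpar t"
  by (induction rule: qeq.induct) (auto dest: qax_typed)

type_synonym 'k qmor = "'k qterm set"  (* congruence classes *)

definition qclass :: "'k::field \<Rightarrow> 'k qterm \<Rightarrow> 'k qmor"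
  where "qclass z t = {s. qeq z t s}"

definition Qcat :: "'k::field \<Rightarrow> (updown list, 'k qmor, 'k) monoidal_supercat" where
  "Qcat z = \<lparr>
     Ob = UNIV,
     Hom = (\<lambda>X Y e. {qclass z t | t. qwf t \<and> qdom t = X \<and> qcod t = Y \<and> qpar t = e}),
     Plus = (\<lambda>A B. \<Union>s\<in>A. \<Union>t\<in>B. qclass z (QAdd s t)),
     Scale = (\<lambda>a A. \<Union>t\<in>A. qclass z (QScale a t)),
     Idt = (\<lambda>X. qclass z (QId X)),
     Comp = (\<lambda>A B. \<Union>s\<in>A. \<Union>t\<in>B. qclass z (s \<circ>\<^sub>Q t)),
     UnitO = [],
     TensO = (@),
     TensM = (\<lambda>A B. \<Union>s\<in>A. \<Union>t\<in>B. qclass z (s \<otimes>\<^sub>Q t)) \<rparr>"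


section \<open>The index set and the element Theta\<close>

definition II :: "nat \<Rightarrow> int set"
  where "II n = {- int n .. int n} - {0}"

definition pr :: "int \<Rightarrow> bit"
  where "pr i = (if i > 0 then 0 else 1)"

definition phi :: "int \<Rightarrow> int \<Rightarrow> int"
  where "phi i j = (if \<bar>i\<bar> = \<bar>j\<bar> then (if j > 0 then 1 else - 1) else 0)"

text \<open>\<open>Theta i j k l\<close> is the coefficient of \<open>E\<^sub>i\<^sub>j \<otimes> E\<^sub>k\<^sub>l\<close> in Theta, so that
  the endomorphism \<open>Theta\<^sub>k\<^sub>l\<close> has matrix entries \<open>Theta i j k l\<close>.\<close>

definition Theta :: "int \<Rightarrow> int \<Rightarrow> int \<Rightarrow> int \<Rightarrow> Cq" where
  "Theta i j k l =
     (if i = j \<and> k = l then qvar powi phi i k else 0)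
   + zvar * (if k < l then psign (pr k) *
        ((if i = l \<and> j = k then 1 else 0) + (if i = - l \<and> j = - k then 1 else 0)) else 0)"


section \<open>The quantum isomeric superalgebra\<close>

text \<open>The free algebra on a set of letters is the monoid algebra of the free monoid,
  which is a copy of lists under concatenation (written additively, as in the convolution
  product of polynomial mappings).\<close>

datatype 'a fmon = FMon (letters: "'a list")

instantiation fmon :: (type) monoid_add
begin

definition zero_fmon :: "'a fmon" where "0 = FMon []"

definition plus_fmon :: "'a fmon \<Rightarrow> 'a fmon \<Rightarrow> 'a fmon"
  where "v + w = FMon (letters v @ letters w)"

instance by standard (auto simp: zero_fmon_def plus_fmon_def)

end

type_synonym falg = "(int \<times> int) fmon \<Rightarrow>\<^sub>0 Cq"

definition Uq_gens :: "nat \<Rightarrow> (int \<times> int) set"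
  where "Uq_gens n = {(i, j). i \<in> II n \<and> j \<in> II n \<and> i \<le> j}"

definition ugen :: "int \<Rightarrow> int \<Rightarrow> falg"
  where "ugen i j = Poly_Mapping.single (FMon [(i, j)]) 1"

definition fscalar :: "Cq \<Rightarrow> falg"
  where "fscalar a = Poly_Mapping.single 0 a"

definition word_par :: "(int \<times> int) fmon \<Rightarrow> bit"
  where "word_par w = (\<Sum>(i, j)\<leftarrow>letters w. pr i + pr j)"

definition falg_on :: "nat \<Rightarrow> falg set"
  where "falg_on n = {x. \<forall>w\<in>Poly_Mapping.keys x. set (letters w) \<subseteq> Uq_gens n}"

definition falg_hom :: "nat \<Rightarrow> bit \<Rightarrow> falg set"  (* homogeneous elements of parity e *)
  where "falg_hom n e = {x \<in> falg_on n. \<forall>w\<in>Poly_Mapping.keys x. word_par w = e}"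

text \<open>Even elements of \<open>A \<otimes> End(V) \<otimes> End(V)\<close>, with \<open>A\<close> the free superalgebra, are families of
  coefficients \<open>X i j k l\<close> of \<open>E\<^sub>i\<^sub>j \<otimes> E\<^sub>k\<^sub>l\<close>.  Since the elements are even, the coefficient \<open>Y j m l r\<close>
  has the parity of \<open>E\<^sub>j\<^sub>m \<otimes> E\<^sub>l\<^sub>r\<close>; the Koszul sign in \<open>EE_mult\<close> is the one for moving it past
  \<open>E\<^sub>i\<^sub>j \<otimes> E\<^sub>k\<^sub>l\<close>, and \<open>E\<^sub>j\<^sub>m\<close> past \<open>E\<^sub>k\<^sub>l\<close>.\<close>

type_synonym aEE = "int \<Rightarrow> int \<Rightarrow> int \<Rightarrow> int \<Rightarrow> falg"

definition EE_mult :: "nat \<Rightarrow> aEE \<Rightarrow> aEE \<Rightarrow> aEE" where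
  "EE_mult n X Y = (\<lambda>i m k r. \<Sum>j\<in>II n. \<Sum>l\<in>II n.
     psign ((pr i + pr j + pr k + pr l) * (pr j + pr m + pr l + pr r) + (pr k + pr l) * (pr j + pr m))
       * (X i j k l * Y j m l r))"

definition Lcoef :: "int \<Rightarrow> int \<Rightarrow> falg"  (* L is the sum of the Lcoef i j tensor E_ij *)
  where "Lcoef i j = (if i \<le> j then ugen i j else 0)"

definition L12 :: aEE where "L12 i j k l = (if k = l then Lcoef i j else 0)"
definition L13 :: aEE where "L13 i j k l = (if i = j then Lcoef k l else 0)"
definition Theta23 :: aEE where "Theta23 i j k l = fscalar (Theta i j k l)"

inductive_set Uq_ideal :: "nat \<Rightarrow> falg set" for n :: nat where
  inv: "i \<in> II n \<Longrightarrow> ugen i i * ugen (- i) (- i) - 1 \<in> Uq_ideal n"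
| RLL: "i \<in> II n \<Longrightarrow> j \<in> II n \<Longrightarrow> k \<in> II n \<Longrightarrow> l \<in> II n \<Longrightarrow>
     EE_mult n (EE_mult n L12 L13) Theta23 i j k l
   - EE_mult n (EE_mult n Theta23 L13) L12 i j k l \<in> Uq_ideal n"
| zero: "0 \<in> Uq_ideal n"
| add: "x \<in> Uq_ideal n \<Longrightarrow> y \<in> Uq_ideal n \<Longrightarrow> x + y \<in> Uq_ideal n"
| mult: "x \<in> Uq_ideal n \<Longrightarrow> a \<in> falg_on n \<Longrightarrow> b \<in> falg_on n \<Longrightarrow> a * x * b \<in> Uq_ideal n"

text \<open>\<open>U\<^sub>q\<close> is \<open>falg_on n\<close> modulo \<open>Uq_ideal n\<close>; its elements are handled through representatives
  in the free superalgebra, with \<open>Uq_eq n\<close> as equality.\<close>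

definition Uq_eq :: "nat \<Rightarrow> falg \<Rightarrow> falg \<Rightarrow> bool"
  where "Uq_eq n x y \<longleftrightarrow> x \<in> falg_on n \<and> y \<in> falg_on n \<and> x - y \<in> Uq_ideal n"

text \<open>The antipode on generators: the sum of the \<open>S(u\<^sub>i\<^sub>j) \<otimes> E\<^sub>i\<^sub>j\<close> over \<open>i \<le> j\<close> is the two-sided
  inverse of \<open>L\<close> in the superalgebra \<open>U\<^sub>q \<otimes> End(V)\<close>.  This determines \<open>S(u\<^sub>i\<^sub>j)\<close> as an element of \<open>U\<^sub>q\<close>,
  that is, up to \<open>Uq_eq\<close>.\<close>

definition is_antipode :: "nat \<Rightarrow> (int \<Rightarrow> int \<Rightarrow> falg) \<Rightarrow> bool" where
  "is_antipode n s \<longleftrightarrow>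
     (\<forall>i\<in>II n. \<forall>j\<in>II n. s i j \<in> falg_hom n (pr i + pr j) \<and> (j < i \<longrightarrow> s i j = 0)) \<and>
     (\<forall>i\<in>II n. \<forall>k\<in>II n.
        Uq_eq n (\<Sum>j\<in>II n. psign ((pr i + pr j) * (pr j + pr k)) * (Lcoef i j * s j k))
                (if i = k then 1 else 0) \<and>
        Uq_eq n (\<Sum>j\<in>II n. psign ((pr i + pr j) * (pr j + pr k)) * (s i j * Lcoef j k))
                (if i = k then 1 else 0))"

definition Uq_antipode :: "nat \<Rightarrow> int \<Rightarrow> int \<Rightarrow> falg"
  where "Uq_antipode n = (SOME s. is_antipode n s)"


section \<open>Finite-dimensional supermodules over the quantum isomeric superalgebra\<close>

text \<open>A finite-dimensional superspace has a homogeneous basis, and is taken in coordinates with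
  respect to such a basis: its basis vectors are labelled by a finite set of integer words, all
  of the same length, and \<open>par w\<close> is the parity of the basis vector labelled \<open>w\<close> (set to \<open>0\<close> off
  the basis).  Linear maps are matrices, \<open>A a b\<close> being the coefficient of the basis vector \<open>a\<close>
  in the image of the basis vector \<open>b\<close>.  The basis of a tensor product consists of the
  concatenated words, the word \<open>v @ w\<close> labelling the tensor product of the basis vectors labelled
  \<open>v\<close> and \<open>w\<close>; fixing the word length makes this unambiguous, and makes the tensor product
  strictly associative.

  The action is recorded on the generators: \<open>gact (i, j)\<close> is the matrix of \<open>u\<^sub>i\<^sub>j\<close>.\<close>

type_synonym cmat = "int list \<Rightarrow> int list \<Rightarrow> Cq"

record smodule =
  wlen :: nat
  bas :: "int list set"
  par :: "int list \<Rightarrow> bit"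
  gact :: "int \<times> int \<Rightarrow> cmat"

primrec word_act :: "smodule \<Rightarrow> (int \<times> int) list \<Rightarrow> cmat" where
  "word_act M [] = (\<lambda>a b. if a = b \<and> a \<in> bas M then 1 else 0)"
| "word_act M (u # us) = (\<lambda>a b. \<Sum>c\<in>bas M. gact M u a c * word_act M us c b)"

definition act :: "smodule \<Rightarrow> falg \<Rightarrow> cmat" where
  "act M x = (\<lambda>a b. \<Sum>w\<in>Poly_Mapping.keys x. Poly_Mapping.lookup x w * word_act M (letters w) a b)"

definition is_smodule :: "nat \<Rightarrow> smodule \<Rightarrow> bool" where
  "is_smodule n M \<longleftrightarrow>
     finite (bas M) \<and> (\<forall>w\<in>bas M. length w = wlen M) \<and> (\<forall>w. w \<notin> bas M \<longrightarrow> par M w = 0) \<and>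
     (\<forall>i j a b. gact M (i, j) a b \<noteq> 0 \<longrightarrow>
        (i, j) \<in> Uq_gens n \<and> a \<in> bas M \<and> b \<in> bas M \<and> par M a + par M b = pr i + pr j) \<and>
     (\<forall>x y. Uq_eq n x y \<longrightarrow> act M x = act M y)"

text \<open>The counit and the coproduct, evaluated on generators.\<close>

definition smod_unit :: "nat \<Rightarrow> smodule" where
  "smod_unit n = \<lparr> wlen = 0, bas = {[]}, par = (\<lambda>w. 0),
     gact = (\<lambda>(i, j) a b. if (i, j) \<in> Uq_gens n \<and> i = j \<and> a = [] \<and> b = [] then 1 else 0) \<rparr>"

definition smod_tensor :: "nat \<Rightarrow> smodule \<Rightarrow> smodule \<Rightarrow> smodule" where
  "smod_tensor n M N = \<lparr>
     wlen = wlen M + wlen N,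
     bas = {v @ w | v w. v \<in> bas M \<and> w \<in> bas N},
     par = (\<lambda>x. if take (wlen M) x \<in> bas M \<and> drop (wlen M) x \<in> bas N
                then par M (take (wlen M) x) + par N (drop (wlen M) x) else 0),
     gact = (\<lambda>(i, j) x y. \<Sum>k\<in>{k \<in> II n. i \<le> k \<and> k \<le> j}.
        psign ((pr k + pr j) * par M (take (wlen M) y))
          * gact M (i, k) (take (wlen M) x) (take (wlen M) y)
          * gact N (k, j) (drop (wlen M) x) (drop (wlen M) y)) \<rparr>"

text \<open>The dual module; the word \<open>b\<close> now labels the dual basis vector, and the entry at \<open>a\<close>, \<open>b\<close>
  is the value of \<open>u\<^sub>i\<^sub>j\<close> applied to that dual basis vector, on the basis vector \<open>a\<close>.\<close>

definition smod_dual :: "nat \<Rightarrow> smodule \<Rightarrow> smodule" where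
  "smod_dual n M = M \<lparr> gact := (\<lambda>(i, j) a b.
     if (i, j) \<in> Uq_gens n
     then psign ((pr i + pr j) * par M b) * act M (Uq_antipode n i j) b a else 0) \<rparr>"

record smor =
  src :: smodule
  tgt :: smodule
  mpar :: bit
  mat :: cmat

definition smod_Hom :: "nat \<Rightarrow> smodule \<Rightarrow> smodule \<Rightarrow> bit \<Rightarrow> smor set" where
  "smod_Hom n M N e = {f. src f = M \<and> tgt f = N \<and> mpar f = e \<and>
     (\<forall>a b. mat f a b \<noteq> 0 \<longrightarrow> a \<in> bas N \<and> b \<in> bas M \<and> par N a + par M b = e) \<and>
     (\<forall>d. \<forall>x\<in>falg_hom n d. \<forall>a\<in>bas N. \<forall>b\<in>bas M.
        (\<Sum>c\<in>bas M. mat f a c * act M x c b)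
          = psign (e * d) * (\<Sum>c\<in>bas N. act N x a c * mat f c b))}"

definition smor_id :: "smodule \<Rightarrow> smor" where
  "smor_id M = \<lparr> src = M, tgt = M, mpar = 0, mat = (\<lambda>a b. if a = b \<and> a \<in> bas M then 1 else 0) \<rparr>"

definition smor_comp :: "smor \<Rightarrow> smor \<Rightarrow> smor" where
  "smor_comp g f = \<lparr> src = src f, tgt = tgt g, mpar = mpar g + mpar f,
     mat = (\<lambda>a c. \<Sum>b\<in>bas (tgt f). mat g a b * mat f b c) \<rparr>"

definition smor_tensor :: "nat \<Rightarrow> smor \<Rightarrow> smor \<Rightarrow> smor" where
  "smor_tensor n f g = \<lparr>
     src = smod_tensor n (src f) (src g), tgt = smod_tensor n (tgt f) (tgt g),
     mpar = mpar f + mpar g,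
     mat = (\<lambda>x y. psign (mpar g * par (src f) (take (wlen (src f)) y))
                * mat f (take (wlen (tgt f)) x) (take (wlen (src f)) y)
                * mat g (drop (wlen (tgt f)) x) (drop (wlen (src f)) y)) \<rparr>"

definition Uq_smod :: "nat \<Rightarrow> (smodule, smor, Cq) monoidal_supercat" where
  "Uq_smod n = \<lparr>
     Ob = {M. is_smodule n M},
     Hom = smod_Hom n,
     Plus = (\<lambda>f g. f \<lparr> mat := (\<lambda>a b. mat f a b + mat g a b) \<rparr>),
     Scale = (\<lambda>r f. f \<lparr> mat := (\<lambda>a b. r * mat f a b) \<rparr>),
     Idt = smor_id,
     Comp = smor_comp,
     UnitO = smod_unit n,
     TensO = smod_tensor n,
     TensM = smor_tensor n \<rparr>"


section \<open>The supermodule \<open>V\<close> and the maps between its tensor powers\<close>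

definition Vmod :: "nat \<Rightarrow> smodule" where
  "Vmod n = \<lparr> wlen = 1, bas = {[i] | i. i \<in> II n},
     par = (\<lambda>w. if w \<in> {[i] | i. i \<in> II n} then pr (hd w) else 0),
     gact = (\<lambda>(i, j) a b. if (i, j) \<in> Uq_gens n \<and> a \<in> {[k] | k. k \<in> II n} \<and> b \<in> {[k] | k. k \<in> II n}
                         then Theta (hd a) (hd b) i j else 0) \<rparr>"

abbreviation Vdual :: "nat \<Rightarrow> smodule"  (* the word [i] labels v_i^* *)
  where "Vdual n \<equiv> smod_dual n (Vmod n)"

abbreviation VV :: "nat \<Rightarrow> smodule"
  where "VV n \<equiv> smod_tensor n (Vmod n) (Vmod n)"

definition flip_map :: "nat \<Rightarrow> smor" where
  "flip_map n = \<lparr> src = VV n, tgt = VV n, mpar = 0,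
     mat = (\<lambda>x y. if y \<in> bas (VV n) \<and> x = [y ! 1, y ! 0] then psign (pr (y ! 0) * pr (y ! 1)) else 0) \<rparr>"

text \<open>The sign comes from \<open>(E\<^sub>i\<^sub>j \<otimes> E\<^sub>k\<^sub>l)(v\<^sub>j \<otimes> v\<^sub>l) = \<plusminus> v\<^sub>i \<otimes> v\<^sub>k\<close>.\<close>

definition Theta_map :: "nat \<Rightarrow> smor" where
  "Theta_map n = \<lparr> src = VV n, tgt = VV n, mpar = 0,
     mat = (\<lambda>x y. if x \<in> bas (VV n) \<and> y \<in> bas (VV n)
        then psign ((pr (x ! 1) + pr (y ! 1)) * pr (y ! 0)) * Theta (x ! 0) (y ! 0) (x ! 1) (y ! 1)
        else 0) \<rparr>"

definition Tmap :: "nat \<Rightarrow> smor"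
  where "Tmap n = smor_comp (flip_map n) (Theta_map n)"

definition ev :: "nat \<Rightarrow> smor" where
  "ev n = \<lparr> src = smod_tensor n (Vdual n) (Vmod n), tgt = smod_unit n, mpar = 0,
     mat = (\<lambda>x y. if x = [] \<and> (\<exists>i\<in>II n. y = [i, i]) then 1 else 0) \<rparr>"

definition coev :: "nat \<Rightarrow> smor" where
  "coev n = \<lparr> src = smod_unit n, tgt = smod_tensor n (Vmod n) (Vdual n), mpar = 0,
     mat = (\<lambda>x y. if y = [] \<and> (\<exists>i\<in>II n. x = [i, i]) then 1 else 0) \<rparr>"

definition Jmap :: "nat \<Rightarrow> smor" where
  "Jmap n = \<lparr> src = Vmod n, tgt = Vmod n, mpar = 1,
     mat = (\<lambda>x y. if \<exists>i\<in>II n. y = [i] \<and> x = [- i] then psign (pr (hd y)) else 0) \<rparr>"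

definition image_of :: "smor \<Rightarrow> int list \<Rightarrow> int list \<Rightarrow> Cq"  (* f applied to the basis vector w *)
  where "image_of f w = (\<lambda>x. mat f x w)"

definition bvec :: "int list \<Rightarrow> int list \<Rightarrow> Cq"  (* the basis vector labelled w *)
  where "bvec w = (\<lambda>x. if x = w then 1 else 0)"


section \<open>The functor \<open>F\<^sub>n\<close>\<close>

definition is_Fn ::
  "nat \<Rightarrow> (updown list \<Rightarrow> smodule) \<Rightarrow> (Cq qmor \<Rightarrow> smor) \<Rightarrow> bool" where
  "is_Fn n FO FM \<longleftrightarrow>
     monoidal_superfunctor (Qcat zvar) (Uq_smod n) FO FM \<and>
     FO [Up] = Vmod n \<and> FO [Dn] = Vdual n \<and>
     FM (qclass zvar (QGen UPlus)) = Tmap n \<and>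
     FM (qclass zvar (QGen CapL)) = ev n \<and>
     FM (qclass zvar (QGen Cdot)) = Jmap n"

end

theory Submission
  imports Defs
begin

text \<open>All Koszul signs of the presentation disappear when the action of \<open>U\<^sub>q\<close> on a supermodule \<open>M\<close> is
  recorded as one even map \<open>M \<otimes> V \<rightarrow> V \<otimes> M\<close>, the flip composed with the image of \<open>L\<close>.  The RLL relation
  becomes a hexagon identity for this map and the morphism condition becomes naturality; both pass
  to tensor products by formal manipulations with the interchange law.  On \<open>V\<close> this map is \<open>T\<close>, so the
  hexagon is the braid relation, and on the dual of \<open>V\<close> it is the mate of \<open>T\<^sup>-\<^sup>1 = T - z\<close>.  On a
  basis vector \<open>T\<close> has only three terms, depending on the order type and the signs of the indices,
  which reduces the braid relation to finitely many cases.  The image of \<open>r\<^sup>-\<close> inverts the mate of \<open>T\<close>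
  because the sums of \<open>z psign (pr k) q powi (-2 |k|)\<close> over consecutive \<open>k\<close> telescope.\<close>

text \<open>The signs can vanish because parity is monotone on the ordered index set while all
  actions are triangular: along a chain i <= k <= j the index k has the parity of i or of j, and on
  such chains the signs of the coproduct and of the antipode become trivial or split into factors.
  The main obstacle is the dual of \<open>V\<close>: its action goes through an antipode chosen by
  \<open>SOME\<close> in a quotient of a free algebra. The antipode is therefore constructed first,
  by inverting the triangular matrix L; its effect on \<open>V\<close> then follows from the
  uniqueness of matrix inverses, for which \<open>V\<close> must already satisfy the relations. The
  explicit formula for r^- is never checked for equivariance directly: naturality passes from the
  mate of T to its inverse. For uniqueness the remaining generators are forced in turn: cup_L by a
  zigzag identity, u^- as the inverse of T, r^- as the inverse of the mate, which contains cup_L. In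
  the relation cap_R cup_L = 0 it is z times the relevant sum that telescopes, so z has to be
  cancelled.\<close>

section \<open>Signs\<close>

text \<open>These simp rules turn sums and products of parities into Boolean conditions.\<close>

declare Z2.add_bit_eq_xor [simp del] Z2.mult_bit_eq_and [simp del]

lemma bit_add_self [simp]: "(x::bit) + x = 0" "x + (x + y) = y"
  by (cases x; cases y; simp)+

lemma bit_add_eq_0_iff [simp]: "(x::bit) + y = 0 \<longleftrightarrow> x = y"
  by (cases x; cases y; simp)

lemma bit_mult_self [simp]: "(x::bit) * x = x" "x * (x * y) = x * y"
  by (cases x; cases y; simp)+

lemma psign_0 [simp]: "psign 0 = 1" and psign_1 [simp]: "psign 1 = - 1"
  by (simp_all add: psign_def)

lemma psign_add: "psign (x + y) = psign x * psign y"
  by (cases x; cases y; simp)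

lemma psign_square [simp]: "psign x * psign x = (1::'a::comm_ring_1)"
  "psign x * (psign x * y) = (y::'a::comm_ring_1)"
  by (cases x; simp)+

lemma psign_nonzero [simp]: "psign x \<noteq> (0::'a::{ring_1,zero_neq_one})"
  by (cases x; simp)

lemma finite_II [simp]: "finite (II n)"
  by (simp add: II_def)

lemma uminus_II [simp]: "- i \<in> II n \<longleftrightarrow> i \<in> II n"
  by (auto simp: II_def)

lemma II_nonzero: "i \<in> II n \<Longrightarrow> i \<noteq> 0"
  by (simp add: II_def)

lemma pr_uminus: "i \<noteq> 0 \<Longrightarrow> pr (- i) = pr i + 1"
  by (auto simp: pr_def)


section \<open>Supermodules and matrices without the defining relations\<close>

text \<open>Weaker than \<open>is_smodule\<close>: the defining relations are dropped. Being closed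
  under tensor products by direct computation, it carries the whole matrix calculus before the
  relations are known on a tensor product.\<close>

definition presmod :: "nat \<Rightarrow> smodule \<Rightarrow> bool" where
  "presmod n M \<longleftrightarrow>
     finite (bas M) \<and> (\<forall>w\<in>bas M. length w = wlen M) \<and> (\<forall>w. w \<notin> bas M \<longrightarrow> par M w = 0) \<and>
     (\<forall>i j a b. gact M (i, j) a b \<noteq> 0 \<longrightarrow>
        (i, j) \<in> Uq_gens n \<and> a \<in> bas M \<and> b \<in> bas M \<and> par M a + par M b = pr i + pr j)"

text \<open>Equivariance is left out, because the braidings \<open>Lt n M\<close> have to be
  composed with other maps before anything is known about their equivariance.\<close>

definition premor :: "nat \<Rightarrow> smor \<Rightarrow> bool" where
  "premor n f \<longleftrightarrow> presmod n (src f) \<and> presmod n (tgt f) \<and>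
     (\<forall>a b. mat f a b \<noteq> 0 \<longrightarrow>
        a \<in> bas (tgt f) \<and> b \<in> bas (src f) \<and> par (tgt f) a + par (src f) b = mpar f)"

lemma presmod_finite: "presmod n M \<Longrightarrow> finite (bas M)"
  and presmod_length: "presmod n M \<Longrightarrow> w \<in> bas M \<Longrightarrow> length w = wlen M"
  and presmod_par: "presmod n M \<Longrightarrow> w \<notin> bas M \<Longrightarrow> par M w = 0"
  and presmod_gact: "presmod n M \<Longrightarrow> gact M (i, j) a b \<noteq> 0 \<Longrightarrow>
    (i, j) \<in> Uq_gens n \<and> a \<in> bas M \<and> b \<in> bas M \<and> par M a + par M b = pr i + pr j"
  by (simp_all add: presmod_def)

lemma presmod_gact_0: "presmod n M \<Longrightarrow>
    (i, j) \<notin> Uq_gens n \<or> a \<notin> bas M \<or> b \<notin> bas M \<Longrightarrow> gact M (i, j) a b = 0"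
  using presmod_gact by blast

lemma presmod_gact_parity: "presmod n M \<Longrightarrow> gact M (i, j) a b \<noteq> 0 \<Longrightarrow>
    par M a = par M b + pr i + pr j"
  by (drule (1) presmod_gact, cases "par M a"; cases "par M b"; cases "pr i"; cases "pr j"; simp)

lemma premor_presmod: "premor n f \<Longrightarrow> presmod n (src f)" "premor n f \<Longrightarrow> presmod n (tgt f)"
  by (simp_all add: premor_def)

lemma premor_mat_0: "premor n f \<Longrightarrow> a \<notin> bas (tgt f) \<or> b \<notin> bas (src f) \<Longrightarrow> mat f a b = 0"
  unfolding premor_def by blast

lemma premor_parity: "premor n f \<Longrightarrow> mat f a b \<noteq> 0 \<Longrightarrow> par (tgt f) a = par (src f) b + mpar f"
  unfolding premor_def
  by (cases "par (tgt f) a"; cases "par (src f) b"; cases "mpar f"; force)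

lemma presmod_eqI:
  assumes "presmod n M" "presmod n N" "wlen M = wlen N" "bas M = bas N"
    and "\<And>w. w \<in> bas M \<Longrightarrow> par M w = par N w"
    and "\<And>i j a b. i \<in> II n \<Longrightarrow> j \<in> II n \<Longrightarrow> a \<in> bas M \<Longrightarrow> b \<in> bas M \<Longrightarrow>
      gact M (i, j) a b = gact N (i, j) a b"
  shows "M = N"
proof (rule smodule.equality)
  show "par M = par N"
    using assms(1,2,4,5) by (metis ext presmod_par)
  show "gact M = gact N"
  proof (intro ext, clarify)
    fix i j a b
    show "gact M (i, j) a b = gact N (i, j) a b"
    proof (cases "(i, j) \<in> Uq_gens n \<and> a \<in> bas M \<and> b \<in> bas M")
      case True
      then show ?thesis using assms(6) by (auto simp: Uq_gens_def)
    next
      case False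
      then show ?thesis using assms(1,2,4) presmod_gact_0 by metis
    qed
  qed
qed (use assms in auto)

lemma premor_eqI:
  assumes "premor n f" "premor n g" "src f = src g" "tgt f = tgt g" "mpar f = mpar g"
    and "\<And>a b. a \<in> bas (tgt f) \<Longrightarrow> b \<in> bas (src f) \<Longrightarrow> mat f a b = mat g a b"
  shows "f = g"
proof (rule smor.equality)
  show "mat f = mat g"
    using assms premor_mat_0 by (metis ext)
qed (use assms in auto)


subsection \<open>Tensor products of supermodules\<close>

lemma wlen_tensor [simp]: "wlen (smod_tensor n M N) = wlen M + wlen N"
  by (simp add: smod_tensor_def)

lemma bas_tensor: "bas (smod_tensor n M N) = {v @ w | v w. v \<in> bas M \<and> w \<in> bas N}"
  by (simp add: smod_tensor_def)

lemma bas_tensor_take_drop: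
  assumes "presmod n M"
  shows "x \<in> bas (smod_tensor n M N) \<longleftrightarrow> take (wlen M) x \<in> bas M \<and> drop (wlen M) x \<in> bas N"
proof
  assume "x \<in> bas (smod_tensor n M N)"
  then show "take (wlen M) x \<in> bas M \<and> drop (wlen M) x \<in> bas N"
    using presmod_length[OF assms] by (auto simp: bas_tensor)
next
  assume "take (wlen M) x \<in> bas M \<and> drop (wlen M) x \<in> bas N"
  moreover have "x = take (wlen M) x @ drop (wlen M) x" by simp
  ultimately show "x \<in> bas (smod_tensor n M N)" unfolding bas_tensor by blast
qed

lemma sum_bas_tensor:
  assumes "presmod n M"
  shows "(\<Sum>x\<in>bas (smod_tensor n M N). F x) = (\<Sum>v\<in>bas M. \<Sum>w\<in>bas N. F (v @ w))"
proof -
  have "(\<Sum>x\<in>bas (smod_tensor n M N). F x) = (\<Sum>(v, w)\<in>bas M \<times> bas N. F (v @ w))"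
    by (rule sum.reindex_bij_witness[where i = "\<lambda>(v, w). v @ w"
          and j = "\<lambda>x. (take (wlen M) x, drop (wlen M) x)"])
       (use assms presmod_length[OF assms] in \<open>auto simp: bas_tensor\<close>)
  then show ?thesis by (simp add: sum.cartesian_product)
qed

lemma par_tensor_append:
  assumes "presmod n M" "v \<in> bas M" "w \<in> bas N"
  shows "par (smod_tensor n M N) (v @ w) = par M v + par N w"
  using assms presmod_length[OF assms(1)] by (simp add: smod_tensor_def)

text \<open>Triangularity of both factors kills every \<open>k\<close> outside
  \<open>i <= k <= j\<close>, so the sum may run over the full index set and be swapped freely with
  other sums.\<close>

lemma gact_tensor:
  assumes "presmod n M" "presmod n N"
  shows "gact (smod_tensor n M N) (i, j) x y =
    (\<Sum>k\<in>II n. psign ((pr k + pr j) * par M (take (wlen M) y))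
          * gact M (i, k) (take (wlen M) x) (take (wlen M) y)
          * gact N (k, j) (drop (wlen M) x) (drop (wlen M) y))"
proof -
  have "i \<le> k" if "gact M (i, k) a b \<noteq> 0" for k a b
    using presmod_gact[OF assms(1) that] by (simp add: Uq_gens_def)
  moreover have "k \<le> j" if "gact N (k, j) a b \<noteq> 0" for k a b
    using presmod_gact[OF assms(2) that] by (simp add: Uq_gens_def)
  ultimately show ?thesis
    unfolding smod_tensor_def by (simp, intro sum.mono_neutral_left) auto
qed

lemma presmod_tensor:
  assumes M: "presmod n M" and N: "presmod n N"
  shows "presmod n (smod_tensor n M N)"
  unfolding presmod_def
proof (intro conjI allI impI ballI)
  have "bas (smod_tensor n M N) = (\<lambda>(v, w). v @ w) ` (bas M \<times> bas N)"
    by (auto simp: bas_tensor)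
  then show "finite (bas (smod_tensor n M N))"
    using presmod_finite[OF M] presmod_finite[OF N] by simp
next
  fix w assume "w \<in> bas (smod_tensor n M N)"
  then show "length w = wlen (smod_tensor n M N)"
    using presmod_length[OF M] presmod_length[OF N] by (auto simp: bas_tensor)
next
  fix w assume "w \<notin> bas (smod_tensor n M N)"
  then show "par (smod_tensor n M N) w = 0"
    unfolding bas_tensor_take_drop[OF M] by (auto simp: smod_tensor_def)
next
  fix i j a b
  assume "gact (smod_tensor n M N) (i, j) a b \<noteq> 0"
  then obtain k where k: "k \<in> II n" and
    "psign ((pr k + pr j) * par M (take (wlen M) b))
          * gact M (i, k) (take (wlen M) a) (take (wlen M) b)
          * gact N (k, j) (drop (wlen M) a) (drop (wlen M) b) \<noteq> 0"
    unfolding gact_tensor[OF M N] by (rule sum.not_neutral_contains_not_neutral)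
  then have m: "gact M (i, k) (take (wlen M) a) (take (wlen M) b) \<noteq> 0"
    and m': "gact N (k, j) (drop (wlen M) a) (drop (wlen M) b) \<noteq> 0" by auto
  note * = presmod_gact[OF M m] presmod_gact[OF N m']
  show "(i, j) \<in> Uq_gens n" using * by (auto simp: Uq_gens_def)
  show a: "a \<in> bas (smod_tensor n M N)" "b \<in> bas (smod_tensor n M N)"
    using * unfolding bas_tensor_take_drop[OF M] by auto
  have "par (smod_tensor n M N) a + par (smod_tensor n M N) b
     = (par M (take (wlen M) a) + par M (take (wlen M) b)) +
       (par N (drop (wlen M) a) + par N (drop (wlen M) b))"
    using * by (simp add: smod_tensor_def ac_simps)
  also have "\<dots> = pr i + pr j" using * by (simp add: ac_simps)
  finally show "par (smod_tensor n M N) a + par (smod_tensor n M N) b = pr i + pr j" .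
qed

text \<open>Coassociativity: both actions are the same sum over two intermediate indices, up to the
  order of summation. Equality on the nose is possible because words concatenate
  associatively.\<close>

lemma smod_tensor_assoc:
  assumes M: "presmod n M" and N: "presmod n N" and P: "presmod n P"
  shows "smod_tensor n (smod_tensor n M N) P = smod_tensor n M (smod_tensor n N P)"
proof (rule presmod_eqI)
  show "presmod n (smod_tensor n (smod_tensor n M N) P)"
    "presmod n (smod_tensor n M (smod_tensor n N P))"
    by (intro presmod_tensor M N P)+
  show bas: "bas (smod_tensor n (smod_tensor n M N) P) = bas (smod_tensor n M (smod_tensor n N P))"
  proof (intro set_eqI iffI)
    fix x assume "x \<in> bas (smod_tensor n (smod_tensor n M N) P)"
    then obtain u v w where "x = u @ (v @ w)" "u \<in> bas M" "v \<in> bas N" "w \<in> bas P"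
      by (auto simp: bas_tensor)
    then show "x \<in> bas (smod_tensor n M (smod_tensor n N P))" unfolding bas_tensor by blast
  next
    fix x assume "x \<in> bas (smod_tensor n M (smod_tensor n N P))"
    then obtain u v w where "x = (u @ v) @ w" "u \<in> bas M" "v \<in> bas N" "w \<in> bas P"
      by (auto simp: bas_tensor)
    then show "x \<in> bas (smod_tensor n (smod_tensor n M N) P)" unfolding bas_tensor by blast
  qed
next
  fix w assume "w \<in> bas (smod_tensor n (smod_tensor n M N) P)"
  then obtain u v x where w: "w = (u @ v) @ x" and *: "u \<in> bas M" "v \<in> bas N" "x \<in> bas P"
    by (auto simp: bas_tensor)
  then have **: "u @ v \<in> bas (smod_tensor n M N)" "v @ x \<in> bas (smod_tensor n N P)"
    by (auto simp: bas_tensor)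
  have "par (smod_tensor n (smod_tensor n M N) P) ((u @ v) @ x) = par M u + par N v + par P x"
    using * ** by (simp only: par_tensor_append[OF presmod_tensor[OF M N]] par_tensor_append[OF M])
  moreover have "par (smod_tensor n M (smod_tensor n N P)) (u @ v @ x) = par M u + (par N v + par P x)"
    using * ** by (simp only: par_tensor_append[OF N] par_tensor_append[OF M])
  ultimately show "par (smod_tensor n (smod_tensor n M N) P) w
      = par (smod_tensor n M (smod_tensor n N P)) w"
    by (simp add: w ac_simps)
next
  fix i j a b
  assume "a \<in> bas (smod_tensor n (smod_tensor n M N) P)" "b \<in> bas (smod_tensor n (smod_tensor n M N) P)"
  then obtain u v x u' v' x' where a: "a = u @ v @ x" and b: "b = u' @ v' @ x'" and
     *: "u \<in> bas M" "v \<in> bas N" "x \<in> bas P" "u' \<in> bas M" "v' \<in> bas N" "x' \<in> bas P"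
    by (auto simp: bas_tensor)
  have l: "length u = wlen M" "length v = wlen N" "length u' = wlen M" "length v' = wlen N"
    using * presmod_length[OF M] presmod_length[OF N] by auto
  show "gact (smod_tensor n (smod_tensor n M N) P) (i, j) a b =
        gact (smod_tensor n M (smod_tensor n N P)) (i, j) a b"
    unfolding gact_tensor[OF presmod_tensor[OF M N] P] gact_tensor[OF M presmod_tensor[OF N P]]
      gact_tensor[OF M N] gact_tensor[OF N P]
    apply (simp add: a b l par_tensor_append[OF M] * sum_distrib_left sum_distrib_right
        psign_add algebra_simps)
    apply (subst sum.swap)
    apply (intro sum.cong HOL.refl)
    apply (simp_all add: ac_simps)
    done
qed (simp_all)

lemma presmod_unit: "presmod n (smod_unit n)"
  by (auto simp: presmod_def smod_unit_def split: if_splits)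

lemma unit_sel [simp]: "wlen (smod_unit n) = 0" "bas (smod_unit n) = {[]}" "par (smod_unit n) w = 0"
  by (simp_all add: smod_unit_def)

lemma smod_tensor_unit_left:
  assumes M: "presmod n M" shows "smod_tensor n (smod_unit n) M = M"
proof (rule presmod_eqI[OF presmod_tensor[OF presmod_unit M] M])
  fix i j a b assume ij: "i \<in> II n" "j \<in> II n"
  have "gact (smod_tensor n (smod_unit n) M) (i, j) a b =
    (\<Sum>k\<in>II n. if k = i then gact M (i, j) a b else 0)"
    unfolding gact_tensor[OF presmod_unit M]
    by (intro sum.cong HOL.refl) (use ij in \<open>auto simp: smod_unit_def Uq_gens_def\<close>)
  then show "gact (smod_tensor n (smod_unit n) M) (i, j) a b = gact M (i, j) a b"
    using ij by simp
qed (auto simp: smod_tensor_def smod_unit_def)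

lemma smod_tensor_unit_right:
  assumes M: "presmod n M" shows "smod_tensor n M (smod_unit n) = M"
proof (rule presmod_eqI[OF presmod_tensor[OF M presmod_unit] M])
  fix i j a b assume ij: "i \<in> II n" "j \<in> II n"
    and "a \<in> bas (smod_tensor n M (smod_unit n))" "b \<in> bas (smod_tensor n M (smod_unit n))"
  then have ab: "a \<in> bas M" "b \<in> bas M" by (auto simp: bas_tensor)
  have "gact (smod_tensor n M (smod_unit n)) (i, j) a b =
    (\<Sum>k\<in>II n. if k = j then gact M (i, j) a b else 0)"
    unfolding gact_tensor[OF M presmod_unit]
    by (intro sum.cong HOL.refl)
       (use ij ab presmod_length[OF M] in \<open>auto simp: smod_unit_def Uq_gens_def\<close>)
  then show "gact (smod_tensor n M (smod_unit n)) (i, j) a b = gact M (i, j) a b"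
    using ij by simp
qed (use presmod_length[OF M] in \<open>auto simp: smod_tensor_def smod_unit_def\<close>)


subsection \<open>Composition and tensor products of matrices\<close>

lemma smor_comp_sel [simp]: "src (smor_comp g f) = src f" "tgt (smor_comp g f) = tgt g"
  "mpar (smor_comp g f) = mpar g + mpar f"
  "mat (smor_comp g f) a c = (\<Sum>b\<in>bas (tgt f). mat g a b * mat f b c)"
  by (simp_all add: smor_comp_def)

lemma smor_tensor_sel [simp]: "src (smor_tensor n f g) = smod_tensor n (src f) (src g)"
  "tgt (smor_tensor n f g) = smod_tensor n (tgt f) (tgt g)"
  "mpar (smor_tensor n f g) = mpar f + mpar g"
  by (simp_all add: smor_tensor_def)

lemma smor_id_sel [simp]: "src (smor_id M) = M" "tgt (smor_id M) = M" "mpar (smor_id M) = 0"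
  "mat (smor_id M) a b = (if a = b \<and> a \<in> bas M then 1 else 0)"
  by (simp_all add: smor_id_def)

lemma mat_tensor_append:
  assumes "length a = wlen (tgt f)" "length b = wlen (src f)"
  shows "mat (smor_tensor n f g) (a @ a') (b @ b') =
    psign (mpar g * par (src f) b) * mat f a b * mat g a' b'"
  using assms by (simp add: smor_tensor_def)

lemma premor_id: "presmod n M \<Longrightarrow> premor n (smor_id M)"
  by (auto simp: premor_def split: if_splits)

lemma premor_comp:
  assumes g: "premor n g" and f: "premor n f" and e: "src g = tgt f"
  shows "premor n (smor_comp g f)"
  unfolding premor_def
proof (intro conjI allI impI)
  fix a c assume "mat (smor_comp g f) a c \<noteq> 0"
  then have "(\<Sum>b\<in>bas (tgt f). mat g a b * mat f b c) \<noteq> 0" by simp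
  then obtain b where "mat g a b * mat f b c \<noteq> 0"
    by (rule sum.not_neutral_contains_not_neutral)
  then have n0: "mat g a b \<noteq> 0" "mat f b c \<noteq> 0" by auto
  show "a \<in> bas (tgt (smor_comp g f))" "c \<in> bas (src (smor_comp g f))"
    using premor_mat_0[OF g, of a b] premor_mat_0[OF f, of b c] n0 by auto
  show "par (tgt (smor_comp g f)) a + par (src (smor_comp g f)) c = mpar (smor_comp g f)"
    using premor_parity[OF g n0(1)] premor_parity[OF f n0(2)] e by (simp add: ac_simps)
qed (use premor_presmod f g in auto)

lemma premor_tensor:
  assumes f: "premor n f" and g: "premor n g"
  shows "premor n (smor_tensor n f g)"
  unfolding premor_def
proof (intro conjI allI impI)
  show "presmod n (src (smor_tensor n f g))" "presmod n (tgt (smor_tensor n f g))"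
    using f g premor_presmod presmod_tensor by auto
  fix x y assume "mat (smor_tensor n f g) x y \<noteq> 0"
  then have n0: "mat f (take (wlen (tgt f)) x) (take (wlen (src f)) y) \<noteq> 0"
      "mat g (drop (wlen (tgt f)) x) (drop (wlen (src f)) y) \<noteq> 0"
    by (auto simp: smor_tensor_def)
  note * = f[unfolded premor_def, THEN conjunct2, THEN conjunct2, rule_format, OF n0(1)]
    g[unfolded premor_def, THEN conjunct2, THEN conjunct2, rule_format, OF n0(2)]
  show "x \<in> bas (tgt (smor_tensor n f g))" "y \<in> bas (src (smor_tensor n f g))"
    using * by (auto simp: bas_tensor_take_drop[OF premor_presmod(2)[OF f]]
        bas_tensor_take_drop[OF premor_presmod(1)[OF f]])
  show "par (tgt (smor_tensor n f g)) x + par (src (smor_tensor n f g)) y = mpar (smor_tensor n f g)"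
    using * premor_parity[OF f n0(1)] premor_parity[OF g n0(2)]
    by (simp add: smod_tensor_def ac_simps)
qed

lemma smor_comp_assoc: "smor_comp (smor_comp h g) f = smor_comp h (smor_comp g f)"
  unfolding smor_comp_def
  by (simp add: sum_distrib_left sum_distrib_right mult.assoc add.assoc)
     (intro ext sum.swap)

lemma smor_comp_id_left:
  assumes "premor n f" shows "smor_comp (smor_id (tgt f)) f = f"
  by (rule premor_eqI[OF premor_comp[OF premor_id assms] assms])
     (use presmod_finite[OF premor_presmod(2)[OF assms]] premor_presmod[OF assms] in
       \<open>auto simp: if_distrib[of "\<lambda>x. x * _"] cong: if_cong\<close>)

lemma smor_comp_id_right:
  assumes "premor n f" shows "smor_comp f (smor_id (src f)) = f"
  by (rule premor_eqI[OF premor_comp[OF assms premor_id] assms])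
     (use presmod_finite[OF premor_presmod(1)[OF assms]] premor_presmod[OF assms] in
       \<open>auto simp: if_distrib[of "\<lambda>x. _ * x"] cong: if_cong conj_cong\<close>)

lemma smor_tensor_id:
  assumes M: "presmod n M" and N: "presmod n N"
  shows "smor_tensor n (smor_id M) (smor_id N) = smor_id (smod_tensor n M N)"
proof (rule premor_eqI[OF premor_tensor[OF premor_id[OF M] premor_id[OF N]]
        premor_id[OF presmod_tensor[OF M N]]])
  fix a b assume "a \<in> bas (tgt (smor_tensor n (smor_id M) (smor_id N)))"
    "b \<in> bas (src (smor_tensor n (smor_id M) (smor_id N)))"
  then show "mat (smor_tensor n (smor_id M) (smor_id N)) a b = mat (smor_id (smod_tensor n M N)) a b"
    using presmod_length[OF M] by (auto simp: bas_tensor mat_tensor_append)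
qed auto

lemma smor_tensor_assoc:
  assumes f: "premor n f" and g: "premor n g" and h: "premor n h"
  shows "smor_tensor n (smor_tensor n f g) h = smor_tensor n f (smor_tensor n g h)"
proof (rule premor_eqI[of n])
  show "premor n (smor_tensor n (smor_tensor n f g) h)" "premor n (smor_tensor n f (smor_tensor n g h))"
    by (intro premor_tensor f g h)+
  note p = premor_presmod[OF f] premor_presmod[OF g] premor_presmod[OF h]
  show s: "src (smor_tensor n (smor_tensor n f g) h) = src (smor_tensor n f (smor_tensor n g h))"
    and t: "tgt (smor_tensor n (smor_tensor n f g) h) = tgt (smor_tensor n f (smor_tensor n g h))"
    by (simp_all add: smod_tensor_assoc p)
  fix x y assume "x \<in> bas (tgt (smor_tensor n (smor_tensor n f g) h))"
    "y \<in> bas (src (smor_tensor n (smor_tensor n f g) h))"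
  then obtain a b c a' b' c' where x: "x = a @ b @ c" and y: "y = a' @ b' @ c'"
    and *: "a \<in> bas (tgt f)" "b \<in> bas (tgt g)" "c \<in> bas (tgt h)"
      "a' \<in> bas (src f)" "b' \<in> bas (src g)" "c' \<in> bas (src h)"
    by (auto simp: bas_tensor)
  have l: "length a = wlen (tgt f)" "length b = wlen (tgt g)"
    "length a' = wlen (src f)" "length b' = wlen (src g)"
    using * p presmod_length by blast+
  have "mat (smor_tensor n (smor_tensor n f g) h) ((a @ b) @ c) ((a' @ b') @ c')
     = mat (smor_tensor n f (smor_tensor n g h)) (a @ b @ c) (a' @ b' @ c')"
    using l by (simp only: mat_tensor_append length_append wlen_tensor smor_tensor_sel)
      (simp add: mat_tensor_append par_tensor_append[OF p(1)] * algebra_simps psign_add)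
  then show "mat (smor_tensor n (smor_tensor n f g) h) x y = mat (smor_tensor n f (smor_tensor n g h)) x y"
    by (simp add: x y)
qed simp

lemma smor_tensor_unit_left:
  assumes f: "premor n f" shows "smor_tensor n (smor_id (smod_unit n)) f = f"
proof (rule premor_eqI[OF premor_tensor[OF premor_id[OF presmod_unit] f] f])
  fix a b
  show "mat (smor_tensor n (smor_id (smod_unit n)) f) a b = mat f a b"
    using mat_tensor_append[of "[]" "smor_id (smod_unit n)" "[]" n f a b] by simp
qed (simp_all add: smod_tensor_unit_left premor_presmod[OF f])

lemma smor_tensor_unit_right:
  assumes f: "premor n f" shows "smor_tensor n f (smor_id (smod_unit n)) = f"
proof (rule premor_eqI[OF premor_tensor[OF f premor_id[OF presmod_unit]] f])
  fix a b assume "a \<in> bas (tgt (smor_tensor n f (smor_id (smod_unit n))))"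
    "b \<in> bas (src (smor_tensor n f (smor_id (smod_unit n))))"
  then show "mat (smor_tensor n f (smor_id (smod_unit n))) a b = mat f a b"
    using mat_tensor_append[of a f b n "smor_id (smod_unit n)" "[]" "[]"]
      presmod_length[OF premor_presmod(1)[OF f]] presmod_length[OF premor_presmod(2)[OF f]]
    by (simp add: smod_tensor_unit_right premor_presmod[OF f])
qed (simp_all add: smod_tensor_unit_right premor_presmod[OF f])

definition smor_scale :: "Cq \<Rightarrow> smor \<Rightarrow> smor" where
  "smor_scale r f = f \<lparr> mat := (\<lambda>a b. r * mat f a b) \<rparr>"

definition smor_plus :: "smor \<Rightarrow> smor \<Rightarrow> smor" where
  "smor_plus f g = f \<lparr> mat := (\<lambda>a b. mat f a b + mat g a b) \<rparr>"

definition smor_zero :: "smodule \<Rightarrow> smodule \<Rightarrow> bit \<Rightarrow> smor" where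
  "smor_zero M N e = \<lparr> src = M, tgt = N, mpar = e, mat = (\<lambda>a b. 0) \<rparr>"

lemma smor_scale_sel [simp]: "src (smor_scale r f) = src f" "tgt (smor_scale r f) = tgt f"
  "mpar (smor_scale r f) = mpar f" "mat (smor_scale r f) a b = r * mat f a b"
  by (simp_all add: smor_scale_def)

lemma smor_plus_sel [simp]: "src (smor_plus f g) = src f" "tgt (smor_plus f g) = tgt f"
  "mpar (smor_plus f g) = mpar f" "mat (smor_plus f g) a b = mat f a b + mat g a b"
  by (simp_all add: smor_plus_def)

lemma smor_zero_sel [simp]: "src (smor_zero M N e) = M" "tgt (smor_zero M N e) = N"
  "mpar (smor_zero M N e) = e" "mat (smor_zero M N e) a b = 0"
  by (simp_all add: smor_zero_def)

lemma premor_scale: "premor n f \<Longrightarrow> premor n (smor_scale r f)"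
  by (auto simp: premor_def)

lemma add_nonzero_cases: "(x::Cq) + y \<noteq> 0 \<Longrightarrow> x \<noteq> 0 \<or> y \<noteq> 0"
  by auto

lemma premor_plus: "premor n f \<Longrightarrow> premor n g \<Longrightarrow> src f = src g \<Longrightarrow> tgt f = tgt g \<Longrightarrow> mpar f = mpar g \<Longrightarrow>
    premor n (smor_plus f g)"
  unfolding premor_def smor_plus_sel by (intro conjI allI impI; metis add_nonzero_cases)

lemma premor_zero: "presmod n M \<Longrightarrow> presmod n N \<Longrightarrow> premor n (smor_zero M N e)"
  by (auto simp: premor_def)

text \<open>The sign comes from the middle vector \<open>v\<close>: on the left \<open>g\<close>
  passes \<open>v\<close>, on the right it passes \<open>c\<close>, and their parities differ by the
  parity of \<open>f\<close> wherever \<open>f\<close> has a nonzero entry.\<close>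

lemma smor_interchange:
  assumes f': "premor n f'" and g: "premor n g" and f: "premor n f" and g': "premor n g'"
    and e: "src f' = tgt f" "src g = tgt g'"
  shows "smor_comp (smor_tensor n f' g) (smor_tensor n f g') =
    smor_scale (psign (mpar f * mpar g)) (smor_tensor n (smor_comp f' f) (smor_comp g g'))"
    (is "?L = ?R")
proof (rule premor_eqI[of n])
  show "premor n ?L"
    by (intro premor_comp premor_tensor f' g f g') (simp add: e)
  show "premor n ?R"
    by (intro premor_scale premor_comp premor_tensor f' g f g' e)
  fix x y assume xy: "x \<in> bas (tgt ?L)" "y \<in> bas (src ?L)"
  then obtain a b c d where x: "x = a @ b" and y: "y = c @ d" and
    *: "a \<in> bas (tgt f')" "b \<in> bas (tgt g)" "c \<in> bas (src f)" "d \<in> bas (src g')"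
    by (auto simp: bas_tensor)
  have l: "length a = wlen (tgt f')" "length c = wlen (src f)"
    "v \<in> bas (tgt f) \<Longrightarrow> length v = wlen (tgt f)" for v
    using * f' f premor_presmod presmod_length by blast+
  have s: "psign (mpar g * par (tgt f) v) * mat f v c = psign (mpar f * mpar g) * psign (mpar g * par (src f) c) * mat f v c" for v
    using premor_parity[OF f, of v c]
    by (cases "mat f v c = 0") (auto simp: algebra_simps psign_add)
  have "mat ?L x y = (\<Sum>v\<in>bas (tgt f). \<Sum>w\<in>bas (tgt g'). psign (mpar g' * par (src f) c) *
      mat f' a v * (psign (mpar g * par (tgt f) v) * mat f v c) * (mat g b w * mat g' w d))"
    by (simp add: sum_bas_tensor[OF premor_presmod(2)[OF f]])
      (intro sum.cong HOL.refl; simp add: x y mat_tensor_append l e ac_simps)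
  also have "\<dots> = (\<Sum>v\<in>bas (tgt f). \<Sum>w\<in>bas (tgt g'). psign (mpar f * mpar g) *
     psign ((mpar g + mpar g') * par (src f) c) * (mat f' a v * mat f v c) * (mat g b w * mat g' w d))"
    unfolding s by (intro sum.cong HOL.refl; simp add: psign_add algebra_simps)
  also have "\<dots> = mat ?R x y"
    by (simp add: x y mat_tensor_append l sum_distrib_left sum_distrib_right ac_simps)
  finally show "mat ?L x y = mat ?R x y" .
qed (simp_all add: ac_simps)

section \<open>The action of the free superalgebra\<close>

lemma act_zero [simp]: "act M 0 a b = 0"
  by (simp add: act_def)

lemma act_add: "act M (x + y) a b = act M x a b + act M y a b"
  unfolding act_def
  by (rule setsum_keys_plus_distrib[of "\<lambda>w c. c * word_act M (letters w) a b"])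
     (simp_all add: algebra_simps)

lemma act_diff: "act M (x - y) a b = act M x a b - act M y a b"
  using act_add[of M "x - y" y a b] by simp

lemma act_sum: "act M (\<Sum>i\<in>I. f i) a b = (\<Sum>i\<in>I. act M (f i) a b)"
  by (induction I rule: infinite_finite_induct) (simp_all add: act_add)

lemma act_single: "act M (Poly_Mapping.single w c) a b = c * word_act M (letters w) a b"
  by (cases "c = 0") (simp_all add: act_def)

lemma falg_sum_singles:
  fixes x :: falg
  shows "x = (\<Sum>w\<in>Poly_Mapping.keys x. Poly_Mapping.single w (Poly_Mapping.lookup x w))"
  by (rule poly_mapping_eqI)
     (simp add: lookup_sum lookup_single when_def in_keys_iff if_distrib cong: if_cong)

lemma falg_induct:
  fixes x :: falg
  assumes "\<And>w c. P (Poly_Mapping.single w c)" "\<And>x y. P x \<Longrightarrow> P y \<Longrightarrow> P (x + y)"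
  shows "P x"
proof -
  have "P (\<Sum>w\<in>A. Poly_Mapping.single w (c w))" for A c
    \<comment> \<open>Coefficient 0 gives the property for the zero element, which is the empty
      sum.\<close>
    using assms(1)[of _ 0] by (induction A rule: infinite_finite_induct) (simp_all add: assms)
  then show ?thesis by (subst falg_sum_singles)
qed

lemma word_act_0: "presmod n M \<Longrightarrow> a \<notin> bas M \<or> b \<notin> bas M \<Longrightarrow> word_act M us a b = 0"
proof (induction us arbitrary: a)
  case (Cons u us)
  have "gact M u a c * word_act M us c b = 0" for c
    using Cons.IH[OF Cons.prems(1), of c] Cons.prems presmod_gact_0[OF Cons.prems(1)]
    by (cases u) auto
  then show ?case by (simp add: sum.neutral)
qed auto

lemma word_act_append:
  assumes M: "presmod n M"
  shows "word_act M (us @ vs) a b = (\<Sum>c\<in>bas M. word_act M us a c * word_act M vs c b)"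
proof (induction us arbitrary: a)
  case Nil
  show ?case
    using word_act_0[OF M, of a b] presmod_finite[OF M]
    by (auto simp: if_distrib[of "\<lambda>x. x * _"] cong: if_cong conj_cong)
next
  case (Cons u us)
  show ?case
    by (simp add: Cons sum_distrib_left sum_distrib_right mult.assoc, rule sum.swap)
qed

lemma letters_zero [simp]: "letters 0 = []" and letters_plus [simp]: "letters (v + w) = letters v @ letters w"
  by (simp_all add: zero_fmon_def plus_fmon_def)

lemma act_mult:
  assumes M: "presmod n M"
  shows "act M (x * y) a b = (\<Sum>c\<in>bas M. act M x a c * act M y c b)"
proof (induction x rule: falg_induct)
  case (1 w r)
  show ?case
    by (induction y rule: falg_induct)
       (simp_all add: mult_single act_single word_act_append[OF M] distrib_left act_add
         sum.distrib sum_distrib_left ac_simps)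
qed (simp add: distrib_right act_add sum.distrib)

lemma act_0_outside: "presmod n M \<Longrightarrow> a \<notin> bas M \<or> b \<notin> bas M \<Longrightarrow> act M x a b = 0"
  by (simp add: act_def word_act_0)

lemma act_ugen:
  assumes M: "presmod n M"
  shows "act M (ugen i j) a b = gact M (i, j) a b"
proof -
  have "b \<in> bas M" if "gact M (i, j) a b \<noteq> 0"
    using presmod_gact[OF M that] by simp
  then show ?thesis
    using presmod_finite[OF M]
    by (cases "b \<in> bas M")
       (auto simp: ugen_def act_single if_distrib[of "\<lambda>x. _ * x"] cong: if_cong conj_cong)
qed

lemma act_Lcoef:
  assumes M: "presmod n M"
  shows "act M (Lcoef i j) a b = gact M (i, j) a b"
  using presmod_gact_0[OF M, of i j a b] by (auto simp: Lcoef_def act_ugen[OF M] Uq_gens_def)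

lemma act_one: "act M 1 a b = (if a = b \<and> a \<in> bas M then 1 else 0)"
  using act_single[of M 0 1 a b] by simp

lemma act_fscalar_left: "act M (fscalar r * x) a b = r * act M x a b"
  and act_fscalar_right: "act M (x * fscalar r) a b = r * act M x a b"
  by (induction x rule: falg_induct;
      simp add: fscalar_def mult_single act_single distrib_left distrib_right act_add)+

lemma psign_falg: "(psign e :: falg) = fscalar (psign e)"
  by (cases e) (simp_all add: fscalar_def single_uminus flip: single_one)

lemma act_psign: "act M (psign e * x) a b = psign e * act M x a b"
  by (simp add: psign_falg act_fscalar_left)

section \<open>The two sides of the RLL relation as sums over intermediate indices\<close>

lemma EE_mult_L12_L13:
  assumes "i \<in> II n" "m \<in> II n" "k \<in> II n" "r \<in> II n"
  shows "EE_mult n L12 L13 i m k r = psign ((pr i + pr m) * (pr k + pr r)) * (Lcoef i m * Lcoef k r)"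
proof -
  have "EE_mult n L12 L13 i m k r = (\<Sum>j\<in>II n. \<Sum>l\<in>II n. if l = k then if j = m then
       psign ((pr i + pr m) * (pr k + pr r)) * (Lcoef i m * Lcoef k r) else 0 else 0)"
    unfolding EE_mult_def by (intro sum.cong HOL.refl) (auto simp: L12_def L13_def)
  then show ?thesis using assms by simp
qed

text \<open>Total Koszul exponent of the two multiplications in L12 L13 Theta23, with
  \<open>m\<close> and \<open>r\<close> as intermediate indices: the first two summands belong to
  the outer product, the last one to the inner product. \<open>TLL_par\<close> plays the same role
  for Theta23 L13 L12.\<close>

definition LLT_par :: "int \<Rightarrow> int \<Rightarrow> int \<Rightarrow> int \<Rightarrow> int \<Rightarrow> int \<Rightarrow> bit" where
  "LLT_par i j k l m r = (pr i + pr m + pr k + pr r) * (pr m + pr j + pr r + pr l)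
     + (pr k + pr r) * (pr m + pr j) + (pr i + pr m) * (pr k + pr r)"

definition TLL_par :: "int \<Rightarrow> int \<Rightarrow> int \<Rightarrow> int \<Rightarrow> int \<Rightarrow> int \<Rightarrow> bit" where
  "TLL_par i j k l m r = (pr i + pr m + pr k + pr l) * (pr m + pr j)
     + (pr k + pr l) * (pr m + pr j) + (pr i + pr m + pr k + pr r) * (pr r + pr l)"

lemma EE_mult_LL_Theta:
  assumes "i \<in> II n" "j \<in> II n" "k \<in> II n" "l \<in> II n"
  shows "EE_mult n (EE_mult n L12 L13) Theta23 i j k l = (\<Sum>m\<in>II n. \<Sum>r\<in>II n.
    psign (LLT_par i j k l m r) * (Lcoef i m * Lcoef k r * fscalar (Theta m j r l)))"
  unfolding EE_mult_def[of n "EE_mult n L12 L13"] LLT_par_def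
  by (intro sum.cong HOL.refl)
     (simp_all add: EE_mult_L12_L13 assms Theta23_def psign_add[of "_ * _ + _"] mult.assoc)

lemma EE_mult_Theta_LL:
  assumes "i \<in> II n" "j \<in> II n" "k \<in> II n" "l \<in> II n"
  shows "EE_mult n (EE_mult n Theta23 L13) L12 i j k l = (\<Sum>m\<in>II n. \<Sum>r\<in>II n.
    psign (TLL_par i j k l m r) * (fscalar (Theta i m k r) * Lcoef r l * Lcoef m j))"
proof -
  have 1: "EE_mult n Theta23 L13 i m k r = (\<Sum>l\<in>II n.
     psign ((pr i + pr m + pr k + pr l) * (pr l + pr r)) * (fscalar (Theta i m k l) * Lcoef l r))"
    if "m \<in> II n" for m r
  proof -
    have "EE_mult n Theta23 L13 i m k r = (\<Sum>j\<in>II n. if j = m then \<Sum>l\<in>II n.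
       psign ((pr i + pr m + pr k + pr l) * (pr l + pr r)) * (fscalar (Theta i m k l) * Lcoef l r) else 0)"
      unfolding EE_mult_def by (intro sum.cong HOL.refl) (auto simp: Theta23_def L13_def intro!: sum.cong)
    then show ?thesis using that by simp
  qed
  have "EE_mult n (EE_mult n Theta23 L13) L12 i j k l =
    (\<Sum>m\<in>II n. \<Sum>r\<in>II n. if r = l then
      psign ((pr i + pr m + pr k + pr l) * (pr m + pr j) + (pr k + pr l) * (pr m + pr j)) *
         (EE_mult n Theta23 L13 i m k l * Lcoef m j) else 0)"
    unfolding EE_mult_def[of n "EE_mult n Theta23 L13"]
    by (intro sum.cong HOL.refl) (auto simp: L12_def)
  also have "\<dots> = (\<Sum>m\<in>II n.
      psign ((pr i + pr m + pr k + pr l) * (pr m + pr j) + (pr k + pr l) * (pr m + pr j)) *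
         (EE_mult n Theta23 L13 i m k l * Lcoef m j))"
    using assms by simp
  finally show ?thesis
    by (simp add: 1 TLL_par_def sum_distrib_left sum_distrib_right psign_add[of "_ * _ + _"] mult.assoc)
qed

definition RLL_matrices :: "nat \<Rightarrow> smodule \<Rightarrow> bool" where
  "RLL_matrices n M \<longleftrightarrow> (\<forall>i\<in>II n. \<forall>j\<in>II n. \<forall>k\<in>II n. \<forall>l\<in>II n. \<forall>a\<in>bas M. \<forall>b\<in>bas M.
     (\<Sum>m\<in>II n. \<Sum>r\<in>II n. \<Sum>c\<in>bas M.
        psign (LLT_par i j k l m r) * (gact M (i, m) a c * gact M (k, r) c b * Theta m j r l)) =
     (\<Sum>m\<in>II n. \<Sum>r\<in>II n. \<Sum>c\<in>bas M.
        psign (TLL_par i j k l m r) * (Theta i m k r * gact M (r, l) a c * gact M (m, j) c b)))"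

text \<open>The elements that act by zero are stable under sums and under multiplication from both
  sides, so only the generators of \<open>Uq_ideal\<close> have to be tested.\<close>

lemma is_smodule_if_RLL:
  assumes M: "presmod n M"
    and inv: "\<And>i a b. i \<in> II n \<Longrightarrow> a \<in> bas M \<Longrightarrow> b \<in> bas M \<Longrightarrow>
      (\<Sum>c\<in>bas M. gact M (i, i) a c * gact M (- i, - i) c b) = (if a = b then 1 else 0)"
    and RLL: "RLL_matrices n M"
  shows "is_smodule n M"
proof -
  have "act M x a b = 0" if "x \<in> Uq_ideal n" "a \<in> bas M" "b \<in> bas M" for x a b
    using that
  proof (induction arbitrary: a b rule: Uq_ideal.induct)
    case (inv i)
    then show ?case
      using assms(2)[of i a b] by (simp add: act_diff act_mult[OF M] act_ugen[OF M] act_one)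
  next
    case (RLL i j k l)
    have "act M (EE_mult n (EE_mult n L12 L13) Theta23 i j k l) a b = 
      act M (EE_mult n (EE_mult n Theta23 L13) L12 i j k l) a b"
      using assms(3)[unfolded RLL_matrices_def, rule_format, OF RLL(1-4) RLL(5-6)]
      by (simp add: EE_mult_LL_Theta[OF RLL(1-4)] EE_mult_Theta_LL[OF RLL(1-4)] act_sum act_psign
          act_fscalar_right act_fscalar_left act_mult[OF M] act_Lcoef[OF M] sum_distrib_left
          sum_distrib_right ac_simps)
    then show ?case by (simp add: act_diff)
  next
    case (mult x c d)
    then show ?case by (simp add: act_mult[OF M])
  qed (simp_all add: act_add)
  then have "act M x = act M y" if "Uq_eq n x y" for x y
    using that act_0_outside[OF M] act_diff[of M x y] unfolding Uq_eq_def
    by (intro ext) (metis eq_iff_diff_eq_0)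
  then show ?thesis using M unfolding is_smodule_def presmod_def by blast
qed

section \<open>Equivariance, from generators to all homogeneous elements\<close>

definition intertwines :: "smor \<Rightarrow> bool" where
  "intertwines f \<longleftrightarrow> (\<forall>i j. \<forall>a\<in>bas (tgt f). \<forall>b\<in>bas (src f).
     (\<Sum>c\<in>bas (src f). mat f a c * gact (src f) (i, j) c b) =
     psign (mpar f * (pr i + pr j)) * (\<Sum>c\<in>bas (tgt f). gact (tgt f) (i, j) a c * mat f c b))"

text \<open>Letters are moved past \<open>f\<close> one at a time; their signs add up to the parity
  of \<open>f\<close> times the parity of the word.\<close>

lemma intertwines_word:
  assumes f: "premor n f" and "intertwines f" and "a \<in> bas (tgt f)" "b \<in> bas (src f)"
  shows "(\<Sum>c\<in>bas (src f). mat f a c * word_act (src f) us c b) =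
    psign (mpar f * word_par (FMon us)) * (\<Sum>c\<in>bas (tgt f). word_act (tgt f) us a c * mat f c b)"
  using assms(3,4)
proof (induction us arbitrary: a b)
  case Nil
  then show ?case
    using presmod_finite[OF premor_presmod(1)[OF f]] presmod_finite[OF premor_presmod(2)[OF f]]
    by (simp add: word_par_def if_distrib[of "\<lambda>x. _ * x"] if_distrib[of "\<lambda>x. x * _"] cong: if_cong conj_cong)
next
  case (Cons u us)
  obtain i j where u: "u = (i, j)" by (cases u)
  have "(\<Sum>c\<in>bas (src f). mat f a c * word_act (src f) (u # us) c b) =
    (\<Sum>d\<in>bas (src f). (\<Sum>c\<in>bas (src f). mat f a c * gact (src f) (i, j) c d) * word_act (src f) us d b)"
    by (simp add: u sum_distrib_left sum_distrib_right mult.assoc, rule sum.swap)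
  also have "\<dots> = (\<Sum>d\<in>bas (src f). psign (mpar f * (pr i + pr j)) * (\<Sum>c\<in>bas (tgt f). gact (tgt f) (i, j) a c * mat f c d) * word_act (src f) us d b)"
    using assms(2)[unfolded intertwines_def, rule_format, OF Cons.prems(1)] by simp
  also have "\<dots> = psign (mpar f * (pr i + pr j)) * (\<Sum>c\<in>bas (tgt f). gact (tgt f) (i, j) a c *
      (\<Sum>d\<in>bas (src f). mat f c d * word_act (src f) us d b))"
    by (simp add: sum_distrib_left sum_distrib_right mult.assoc, rule sum.swap)
  also have "\<dots> = psign (mpar f * (pr i + pr j)) * (\<Sum>c\<in>bas (tgt f). gact (tgt f) (i, j) a c *
      (psign (mpar f * word_par (FMon us)) * (\<Sum>d\<in>bas (tgt f). word_act (tgt f) us c d * mat f d b)))"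
    using Cons by simp
  also have "\<dots> = psign (mpar f * (pr i + pr j)) * psign (mpar f * word_par (FMon us)) *
      (\<Sum>c\<in>bas (tgt f). gact (tgt f) (i, j) a c * (\<Sum>d\<in>bas (tgt f). word_act (tgt f) us c d * mat f d b))"
    by (simp add: sum_distrib_left ac_simps)
  also have "(\<Sum>c\<in>bas (tgt f). gact (tgt f) (i, j) a c * (\<Sum>d\<in>bas (tgt f). word_act (tgt f) us c d * mat f d b))
    = (\<Sum>c\<in>bas (tgt f). word_act (tgt f) (u # us) a c * mat f c b)"
    by (simp add: u sum_distrib_left sum_distrib_right mult.assoc, rule sum.swap)
  also have "psign (mpar f * (pr i + pr j)) * psign (mpar f * word_par (FMon us)) =
    (psign (mpar f * word_par (FMon (u # us))) :: Cq)"
    by (simp add: u word_par_def distrib_left psign_add)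
  finally show ?case .
qed

text \<open>A homogeneous element is a combination of words of one parity, so the sign of
  \<open>intertwines_word\<close> is common to all its terms.\<close>

lemma smod_Hom_if_intertwines:
  assumes f: "premor n f" and "intertwines f"
  shows "f \<in> smod_Hom n (src f) (tgt f) (mpar f)"
proof -
  have "(\<Sum>c\<in>bas (src f). mat f a c * act (src f) x c b) =
     psign (mpar f * d) * (\<Sum>c\<in>bas (tgt f). act (tgt f) x a c * mat f c b)"
    if x: "x \<in> falg_hom n d" and ab: "a \<in> bas (tgt f)" "b \<in> bas (src f)" for x d a b
  proof -
    have d: "word_par w = d" if "w \<in> Poly_Mapping.keys x" for w
      using x that by (simp add: falg_hom_def)
    have "(\<Sum>c\<in>bas (src f). mat f a c * act (src f) x c b) =
      (\<Sum>w\<in>Poly_Mapping.keys x. Poly_Mapping.lookup x w * (\<Sum>c\<in>bas (src f). mat f a c * word_act (src f) (letters w) c b))"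
      by (simp add: act_def sum_distrib_left mult.left_commute, rule sum.swap)
    also have "\<dots> = (\<Sum>w\<in>Poly_Mapping.keys x. Poly_Mapping.lookup x w *
       (psign (mpar f * d) * (\<Sum>c\<in>bas (tgt f). word_act (tgt f) (letters w) a c * mat f c b)))"
    proof (rule sum.cong[OF HOL.refl])
      fix w assume "w \<in> Poly_Mapping.keys x"
      then show "Poly_Mapping.lookup x w * (\<Sum>c\<in>bas (src f). mat f a c * word_act (src f) (letters w) c b) =
        Poly_Mapping.lookup x w * (psign (mpar f * d) * (\<Sum>c\<in>bas (tgt f). word_act (tgt f) (letters w) a c * mat f c b))"
        using intertwines_word[OF assms ab, of "letters w"] d by simp
    qed
    also have "\<dots> = psign (mpar f * d) * (\<Sum>c\<in>bas (tgt f). act (tgt f) x a c * mat f c b)"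
      by (simp add: act_def sum_distrib_left sum_distrib_right ac_simps, rule sum.swap)
    finally show ?thesis .
  qed
  then show ?thesis
    using f unfolding smod_Hom_def premor_def by auto
qed

lemma premor_if_smod_Hom:
  assumes "presmod n M" "presmod n N" "f \<in> smod_Hom n M N e"
  shows "premor n f" "src f = M" "tgt f = N" "mpar f = e"
  using assms unfolding smod_Hom_def premor_def by auto

section \<open>The three-term formula for the braiding\<close>

lemma qvar_nonzero [simp]: "qvar \<noteq> 0"
  by (simp add: qvar_def Zero_fract_def eq_fract)

text \<open>Value at v_a tensor v_b of T followed by the bilinear map with values \<open>f\<close>,
  see \<open>sum_Tmap\<close>. An arbitrary \<open>f\<close> on integers keeps matrices and the
  index set out of the case analysis.\<close>

definition Tcol :: "(int \<Rightarrow> int \<Rightarrow> Cq) \<Rightarrow> int \<Rightarrow> int \<Rightarrow> Cq" where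
  "Tcol f a b = psign (pr a * pr b) * qvar powi phi a b * f b a
     + (if a < b then zvar * f a b else 0)
     + (if - a < b then zvar * psign (pr b) * f (- a) (- b) else 0)"

lemma qvar_inverse: "qvar * inverse qvar = 1" "qvar * (inverse qvar * x) = x"
  by (simp_all flip: mult.assoc)

lemma pr_pos: "0 < x \<Longrightarrow> pr x = 0" and pr_neg: "x < 0 \<Longrightarrow> pr x = 1"
  by (auto simp: pr_def)

lemma phi_cases:
  "0 < x \<Longrightarrow> 0 < y \<Longrightarrow> x \<noteq> y \<Longrightarrow> phi x y = 0"
  "0 < x \<Longrightarrow> 0 < y \<Longrightarrow> x \<noteq> y \<Longrightarrow> phi (- x) y = 0"
  "0 < x \<Longrightarrow> 0 < y \<Longrightarrow> x \<noteq> y \<Longrightarrow> phi x (- y) = 0"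
  "0 < x \<Longrightarrow> 0 < y \<Longrightarrow> x \<noteq> y \<Longrightarrow> phi (- x) (- y) = 0"
  "0 < x \<Longrightarrow> phi x x = 1"
  "0 < x \<Longrightarrow> phi (- x) x = 1"
  "0 < x \<Longrightarrow> phi x (- x) = -1"
  "0 < x \<Longrightarrow> phi (- x) (- x) = -1"
  by (auto simp: phi_def)

text \<open>With the signs of the indices split off, parities and exponents become constants, and
  every condition is either decided or a comparison of \<open>x\<close> with
  \<open>y\<close>.\<close>

lemma Tcol_signs:
  fixes x y :: int
  assumes "0 < x" "0 < y"
  shows "Tcol f x y = (if x < y then f y x + zvar * f x y else if x = y then qvar * f x x else f y x) + zvar * f (- x) (- y)"
    "Tcol f (- x) y = (if x < y then f y (- x) + zvar * f x (- y) else if x = y then qvar * f x (- x) else f y (- x))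
        + zvar * f (- x) y"
    "Tcol f x (- y) = (if y < x then f (- y) x - zvar * f (- x) y else if x = y then inverse qvar * f (- x) x else f (- y) x)"
    "Tcol f (- x) (- y) = (if y < x then - f (- y) (- x) + zvar * f (- x) (- y) else if x = y then - inverse qvar * f (- x) (- x) else - f (- y) (- x))"
  using assms by (auto simp: Tcol_def pr_pos pr_neg phi_cases power_int_minus)

lemma int_sign_cases:
  fixes a :: int
  assumes "a \<noteq> 0"
  obtains x where "0 < x" "a = x \<or> a = - x"
  using assms by (cases "a > 0") (auto intro: that[of "- a"])

text \<open>The quadratic relation T^2 = z T + 1 for precomposition with T; it makes T - z the
  inverse of T.\<close>

lemma Tcol_Hecke:
  assumes "a \<noteq> 0" "b \<noteq> 0"
  shows "Tcol (Tcol f) a b = zvar * Tcol f a b + f a b"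
proof -
  obtain x y where x: "0 < x" "a = x \<or> a = - x" and y: "0 < y" "b = y \<or> b = - y"
    using assms int_sign_cases by metis
  show ?thesis
    using x(2) y(2) x(1) y(1) linorder_less_linear[of x y]
    by (elim disjE; simp add: Tcol_signs; simp add: zvar_def algebra_simps qvar_inverse)
qed

text \<open>The relation T (J tensor 1) = (1 tensor J) T, read on one row of the matrices. On the
  right, \<open>psign (pr y)\<close> belongs to J itself and \<open>psign (pr x)\<close> to moving J
  past v_x.\<close>

lemma Tcol_odd:
  assumes "a \<noteq> 0" "b \<noteq> 0"
  shows "psign (pr a) * Tcol f (- a) b = Tcol (\<lambda>x y. psign (pr x) * psign (pr y) * f x (- y)) a b"
proof -
  obtain x y where x: "0 < x" "a = x \<or> a = - x" and y: "0 < y" "b = y \<or> b = - y"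
    using assms int_sign_cases by metis
  show ?thesis
    using x(2) y(2) x(1) y(1) linorder_less_linear[of x y]
    by (elim disjE; simp add: Tcol_signs pr_pos pr_neg; simp add: zvar_def algebra_simps qvar_inverse)
qed

text \<open>\<open>T1\<close> and \<open>T2\<close> precompose a trilinear map with T on the first
  or on the last two tensor factors; in a nested expression the innermost operator is the one
  applied last to a vector.\<close>

definition T1 :: "(int \<Rightarrow> int \<Rightarrow> int \<Rightarrow> Cq) \<Rightarrow> int \<Rightarrow> int \<Rightarrow> int \<Rightarrow> Cq" where
  "T1 F a b c = Tcol (\<lambda>x y. F x y c) a b"

definition T2 :: "(int \<Rightarrow> int \<Rightarrow> int \<Rightarrow> Cq) \<Rightarrow> int \<Rightarrow> int \<Rightarrow> int \<Rightarrow> Cq" where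
  "T2 F a b c = Tcol (\<lambda>y z. F a y z) b c"

text \<open>The 13 weak orders of three integers. The strict ones list the transitive consequence
  too, so that \<open>simp\<close> decides every comparison coming from
  \<open>Tcol_signs\<close>.\<close>

lemma order_types:
  fixes x y z :: int
  obtains "x < y" "y < z" "x < z" | "x < z" "z < y" "x < y" | "y < x" "x < z" "y < z"
    | "y < z" "z < x" "y < x" | "z < x" "x < y" "z < y" | "z < y" "y < x" "z < x"
    | "x = y" "y < z" | "x = y" "z < y" | "x = z" "x < y" | "x = z" "y < x" | "y = z" "x < y" | "y = z" "y < x"
    | "x = y" "y = z"
  by (atomize_elim, rule linorder_cases[of x y]; rule linorder_cases[of y z]; rule linorder_cases[of x z]; simp)

text \<open>With z kept as an atom, these rules reduce powers of q and its inverse to expressions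
  linear in q over polynomials in z, so that both sides of an equation meet in the same
  form.\<close>

lemma qvar_square: "qvar * qvar = zvar * qvar + 1" "qvar * (qvar * x) = zvar * (qvar * x) + x"
  and inverse_qvar: "inverse qvar = qvar - zvar"
  by (simp_all add: zvar_def algebra_simps qvar_inverse)

lemma T_braid_signs:
  fixes x y z :: int
  assumes "0 < x" "0 < y" "0 < z"
  shows "T1 (T2 (T1 F)) x y z = T2 (T1 (T2 F)) x y z"
    "T1 (T2 (T1 F)) (- x) y z = T2 (T1 (T2 F)) (- x) y z"
    "T1 (T2 (T1 F)) x (- y) z = T2 (T1 (T2 F)) x (- y) z"
    "T1 (T2 (T1 F)) x y (- z) = T2 (T1 (T2 F)) x y (- z)"
    "T1 (T2 (T1 F)) (- x) (- y) z = T2 (T1 (T2 F)) (- x) (- y) z"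
    "T1 (T2 (T1 F)) (- x) y (- z) = T2 (T1 (T2 F)) (- x) y (- z)"
    "T1 (T2 (T1 F)) x (- y) (- z) = T2 (T1 (T2 F)) x (- y) (- z)"
    "T1 (T2 (T1 F)) (- x) (- y) (- z) = T2 (T1 (T2 F)) (- x) (- y) (- z)"
  \<comment> \<open>Each of the 8 sign patterns splits into 13 order types; the second
    \<open>simp\<close> compares what is left as polynomials in q and z.\<close>
  by (rule order_types[of x y z]; use assms in \<open>simp add: T1_def T2_def Tcol_signs inverse_qvar\<close>;
      simp add: algebra_simps qvar_square)+

lemma T_braid:
  assumes "a \<noteq> 0" "b \<noteq> 0" "c \<noteq> 0"
  shows "T1 (T2 (T1 F)) a b c = T2 (T1 (T2 F)) a b c"
proof -
  obtain x y z where "0 < x" "a = x \<or> a = - x" "0 < y" "b = y \<or> b = - y" "0 < z" "c = z \<or> c = - z"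
    using assms int_sign_cases by metis
  then show ?thesis using T_braid_signs[of x y z F] by blast
qed

section \<open>The generating supermodule\<close>

lemma V_sel [simp]: "wlen (Vmod n) = 1" "bas (Vmod n) = (\<lambda>i. [i]) ` II n"
  by (auto simp: Vmod_def)

lemma par_V [simp]: "i \<in> II n \<Longrightarrow> par (Vmod n) [i] = pr i"
  by (auto simp: Vmod_def)

lemma gact_V: "a \<in> II n \<Longrightarrow> b \<in> II n \<Longrightarrow> i \<in> II n \<Longrightarrow> j \<in> II n \<Longrightarrow>
    gact (Vmod n) (i, j) [a] [b] = Theta a b i j"
  by (auto simp: Vmod_def Uq_gens_def Theta_def)

lemma sum_singletons: "(\<Sum>x\<in>(\<lambda>i. [i]) ` A. F x) = (\<Sum>i\<in>A. F [i])"
  by (subst sum.reindex) (auto simp: inj_on_def)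

lemma Theta_parity:
  assumes "Theta a b i j \<noteq> 0" "i \<noteq> 0" "a \<noteq> 0" "b \<noteq> 0" "j \<noteq> 0"
  shows "pr a + pr b = pr i + pr j"
  using assms by (auto simp: Theta_def pr_uminus ac_simps split: if_splits)

lemma presmod_V: "presmod n (Vmod n)"
  unfolding presmod_def
proof (intro conjI allI impI ballI)
  fix i j a b assume "gact (Vmod n) (i, j) a b \<noteq> 0"
  then have *: "(i, j) \<in> Uq_gens n" "a \<in> bas (Vmod n)" "b \<in> bas (Vmod n)"
    "Theta (hd a) (hd b) i j \<noteq> 0"
    by (auto simp: Vmod_def split: if_splits)
  then show "(i, j) \<in> Uq_gens n" "a \<in> bas (Vmod n)" "b \<in> bas (Vmod n)" by auto
  show "par (Vmod n) a + par (Vmod n) b = pr i + pr j"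
    using * Theta_parity[OF *(4)] II_nonzero by (auto simp: Uq_gens_def)
qed (auto simp: Vmod_def)

lemma bas_tensor_UN: "bas (smod_tensor n M N) = (\<Union>v\<in>bas M. (@) v ` bas N)"
  by (auto simp: bas_tensor)

lemma bas_V_left: "bas (smod_tensor n (Vmod n) M) = (\<Union>i\<in>II n. (#) i ` bas M)"
  and bas_V_right: "bas (smod_tensor n M (Vmod n)) = (\<Union>v\<in>bas M. (\<lambda>i. v @ [i]) ` II n)"
  by (simp_all add: bas_tensor_UN image_image)

lemma bas_VV: "bas (VV n) = (\<Union>i\<in>II n. (\<lambda>j. [i, j]) ` II n)"
  by (simp add: bas_tensor_UN image_image)

lemma in_bas_VV [simp]: "[i, j] \<in> bas (VV n) \<longleftrightarrow> i \<in> II n \<and> j \<in> II n"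
  by (auto simp: bas_VV)

lemma sum_bas_VV: "(\<Sum>x\<in>bas (VV n). F x) = (\<Sum>i\<in>II n. \<Sum>j\<in>II n. F [i, j])"
  by (simp add: sum_bas_tensor[OF presmod_V] sum_singletons)

lemma par_VV [simp]: "i \<in> II n \<Longrightarrow> j \<in> II n \<Longrightarrow> par (VV n) [i, j] = pr i + pr j"
  using par_tensor_append[OF presmod_V, of "[i]" n "[j]" "Vmod n"] by simp

lemma Tmap_sel [simp]: "src (Tmap n) = VV n" "tgt (Tmap n) = VV n" "mpar (Tmap n) = 0"
  by (simp_all add: Tmap_def flip_map_def Theta_map_def)

lemma mat_Tmap_Theta:
  assumes "x \<in> II n" "y \<in> II n" "j \<in> II n" "l \<in> II n"
  shows "mat (Tmap n) [x, y] [j, l] = psign (pr x * pr y + (pr x + pr l) * pr j) * Theta y j x l"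
proof -
  have "mat (flip_map n) [x, y] [u, v] * mat (Theta_map n) [u, v] [j, l] =
      (if v = x then if u = y then psign (pr x * pr y + (pr x + pr l) * pr j) * Theta y j x l else 0 else 0)"
    if "u \<in> II n" "v \<in> II n" for u v
    using that assms by (simp add: flip_map_def Theta_map_def psign_add ac_simps)
  then have "mat (Tmap n) [x, y] [j, l] = (\<Sum>u\<in>II n. \<Sum>v\<in>II n.
      if v = x then if u = y then psign (pr x * pr y + (pr x + pr l) * pr j) * Theta y j x l else 0 else 0)"
    by (simp add: Tmap_def Theta_map_def[of n, THEN arg_cong[where f = tgt]] sum_bas_VV)
  then show ?thesis using assms by simp
qed

text \<open>The terms come from the diagonal of Theta, from E_ji tensor E_ij and from E_{-j,-i}
  tensor E_ij. The Koszul signs of the flip and of \<open>Theta_map\<close> cancel the factor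
  (-1)^p(i) in the second and turn it into the sign of \<open>b\<close> in the third.\<close>

lemma mat_Tmap:
  assumes "x \<in> II n" "y \<in> II n" "a \<in> II n" "b \<in> II n"
  shows "mat (Tmap n) [x, y] [a, b] =
    (if x = b \<and> y = a then psign (pr a * pr b) * qvar powi phi a b else 0)
    + (if x = a \<and> y = b \<and> a < b then zvar else 0)
    + (if x = - a \<and> y = - b \<and> - a < b then zvar * psign (pr b) else 0)"
proof -
  let ?S = "psign (pr x * pr y + (pr x + pr b) * pr a) :: Cq"
  have 1: "?S * (if y = a \<and> x = b then qvar powi phi y x else 0) =
    (if x = b \<and> y = a then psign (pr a * pr b) * qvar powi phi a b else 0)"
    by (simp add: mult.commute)
  have "?S * psign (pr x) = 1" if "y = b" "x = a"
    using that by (cases "pr a"; cases "pr b"; simp)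
  then have 2: "?S * (zvar * (if x < b then psign (pr x) * (if y = b \<and> a = x then 1 else 0) else 0))
    = (if x = a \<and> y = b \<and> a < b then zvar else 0)"
    by (simp add: mult.left_commute[of "psign _" zvar])
  have n0: "a \<noteq> 0" "b \<noteq> 0" using assms II_nonzero by auto
  have "?S * psign (pr x) = psign (pr b)" if "y = - b" "x = - a"
    using that n0 by (cases "pr a"; cases "pr b"; simp add: pr_uminus)
  moreover have "x = - a \<longleftrightarrow> a = - x" by auto
  ultimately have 3: "?S * (zvar * (if x < b then psign (pr x) * (if y = - b \<and> a = - x then 1 else 0) else 0))
    = (if x = - a \<and> y = - b \<and> - a < b then zvar * psign (pr b) else 0)"
    by (simp add: mult.left_commute[of "psign _" zvar])
  have "Theta y a x b = (if y = a \<and> x = b then qvar powi phi y x else 0)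
    + zvar * (if x < b then psign (pr x) * (if y = b \<and> a = x then 1 else 0) else 0)
    + zvar * (if x < b then psign (pr x) * (if y = - b \<and> a = - x then 1 else 0) else 0)"
    by (simp add: Theta_def distrib_left)
  then show ?thesis
    unfolding mat_Tmap_Theta[OF assms] by (simp only: distrib_left 1 2 3)
qed

lemma premor_T: "premor n (Tmap n)"
  unfolding premor_def
proof (intro conjI allI impI)
  fix a b assume n0: "mat (Tmap n) a b \<noteq> 0"
  then have *: "a \<in> bas (VV n)" "b \<in> bas (VV n)"
    by (auto simp: Tmap_def flip_map_def Theta_map_def split: if_splits elim!: sum.not_neutral_contains_not_neutral)
      (auto simp: bas_VV)
  then show "a \<in> bas (tgt (Tmap n))" "b \<in> bas (src (Tmap n))" by simp_all
  from * obtain x y j l where ab: "a = [x, y]" "b = [j, l]" "x \<in> II n" "y \<in> II n" "j \<in> II n" "l \<in> II n"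
    by (auto simp: bas_VV)
  then show "par (tgt (Tmap n)) a + par (src (Tmap n)) b = mpar (Tmap n)"
    using n0 II_nonzero by (auto simp: mat_Tmap pr_uminus ac_simps split: if_splits)
qed (simp_all add: presmod_V presmod_tensor)

lemma sum_Tmap:
  assumes "a \<in> II n" "b \<in> II n"
  shows "(\<Sum>x\<in>II n. \<Sum>y\<in>II n. f x y * mat (Tmap n) [x, y] [a, b]) = Tcol f a b"
proof -
  have "(\<Sum>x\<in>II n. \<Sum>y\<in>II n. f x y * mat (Tmap n) [x, y] [a, b]) =
    (\<Sum>x\<in>II n. \<Sum>y\<in>II n. 
      (if y = a then if x = b then f b a * (psign (pr a * pr b) * qvar powi phi a b) else 0 else 0)
    + (if y = b then if x = a then if a < b then f a b * zvar else 0 else 0 else 0)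
    + (if y = - b then if x = - a then if - a < b then f (- a) (- b) * (zvar * psign (pr b)) else 0 else 0 else 0))"
    using assms by (intro sum.cong HOL.refl) (auto simp: mat_Tmap distrib_left)
  also have "\<dots> = Tcol f a b"
    using assms by (simp add: sum.distrib Tcol_def ac_simps)
  finally show ?thesis .
qed


section \<open>Rows and columns of composites\<close>

text \<open>The identity factor collapses half of the sum over the intermediate basis. Being even it
  adds no sign, in contrast to \<open>comp_col_left\<close>, where \<open>h\<close> passes a vector
  of \<open>M\<close>.\<close>

lemma comp_col_right:
  assumes h: "premor n h" and N: "presmod n N" and "b \<in> bas (src h)" "w \<in> bas N"
  shows "mat (smor_comp f (smor_tensor n h (smor_id N))) u (b @ w) =
    (\<Sum>x\<in>bas (tgt h). mat f u (x @ w) * mat h x b)"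
proof -
  have "length b = wlen (src h)" "\<And>x. x \<in> bas (tgt h) \<Longrightarrow> length x = wlen (tgt h)"
    using assms premor_presmod presmod_length by blast+
  then show ?thesis
    using assms premor_presmod[OF h] presmod_finite[OF N]
    by (simp add: sum_bas_tensor mat_tensor_append if_distrib[of "\<lambda>x. _ * x"] cong: if_cong conj_cong)
qed

lemma comp_col_left:
  assumes M: "presmod n M" and h: "premor n h" and "v \<in> bas M" "b \<in> bas (src h)"
  shows "mat (smor_comp f (smor_tensor n (smor_id M) h)) u (v @ b) =
    psign (mpar h * par M v) * (\<Sum>x\<in>bas (tgt h). mat f u (v @ x) * mat h x b)"
proof -
  have l: "\<And>x. x \<in> bas M \<Longrightarrow> length x = wlen M"
    using assms presmod_length by blast+
  have "mat (smor_comp f (smor_tensor n (smor_id M) h)) u (v @ b) =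
    (\<Sum>y\<in>bas M. if y = v then psign (mpar h * par M v) * (\<Sum>x\<in>bas (tgt h). mat f u (v @ x) * mat h x b) else 0)"
    by (simp add: sum_bas_tensor M)
       (use assms l in \<open>intro sum.cong HOL.refl; auto simp: mat_tensor_append sum_distrib_left ac_simps\<close>)
  then show ?thesis using assms(3) presmod_finite[OF M] by simp
qed

lemma comp_row_right:
  assumes h: "premor n h" and N: "presmod n N" and "a \<in> bas (tgt h)" "w \<in> bas N"
    and "tgt f = smod_tensor n (src h) N"
  shows "mat (smor_comp (smor_tensor n h (smor_id N)) f) (a @ w) u =
    (\<Sum>x\<in>bas (src h). mat h a x * mat f (x @ w) u)"
proof -
  have "length a = wlen (tgt h)" "\<And>x. x \<in> bas (src h) \<Longrightarrow> length x = wlen (src h)"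
    using assms premor_presmod presmod_length by blast+
  then show ?thesis
    using assms premor_presmod[OF h] presmod_finite[OF N]
    by (simp add: sum_bas_tensor mat_tensor_append if_distrib[of "\<lambda>x. _ * x"] if_distrib[of "\<lambda>x. x * _"] cong: if_cong conj_cong)
qed

lemma comp_row_left:
  assumes M: "presmod n M" and h: "premor n h" and "v \<in> bas M" "a \<in> bas (tgt h)"
    and "tgt f = smod_tensor n M (src h)"
  shows "mat (smor_comp (smor_tensor n (smor_id M) h) f) (v @ a) u =
    psign (mpar h * par M v) * (\<Sum>x\<in>bas (src h). mat h a x * mat f (v @ x) u)"
proof -
  have l: "\<And>x. x \<in> bas M \<Longrightarrow> length x = wlen M"
    using assms presmod_length by blast+
  have "mat (smor_comp (smor_tensor n (smor_id M) h) f) (v @ a) u =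
    (\<Sum>y\<in>bas M. if y = v then psign (mpar h * par M v) * (\<Sum>x\<in>bas (src h). mat h a x * mat f (v @ x) u) else 0)"
    by (simp add: sum_bas_tensor M assms)
       (use assms l in \<open>intro sum.cong HOL.refl; auto simp: mat_tensor_append sum_distrib_left ac_simps\<close>)
  then show ?thesis using assms(3) presmod_finite[OF M] by simp
qed

section \<open>The braiding of a supermodule with the generating supermodule\<close>

text \<open>Entry of the flip composed with L. Letting E_ij pass \<open>b\<close> contributes p(i) +
  p(j) times \<open>par M b\<close>; the flip contributes p(i) times the parity of \<open>a\<close>,
  which is \<open>par M b\<close> + p(i) + p(j) where the entry is nonzero. The exponent is the sum
  of both.\<close>

definition lam :: "smodule \<Rightarrow> int \<Rightarrow> int list \<Rightarrow> int list \<Rightarrow> int \<Rightarrow> Cq" where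
  "lam M i a b j = psign (pr j * par M b + pr i + pr i * pr j) * gact M (i, j) a b"

definition Lt :: "nat \<Rightarrow> smodule \<Rightarrow> smor" where
  "Lt n M = \<lparr> src = smod_tensor n M (Vmod n), tgt = smod_tensor n (Vmod n) M, mpar = 0,
     mat = (\<lambda>x y. if x \<in> bas (smod_tensor n (Vmod n) M) \<and> y \<in> bas (smod_tensor n M (Vmod n))
       then lam M (hd x) (tl x) (butlast y) (last y) else 0) \<rparr>"

lemma Lt_sel [simp]: "src (Lt n M) = smod_tensor n M (Vmod n)"
  "tgt (Lt n M) = smod_tensor n (Vmod n) M" "mpar (Lt n M) = 0"
  by (simp_all add: Lt_def)

lemma mat_Lt:
  assumes "i \<in> II n" "j \<in> II n" "a \<in> bas M" "b \<in> bas M"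
  shows "mat (Lt n M) (i # a) (b @ [j]) = lam M i a b j"
  using assms by (auto simp: Lt_def bas_V_left bas_V_right)

lemma par_V_left: "i \<in> II n \<Longrightarrow> a \<in> bas M \<Longrightarrow> par (smod_tensor n (Vmod n) M) (i # a) = pr i + par M a"
  using par_tensor_append[OF presmod_V, of "[i]" n a M] by simp

lemma par_V_right: "presmod n M \<Longrightarrow> i \<in> II n \<Longrightarrow> a \<in> bas M \<Longrightarrow>
    par (smod_tensor n M (Vmod n)) (a @ [i]) = par M a + pr i"
  using par_tensor_append[of n M a "[i]" "Vmod n"] by simp

lemma lam_nonzero:
  assumes "presmod n M" "lam M i a b j \<noteq> 0"
  shows "i \<in> II n" "j \<in> II n" "i \<le> j" "a \<in> bas M" "b \<in> bas M" "par M a = par M b + pr i + pr j"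
proof -
  have *: "gact M (i, j) a b \<noteq> 0" using assms(2) by (auto simp: lam_def)
  show "i \<in> II n" "j \<in> II n" "i \<le> j" "a \<in> bas M" "b \<in> bas M" "par M a = par M b + pr i + pr j"
    using presmod_gact[OF assms(1) *] presmod_gact_parity[OF assms(1) *] by (auto simp: Uq_gens_def)
qed

lemma premor_Lt:
  assumes M: "presmod n M" shows "premor n (Lt n M)"
  unfolding premor_def
proof (intro conjI allI impI)
  fix x y assume n0: "mat (Lt n M) x y \<noteq> 0"
  then show "x \<in> bas (tgt (Lt n M))" "y \<in> bas (src (Lt n M))"
    by (auto simp: Lt_def split: if_splits)
  then obtain i a b j where "x = i # a" "y = b @ [j]" "i \<in> II n" "j \<in> II n" "a \<in> bas M" "b \<in> bas M"
    by (auto simp: bas_V_left bas_V_right)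
  then show "par (tgt (Lt n M)) x + par (src (Lt n M)) y = mpar (Lt n M)"
    using lam_nonzero[OF M, of i a b j] n0
    by (simp add: mat_Lt par_V_left par_V_right M ac_simps)
qed (use M presmod_V presmod_tensor in auto)

text \<open>Since braidings with tensor products compose as in \<open>Lt_tensor\<close>, this
  identity says that \<open>Lt n M\<close> is itself natural in the sense of
  \<open>braid_natural\<close>.\<close>

definition hexagon :: "nat \<Rightarrow> smodule \<Rightarrow> bool" where
  "hexagon n M \<longleftrightarrow>
     smor_comp (smor_tensor n (Tmap n) (smor_id M))
       (smor_comp (smor_tensor n (smor_id (Vmod n)) (Lt n M)) (smor_tensor n (Lt n M) (smor_id (Vmod n)))) =
     smor_comp (smor_tensor n (smor_id (Vmod n)) (Lt n M))
       (smor_comp (smor_tensor n (Lt n M) (smor_id (Vmod n))) (smor_tensor n (smor_id M) (Tmap n)))"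

definition hexagon_entries :: "nat \<Rightarrow> smodule \<Rightarrow> bool" where
  "hexagon_entries n M \<longleftrightarrow> (\<forall>i\<in>II n. \<forall>k\<in>II n. \<forall>j\<in>II n. \<forall>l\<in>II n. \<forall>a\<in>bas M. \<forall>b\<in>bas M.
     (\<Sum>x\<in>II n. \<Sum>y\<in>II n. mat (Tmap n) [i, k] [x, y] * (\<Sum>c\<in>bas M. lam M x c b j * lam M y a c l)) =
     (\<Sum>x\<in>II n. \<Sum>y\<in>II n. (\<Sum>c\<in>bas M. lam M i c b x * lam M k a c y) * mat (Tmap n) [x, y] [j, l]))"

lemma mat_Lt_Lt:
  assumes M: "presmod n M" and "i \<in> II n" "k \<in> II n" "j \<in> II n" "l \<in> II n" "a \<in> bas M" "b \<in> bas M"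
  shows "mat (smor_comp (smor_tensor n (smor_id (Vmod n)) (Lt n M)) (smor_tensor n (Lt n M) (smor_id (Vmod n))))
     (i # k # a) (b @ [j, l]) = (\<Sum>c\<in>bas M. lam M i c b j * lam M k a c l)"
proof -
  let ?F = "smor_tensor n (smor_id (Vmod n)) (Lt n M)"
  have "mat (smor_comp ?F (smor_tensor n (Lt n M) (smor_id (Vmod n)))) (i # k # a) ((b @ [j]) @ [l])
     = (\<Sum>w\<in>bas (tgt (Lt n M)). mat ?F (i # k # a) (w @ [l]) * mat (Lt n M) w (b @ [j]))"
    by (rule comp_col_right[OF premor_Lt[OF M] presmod_V]) (use assms in \<open>auto simp: bas_V_right\<close>)
  also have "\<dots> = (\<Sum>p\<in>II n. \<Sum>c\<in>bas M. mat ?F ([i] @ (k # a)) ([p] @ (c @ [l])) * lam M p c b j)"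
    by (simp add: sum_bas_tensor[OF presmod_V] sum_singletons)
      (intro sum.cong HOL.refl; simp add: mat_Lt assms)
  also have "\<dots> = (\<Sum>p\<in>II n. if p = i then (\<Sum>c\<in>bas M. lam M i c b j * lam M k a c l) else 0)"
  proof (rule sum.cong[OF HOL.refl])
    fix p assume "p \<in> II n"
    then have "mat ?F ([i] @ (k # a)) ([p] @ (c @ [l])) = (if p = i then lam M k a c l else 0)" if "c \<in> bas M" for c
      using mat_tensor_append[of "[i]" "smor_id (Vmod n)" "[p]" n "Lt n M" "k # a" "c @ [l]"]
        assms that by (auto simp: mat_Lt)
    then show "(\<Sum>c\<in>bas M. mat ?F ([i] @ (k # a)) ([p] @ (c @ [l])) * lam M p c b j)
      = (if p = i then (\<Sum>c\<in>bas M. lam M i c b j * lam M k a c l) else 0)"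
      by (auto simp: mult.commute)
  qed
  finally show ?thesis using assms by simp
qed

lemma hexagon_iff_entries:
  assumes M: "presmod n M"
  shows "hexagon n M \<longleftrightarrow> hexagon_entries n M"
proof -
  note V = presmod_V[of n]
  let ?LL = "smor_comp (smor_tensor n (smor_id (Vmod n)) (Lt n M)) (smor_tensor n (Lt n M) (smor_id (Vmod n)))"
  let ?L = "smor_comp (smor_tensor n (Tmap n) (smor_id M)) ?LL"
  let ?R = "smor_comp ?LL (smor_tensor n (smor_id M) (Tmap n))"
  have LL: "premor n ?LL" "src ?LL = smod_tensor n M (VV n)" "tgt ?LL = smod_tensor n (VV n) M"
    by (intro premor_comp premor_tensor premor_id V M premor_Lt)
       (simp_all add: smod_tensor_assoc V M)
  have L: "premor n ?L"
    by (rule premor_comp[OF premor_tensor[OF premor_T premor_id[OF M]] LL(1)]) (simp only: LL; simp)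
  have R: "premor n ?R"
    by (rule premor_comp[OF LL(1) premor_tensor[OF premor_id[OF M] premor_T]]) (simp only: LL; simp)
  have "hexagon n M \<longleftrightarrow> ?L = ?R" by (simp add: hexagon_def smor_comp_assoc)
  also have "\<dots> \<longleftrightarrow> (\<forall>u\<in>bas (tgt ?L). \<forall>v\<in>bas (src ?L). mat ?L u v = mat ?R u v)"
    using premor_eqI[OF L R] LL by (auto simp del: smor_comp_sel(4))
  also have "\<dots> \<longleftrightarrow> (\<forall>i\<in>II n. \<forall>k\<in>II n. \<forall>a\<in>bas M. \<forall>b\<in>bas M. \<forall>j\<in>II n. \<forall>l\<in>II n. 
      mat ?L (i # k # a) (b @ [j, l]) = mat ?R (i # k # a) (b @ [j, l]))"
    unfolding smor_comp_sel(1)[of _ ?LL] smor_comp_sel(2)[of _ ?LL] LL(2)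
    by (simp add: bas_tensor_UN[of n "VV n"] bas_tensor_UN[of n M] bas_VV)
  also have "\<dots> \<longleftrightarrow> hexagon_entries n M"
  proof -
    have "mat ?L (i # k # a) (b @ [j, l]) =
        (\<Sum>x\<in>II n. \<Sum>y\<in>II n. mat (Tmap n) [i, k] [x, y] * (\<Sum>c\<in>bas M. lam M x c b j * lam M y a c l))"
      "mat ?R (i # k # a) (b @ [j, l]) =
        (\<Sum>x\<in>II n. \<Sum>y\<in>II n. (\<Sum>c\<in>bas M. lam M i c b x * lam M k a c y) * mat (Tmap n) [x, y] [j, l])"
      if *: "i \<in> II n" "k \<in> II n" "j \<in> II n" "l \<in> II n" "a \<in> bas M" "b \<in> bas M" for i k j l a b
    proof -
      have "mat ?L ([i, k] @ a) (b @ [j, l]) = (\<Sum>x\<in>bas (src (Tmap n)). mat (Tmap n) [i, k] x * mat ?LL (x @ a) (b @ [j, l]))"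
        by (rule comp_row_right[OF premor_T M]) (use * LL in auto)
      then show "mat ?L (i # k # a) (b @ [j, l]) =
        (\<Sum>x\<in>II n. \<Sum>y\<in>II n. mat (Tmap n) [i, k] [x, y] * (\<Sum>c\<in>bas M. lam M x c b j * lam M y a c l))"
        using * by (simp add: sum_bas_VV mat_Lt_Lt[OF M] del: smor_comp_sel(4))
      have "mat ?R (i # k # a) (b @ [j, l]) = psign (mpar (Tmap n) * par M b) *
         (\<Sum>x\<in>bas (tgt (Tmap n)). mat ?LL (i # k # a) (b @ x) * mat (Tmap n) x [j, l])"
        by (rule comp_col_left[OF M premor_T]) (use * in auto)
      then show "mat ?R (i # k # a) (b @ [j, l]) =
        (\<Sum>x\<in>II n. \<Sum>y\<in>II n. (\<Sum>c\<in>bas M. lam M i c b x * lam M k a c y) * mat (Tmap n) [x, y] [j, l])"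
        using * by (simp add: sum_bas_VV mat_Lt_Lt[OF M] del: smor_comp_sel(4))
    qed
    then show ?thesis unfolding hexagon_entries_def
      by (simp del: smor_comp_sel(4)) blast
  qed
  finally show ?thesis .
qed

text \<open>The first factor on the right depends on the outer indices and on \<open>b\<close> only
  and is the same as in \<open>RLL_sign_right\<close>, so it cancels from the RLL relation. The
  hypothesis expresses that Theta is even.\<close>

lemma RLL_sign_left:
  fixes b i j k l m r :: bit
  assumes "m + j = r + l"
  shows "psign ((i + m + k + r) * (m + j + r + l) + (k + r) * (m + j) + (i + m) * (k + r))
     = psign (b * (j + l) + k + i + i * k + l * j + k * j + (k + i) * (j + l)) *
       (psign (r * b + k + k * r) * psign (m * (b + k + r) + i + i * m) * psign (r * m + (r + l) * j) :: Cq)"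
  using assms by (cases b; cases i; cases j; cases k; cases l; cases m; cases r; simp)

lemma RLL_sign_right:
  fixes b i j k l m r :: bit
  assumes "i + m = k + r"
  shows "psign ((i + m + k + l) * (m + j) + (k + l) * (m + j) + (i + m + k + r) * (r + l))
     = psign (b * (j + l) + k + i + i * k + l * j + k * j + (k + i) * (j + l)) *
       (psign (j * b + m + m * j) * psign (l * (b + m + j) + r + r * l) * psign (k * i + (k + r) * m) :: Cq)"
  using assms by (cases b; cases i; cases j; cases k; cases l; cases m; cases r; simp)

lemma RLL_if_hexagon:
  assumes M: "presmod n M" and hex: "hexagon n M"
  shows "RLL_matrices n M"
  unfolding RLL_matrices_def
proof (intro ballI)
  fix i j k l a b assume *: "i \<in> II n" "j \<in> II n" "k \<in> II n" "l \<in> II n" "a \<in> bas M" "b \<in> bas M"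
  let ?G = "psign (par M b * (pr j + pr l) + pr k + pr i + pr i * pr k + pr l * pr j + pr k * pr j
    + (pr k + pr i) * (pr j + pr l)) :: Cq"
  let ?t = "mat (Tmap n)"
  have left: "psign (LLT_par i j k l m r) * (gact M (i, m) a c * gact M (k, r) c b * Theta m j r l)
    = ?G * (lam M k c b r * lam M i a c m * ?t [r, m] [j, l])"
    if mr: "m \<in> II n" "r \<in> II n" for m r c
  proof (cases "gact M (k, r) c b = 0 \<or> Theta m j r l = 0")
    case True
    then show ?thesis using mr * by (auto simp: lam_def mat_Tmap_Theta)
  next
    case False
    then have p: "par M c = par M b + pr k + pr r" "pr m + pr j = pr r + pr l"
      using presmod_gact_parity[OF M, of k r c b] Theta_parity[of m j r l] mr * II_nonzero by auto
    show ?thesis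
      unfolding LLT_par_def
      by (subst RLL_sign_left[OF p(2), of _ _ "par M b"])
         (use mr * in \<open>simp add: lam_def p(1) mat_Tmap_Theta ac_simps\<close>)
  qed
  have right: "psign (TLL_par i j k l m r) * (Theta i m k r * gact M (r, l) a c * gact M (m, j) c b)
    = ?G * (?t [k, i] [m, r] * (lam M m c b j * lam M r a c l))"
    if mr: "m \<in> II n" "r \<in> II n" for m r c
  proof (cases "gact M (m, j) c b = 0 \<or> Theta i m k r = 0")
    case True
    then show ?thesis using mr * by (auto simp: lam_def mat_Tmap_Theta)
  next
    case False
    then have p: "par M c = par M b + pr m + pr j" "pr i + pr m = pr k + pr r"
      using presmod_gact_parity[OF M, of m j c b] Theta_parity[of i m k r] mr * II_nonzero by auto
    show ?thesis
      unfolding TLL_par_def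
      by (subst RLL_sign_right[OF p(2), of _ _ "par M b"])
         (use mr * in \<open>simp add: lam_def p(1) mat_Tmap_Theta ac_simps\<close>)
  qed
  show "(\<Sum>m\<in>II n. \<Sum>r\<in>II n. \<Sum>c\<in>bas M.
        psign (LLT_par i j k l m r) * (gact M (i, m) a c * gact M (k, r) c b * Theta m j r l)) =
     (\<Sum>m\<in>II n. \<Sum>r\<in>II n. \<Sum>c\<in>bas M.
        psign (TLL_par i j k l m r) * (Theta i m k r * gact M (r, l) a c * gact M (m, j) c b))"
    (is "?L = ?R")
  proof -
    let ?H = "\<lambda>r m. (\<Sum>c\<in>bas M. lam M k c b r * lam M i a c m) * ?t [r, m] [j, l]"
    have "?L = ?G * (\<Sum>m\<in>II n. \<Sum>r\<in>II n. ?H r m)"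
      by (simp add: left sum_distrib_left sum_distrib_right cong: sum.cong)
    also have "(\<Sum>m\<in>II n. \<Sum>r\<in>II n. ?H r m) = (\<Sum>r\<in>II n. \<Sum>m\<in>II n. ?H r m)"
      by (rule sum.swap)
    \<comment> \<open>This is the hexagon at the row \<open>k, i\<close>, the order being reversed
      by the flip inside \<open>Tmap\<close>; its right-hand side is the left-hand side of
      RLL.\<close>
    also have "\<dots> = (\<Sum>m\<in>II n. \<Sum>r\<in>II n. ?t [k, i] [m, r] * (\<Sum>c\<in>bas M. lam M m c b j * lam M r a c l))"
      by (rule hex[unfolded hexagon_iff_entries[OF M] hexagon_entries_def, rule_format,
            OF *(3) *(1) *(2) *(4-6), symmetric])
    also have "?G * \<dots> = ?R"
      by (simp add: right sum_distrib_left cong: sum.cong)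
    finally show ?thesis .
  qed
qed


subsection \<open>Morphisms as natural transformations\<close>

text \<open>No sign is written for odd \<open>f\<close>, because the tensor product with the
  identity on the left already contains it.\<close>

definition braid_natural :: "nat \<Rightarrow> smor \<Rightarrow> bool" where
  "braid_natural n f \<longleftrightarrow>
     smor_comp (Lt n (tgt f)) (smor_tensor n f (smor_id (Vmod n))) =
     smor_comp (smor_tensor n (smor_id (Vmod n)) f) (Lt n (src f))"

lemma braid_natural_iff_entries:
  assumes f: "premor n f"
  shows "braid_natural n f \<longleftrightarrow> (\<forall>i\<in>II n. \<forall>j\<in>II n. \<forall>a\<in>bas (tgt f). \<forall>b\<in>bas (src f).
    (\<Sum>c\<in>bas (tgt f). lam (tgt f) i a c j * mat f c b) =
    psign (mpar f * pr i) * (\<Sum>c\<in>bas (src f). mat f a c * lam (src f) i c b j))"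
    (is "_ \<longleftrightarrow> ?E")
proof -
  note V = presmod_V[of n] and M = premor_presmod[OF f]
  let ?L = "smor_comp (Lt n (tgt f)) (smor_tensor n f (smor_id (Vmod n)))"
  let ?R = "smor_comp (smor_tensor n (smor_id (Vmod n)) f) (Lt n (src f))"
  have L: "premor n ?L" by (intro premor_comp premor_tensor premor_id V M premor_Lt f) simp
  have R: "premor n ?R" by (intro premor_comp premor_tensor premor_id V M premor_Lt f) simp
  have "braid_natural n f \<longleftrightarrow> (\<forall>u\<in>bas (tgt ?L). \<forall>v\<in>bas (src ?L). mat ?L u v = mat ?R u v)"
    unfolding braid_natural_def using premor_eqI[OF L R] by (auto simp del: smor_comp_sel(4))
  also have "\<dots> \<longleftrightarrow> (\<forall>i\<in>II n. \<forall>a\<in>bas (tgt f). \<forall>b\<in>bas (src f). \<forall>j\<in>II n. 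
      mat ?L (i # a) (b @ [j]) = mat ?R (i # a) (b @ [j]))"
    by (simp add: bas_V_left bas_V_right del: smor_comp_sel(4))
  also have "\<dots> \<longleftrightarrow> ?E"
  proof -
    have "mat ?L (i # a) (b @ [j]) = (\<Sum>c\<in>bas (tgt f). lam (tgt f) i a c j * mat f c b)"
      "mat ?R (i # a) (b @ [j]) = psign (mpar f * pr i) * (\<Sum>c\<in>bas (src f). mat f a c * lam (src f) i c b j)"
      if *: "i \<in> II n" "j \<in> II n" "a \<in> bas (tgt f)" "b \<in> bas (src f)" for i j a b
    proof -
      have "mat ?L (i # a) (b @ [j]) = (\<Sum>c\<in>bas (tgt f). mat (Lt n (tgt f)) (i # a) (c @ [j]) * mat f c b)"
        by (rule comp_col_right[OF f V]) (use * in auto)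
      then show "mat ?L (i # a) (b @ [j]) = (\<Sum>c\<in>bas (tgt f). lam (tgt f) i a c j * mat f c b)"
        using * by (simp add: mat_Lt del: smor_comp_sel(4))
      have "mat ?R ([i] @ a) (b @ [j]) = psign (mpar f * par (Vmod n) [i]) *
          (\<Sum>c\<in>bas (src f). mat f a c * mat (Lt n (src f)) ([i] @ c) (b @ [j]))"
        by (rule comp_row_left[OF V f]) (use * in auto)
      then show "mat ?R (i # a) (b @ [j]) = psign (mpar f * pr i) * (\<Sum>c\<in>bas (src f). mat f a c * lam (src f) i c b j)"
        using * by (simp add: mat_Lt del: smor_comp_sel(4))
    qed
    then show ?thesis by (simp del: smor_comp_sel(4)) blast
  qed
  finally show ?thesis .
qed

text \<open>For fixed \<open>i\<close> and \<open>j\<close>, naturality is the relation for u_ij up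
  to sign. The part \<open>pr i\<close> of the sign comes from moving \<open>f\<close> past v_i, the
  part \<open>pr j\<close> from the parity of the middle vector inside \<open>lam\<close>.\<close>

lemma intertwines_if_braid_natural:
  assumes f: "premor n f" and "braid_natural n f"
  shows "intertwines f"
  unfolding intertwines_def
proof (intro allI ballI)
  fix i j a b assume ab: "a \<in> bas (tgt f)" "b \<in> bas (src f)"
  note M = premor_presmod[OF f]
  show "(\<Sum>c\<in>bas (src f). mat f a c * gact (src f) (i, j) c b) =
     psign (mpar f * (pr i + pr j)) * (\<Sum>c\<in>bas (tgt f). gact (tgt f) (i, j) a c * mat f c b)"
  proof (cases "i \<in> II n \<and> j \<in> II n")
    case False
    then have "(i, j) \<notin> Uq_gens n" by (auto simp: Uq_gens_def)
    then show ?thesis using presmod_gact_0[OF M(1)] presmod_gact_0[OF M(2)] by simp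
  next
    case True
    let ?s = "psign (pr j * par (src f) b + pr i + pr i * pr j) :: Cq"
    have 1: "(\<Sum>c\<in>bas (tgt f). lam (tgt f) i a c j * mat f c b) =
      ?s * psign (mpar f * pr j) * (\<Sum>c\<in>bas (tgt f). gact (tgt f) (i, j) a c * mat f c b)"
      unfolding sum_distrib_left
    proof (rule sum.cong[OF HOL.refl])
      fix c
      show "lam (tgt f) i a c j * mat f c b = ?s * psign (mpar f * pr j) * (gact (tgt f) (i, j) a c * mat f c b)"
        using premor_parity[OF f, of c b]
        by (cases "mat f c b = 0") (auto simp: lam_def distrib_left psign_add ac_simps)
    qed
    have 2: "(\<Sum>c\<in>bas (src f). mat f a c * lam (src f) i c b j) =
        ?s * (\<Sum>c\<in>bas (src f). mat f a c * gact (src f) (i, j) c b)"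
      by (simp add: lam_def sum_distrib_left ac_simps)
    have "?s * psign (mpar f * pr j) * (\<Sum>c\<in>bas (tgt f). gact (tgt f) (i, j) a c * mat f c b) =
      psign (mpar f * pr i) * (?s * (\<Sum>c\<in>bas (src f). mat f a c * gact (src f) (i, j) c b))"
      unfolding 1[symmetric] 2[symmetric]
      using assms(2)[unfolded braid_natural_iff_entries[OF f], rule_format, of i j a b] ab True by blast
    then have "?s * psign (mpar f * pr i) * (?s * psign (mpar f * pr j) * (\<Sum>c\<in>bas (tgt f). gact (tgt f) (i, j) a c * mat f c b)) =
      ?s * psign (mpar f * pr i) * (psign (mpar f * pr i) * (?s * (\<Sum>c\<in>bas (src f). mat f a c * gact (src f) (i, j) c b)))"
      by simp
    then show ?thesis
      by (simp add: distrib_left psign_add ac_simps)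
  qed
qed

text \<open>From here on composites are rewritten as arrows, which would be blocked by expanding
  them into sums.\<close>

declare smor_comp_sel(4) [simp del]

section \<open>Consequences of the interchange law\<close>

lemma smor_scale_1 [simp]: "smor_scale 1 f = f"
  by (simp add: smor_scale_def)

lemma tensor_comp_id_right:
  assumes "premor n g" "premor n f" "src g = tgt f" "presmod n N"
  shows "smor_tensor n (smor_comp g f) (smor_id N) =
    smor_comp (smor_tensor n g (smor_id N)) (smor_tensor n f (smor_id N))"
  using smor_interchange[OF assms(1) premor_id[OF assms(4)] assms(2) premor_id[OF assms(4)] assms(3)]
    smor_comp_id_left[OF premor_id[OF assms(4)]] by simp

lemma tensor_comp_id_left:
  assumes "premor n g" "premor n f" "src g = tgt f" "presmod n N"
  shows "smor_tensor n (smor_id N) (smor_comp g f) =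
    smor_comp (smor_tensor n (smor_id N) g) (smor_tensor n (smor_id N) f)"
  using smor_interchange[OF premor_id[OF assms(4)] assms(1) premor_id[OF assms(4)] assms(2) _ assms(3)]
    smor_comp_id_left[OF premor_id[OF assms(4)]] by simp

lemma tensor_split:
  assumes f: "premor n f" and g: "premor n g"
  shows "smor_comp (smor_tensor n f (smor_id (tgt g))) (smor_tensor n (smor_id (src f)) g) = smor_tensor n f g"
  using smor_interchange[OF f premor_id[OF premor_presmod(2)[OF g]] premor_id[OF premor_presmod(1)[OF f]] g]
    smor_comp_id_left[OF g] smor_comp_id_right[OF f] by simp

text \<open>In this order the interchange law produces \<open>psign (mpar f * mpar g)\<close>, so
  one factor has to be even. In the applications that factor is a braiding.\<close>

lemma tensor_split_even:
  assumes f: "premor n f" and g: "premor n g" and "mpar f = 0 \<or> mpar g = 0"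
  shows "smor_comp (smor_tensor n (smor_id (tgt f)) g) (smor_tensor n f (smor_id (src g))) = smor_tensor n f g"
  using smor_interchange[OF premor_id[OF premor_presmod(2)[OF f]] g f premor_id[OF premor_presmod(1)[OF g]]]
    smor_comp_id_left[OF f] smor_comp_id_right[OF g] assms(3) by auto

lemma premor_tensor_id:
  assumes "premor n f" "presmod n M"
  shows "premor n (smor_tensor n f (smor_id M))" "premor n (smor_tensor n (smor_id M) f)"
  by (intro premor_tensor premor_id assms)+

text \<open>The sign inside \<open>lam\<close> absorbs the Koszul sign of the coproduct, which
  thereby becomes a matrix product in the index \<open>k\<close>.\<close>

lemma lam_tensor:
  assumes M: "presmod n M" and N: "presmod n N"
    and *: "i \<in> II n" "j \<in> II n" "a \<in> bas M" "b \<in> bas M" "a' \<in> bas N" "b' \<in> bas N"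
  shows "lam (smod_tensor n M N) i (a @ a') (b @ b') j = (\<Sum>k\<in>II n. lam M i a b k * lam N k a' b' j)"
proof -
  have l: "length a = wlen M" "length b = wlen M" using * presmod_length[OF M] by auto
  have "psign (pr j * (par M b + par N b') + pr i + pr i * pr j) *
      (psign ((pr k + pr j) * par M b) * gact M (i, k) a b * gact N (k, j) a' b') =
      lam M i a b k * lam N k a' b' j" if k: "k \<in> II n" for k
  proof (cases "i \<le> k \<and> k \<le> j")
    case False
    then have "gact M (i, k) a b = 0 \<or> gact N (k, j) a' b' = 0"
      using presmod_gact_0[OF M, of i k] presmod_gact_0[OF N, of k j] by (auto simp: Uq_gens_def)
    then show ?thesis by (auto simp: lam_def)
  next
    case True
    \<comment> \<open>The sign identity below fails when \<open>pr i = pr j\<close> differs from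
      \<open>pr k\<close>; the chain \<open>i <= k <= j\<close> excludes this.\<close>
    then have "pr k = pr i \<or> pr k = pr j" by (auto simp: pr_def)
    then have "psign (pr j * (par M b + par N b') + pr i + pr i * pr j) * psign ((pr k + pr j) * par M b)
      = (psign (pr k * par M b + pr i + pr i * pr k) * psign (pr j * par N b' + pr k + pr k * pr j) :: Cq)"
      by (cases "pr i"; cases "pr j"; cases "par M b"; cases "par N b'"; auto)
    then show ?thesis by (simp add: lam_def)
  qed
  then show ?thesis
    unfolding lam_def[of "smod_tensor n M N"] gact_tensor[OF M N]
    by (simp add: l par_tensor_append[OF M] * sum_distrib_left)
qed

text \<open>The strand \<open>V\<close> crosses \<open>N\<close> first and then \<open>M\<close>;
  the index \<open>k\<close> of \<open>lam_tensor\<close> labels it in between.\<close>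

lemma Lt_tensor:
  assumes M: "presmod n M" and N: "presmod n N"
  shows "Lt n (smod_tensor n M N) =
    smor_comp (smor_tensor n (Lt n M) (smor_id N)) (smor_tensor n (smor_id M) (Lt n N))"
proof (rule premor_eqI[of n])
  note V = presmod_V[of n]
  show "premor n (Lt n (smod_tensor n M N))" by (intro premor_Lt presmod_tensor M N)
  let ?R = "smor_comp (smor_tensor n (Lt n M) (smor_id N)) (smor_tensor n (smor_id M) (Lt n N))"
  show "premor n ?R"
    by (intro premor_comp premor_tensor_id premor_Lt M N) (simp add: smod_tensor_assoc M N V)
  show "src (Lt n (smod_tensor n M N)) = src ?R" "tgt (Lt n (smod_tensor n M N)) = tgt ?R"
    by (simp_all add: smod_tensor_assoc M N V)
  fix x y assume "x \<in> bas (tgt (Lt n (smod_tensor n M N)))" "y \<in> bas (src (Lt n (smod_tensor n M N)))"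
  then obtain i j a a' b b' where x: "x = i # a @ a'" and y: "y = b @ b' @ [j]" and
    *: "i \<in> II n" "j \<in> II n" "a \<in> bas M" "b \<in> bas M" "a' \<in> bas N" "b' \<in> bas N"
    by (auto simp: bas_V_left bas_V_right bas_tensor_UN[of n M N])
  have "mat ?R ((i # a) @ a') (b @ (b' @ [j])) = (\<Sum>w\<in>bas (src (Lt n M)). mat (Lt n M) (i # a) w *
     mat (smor_tensor n (smor_id M) (Lt n N)) (w @ a') (b @ b' @ [j]))"
    by (rule comp_row_right[OF premor_Lt[OF M] N]) (use * in \<open>auto simp: bas_V_left smod_tensor_assoc M N V\<close>)
  also have "\<dots> = (\<Sum>c\<in>bas M. \<Sum>k\<in>II n. lam M i a c k * mat (smor_tensor n (smor_id M) (Lt n N)) (c @ (k # a')) (b @ (b' @ [j])))"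
    by (simp add: sum_bas_tensor M sum_singletons)
      (intro sum.cong HOL.refl; simp add: mat_Lt *)
  also have "\<dots> = (\<Sum>c\<in>bas M. if c = b then (\<Sum>k\<in>II n. lam M i a b k * lam N k a' b' j) else 0)"
  proof (rule sum.cong[OF HOL.refl])
    fix c assume c: "c \<in> bas M"
    have "mat (smor_tensor n (smor_id M) (Lt n N)) (c @ (k # a')) (b @ (b' @ [j]))
      = (if c = b then lam N k a' b' j else 0)" if "k \<in> II n" for k
      by (subst mat_tensor_append) (use c * that presmod_length[OF M] in \<open>auto simp: mat_Lt\<close>)
    then show "(\<Sum>k\<in>II n. lam M i a c k * mat (smor_tensor n (smor_id M) (Lt n N)) (c @ (k # a')) (b @ (b' @ [j])))
       = (if c = b then (\<Sum>k\<in>II n. lam M i a b k * lam N k a' b' j) else 0)" by simp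
  qed
  also have "\<dots> = lam (smod_tensor n M N) i (a @ a') (b @ b') j"
    using * presmod_finite[OF M] lam_tensor[OF M N *] by simp
  also have "\<dots> = mat (Lt n (smod_tensor n M N)) (i # (a @ a')) ((b @ b') @ [j])"
    by (rule mat_Lt[symmetric]) (use * in \<open>auto simp: bas_tensor\<close>)
  finally show "mat (Lt n (smod_tensor n M N)) x y = mat ?R x y"
    by (simp add: x y)
qed simp

lemma Lt_unit: "Lt n (smod_unit n) = smor_id (Vmod n)"
proof (rule premor_eqI[OF premor_Lt[OF presmod_unit] premor_id[OF presmod_V]])
  fix x y assume "x \<in> bas (tgt (Lt n (smod_unit n)))" "y \<in> bas (src (Lt n (smod_unit n)))"
  then obtain i j where *: "i \<in> II n" "j \<in> II n" "x = [i]" "y = [j]"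
    by (auto simp: bas_V_left bas_V_right)
  show "mat (Lt n (smod_unit n)) x y = mat (smor_id (Vmod n)) x y"
    using mat_Lt[of i n j "[]" "smod_unit n" "[]"] *
    by (auto simp: lam_def smod_unit_def Uq_gens_def)
qed (simp_all add: smod_tensor_unit_left smod_tensor_unit_right presmod_V)

lemma hexagon_unit: "hexagon n (smod_unit n)"
  unfolding hexagon_def Lt_unit
  using smor_comp_id_left[OF premor_T] smor_comp_id_right[OF premor_T]
    smor_comp_id_left[OF premor_id[OF presmod_tensor[OF presmod_V presmod_V]]]
  by (simp add: smor_tensor_id presmod_V smor_tensor_unit_left smor_tensor_unit_right premor_T)

text \<open>T slides through in two steps: the hexagon of \<open>M\<close> moves it from the left of
  \<open>M\<close> (\<open>?T1\<close>) to the place between \<open>M\<close> and \<open>N\<close>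
  (\<open>?T2\<close>), the hexagon of \<open>N\<close> from there to the right of \<open>N\<close>
  (\<open>?T3\<close>).\<close>

lemma hexagon_tensor:
  assumes M: "presmod n M" and N: "presmod n N" and hM: "hexagon n M" and hN: "hexagon n N"
  shows "hexagon n (smod_tensor n M N)"
proof -
  note V = presmod_V[of n]
  note P = premor_tensor_id premor_Lt premor_T premor_id presmod_tensor M N V
  note S = smod_tensor_assoc[OF _ _ _, of n] M N V presmod_tensor
  let ?c = smor_comp and ?t = "smor_tensor n" and ?V = "smor_id (Vmod n)" and ?M = "smor_id M"
    and ?N = "smor_id N" and ?L = "Lt n (smod_tensor n M N)"
  let ?A = "?t (?t ?V (Lt n M)) ?N" and ?B = "?t (?t ?V ?M) (Lt n N)"
  let ?C = "?t (Lt n M) (?t ?N ?V)" and ?D = "?t ?M (?t (Lt n N) ?V)"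
  let ?C' = "?t (?t (Lt n M) ?V) ?N" and ?B' = "?t ?M (?t ?V (Lt n N))"
  let ?T1 = "?t (?t (Tmap n) ?M) ?N" and ?T2 = "?t ?M (?t (Tmap n) ?N)" and ?T3 = "?t ?M (?t ?N (Tmap n))"
  have AB: "?t ?V ?L = ?c ?A ?B"
    by (subst Lt_tensor[OF M N], subst tensor_comp_id_left) (simp_all add: P S smor_tensor_assoc)
  have CD: "?t ?L ?V = ?c ?C ?D"
    by (subst Lt_tensor[OF M N], subst tensor_comp_id_right)
       (simp_all add: P S smor_tensor_assoc smor_tensor_id)
  \<comment> \<open>The crossing of \<open>M\<close> with one strand and that of \<open>N\<close>
    with the other involve disjoint factors, so they commute; this regroups the four crossings by
    module.\<close>
  have BC: "?c ?B ?C = ?c ?C' ?B'"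
  proof -
    have "?c ?B ?C = ?t (Lt n M) (Lt n N)"
      using tensor_split_even[OF premor_Lt[OF M] premor_Lt[OF N]] by (simp add: smor_tensor_id M N V)
    also have "\<dots> = ?c (?t (Lt n M) (smor_id (smod_tensor n (Vmod n) N))) (?t (smor_id (smod_tensor n M (Vmod n))) (Lt n N))"
      using tensor_split[OF premor_Lt[OF M] premor_Lt[OF N]] by simp
    also have "?t (Lt n M) (smor_id (smod_tensor n (Vmod n) N)) = ?C'"
      by (simp add: smor_tensor_assoc smor_tensor_id P)
    also have "?t (smor_id (smod_tensor n M (Vmod n))) (Lt n N) = ?B'"
      by (simp add: smor_tensor_assoc P flip: smor_tensor_id)
    finally show ?thesis .
  qed
  have hM': "?c ?T1 (?c ?A ?C') = ?c ?A (?c ?C' ?T2)"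
  proof -
    have "?c ?T1 (?c ?A ?C') = ?t (?c (?t (Tmap n) ?M) (?c (?t ?V (Lt n M)) (?t (Lt n M) ?V))) ?N"
      by (simp add: tensor_comp_id_right premor_comp P S)
    also have "\<dots> = ?t (?c (?t ?V (Lt n M)) (?c (?t (Lt n M) ?V) (?t ?M (Tmap n)))) ?N"
      using hM unfolding hexagon_def by simp
    also have "\<dots> = ?c ?A (?c ?C' ?T2)"
      by (simp add: tensor_comp_id_right premor_comp P S) (simp add: smor_tensor_assoc P)
    finally show ?thesis .
  qed
  have hN': "?c ?T2 (?c ?B' ?D) = ?c ?B' (?c ?D ?T3)"
  proof -
    have "?c ?T2 (?c ?B' ?D) = ?t ?M (?c (?t (Tmap n) ?N) (?c (?t ?V (Lt n N)) (?t (Lt n N) ?V)))"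
      by (simp add: tensor_comp_id_left premor_comp P S)
    also have "\<dots> = ?t ?M (?c (?t ?V (Lt n N)) (?c (?t (Lt n N) ?V) (?t ?N (Tmap n))))"
      using hN unfolding hexagon_def by simp
    also have "\<dots> = ?c ?B' (?c ?D ?T3)"
      by (simp add: tensor_comp_id_left premor_comp P S)
    finally show ?thesis .
  qed
  have T1: "?t (Tmap n) (smor_id (smod_tensor n M N)) = ?T1"
    by (simp add: smor_tensor_assoc smor_tensor_id P)
  have T3: "?t (smor_id (smod_tensor n M N)) (Tmap n) = ?T3"
    by (simp add: smor_tensor_assoc P flip: smor_tensor_id)
  have "?c ?T1 (?c (?c ?A ?B) (?c ?C ?D)) = ?c ?T1 (?c ?A (?c (?c ?B ?C) ?D))"
    by (simp only: smor_comp_assoc)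
  also have "\<dots> = ?c (?c ?T1 (?c ?A ?C')) (?c ?B' ?D)"
    by (simp only: BC smor_comp_assoc)
  also have "\<dots> = ?c ?A (?c ?C' (?c ?T2 (?c ?B' ?D)))"
    by (simp only: hM' smor_comp_assoc)
  also have "\<dots> = ?c ?A (?c (?c ?C' ?B') (?c ?D ?T3))"
    by (simp only: hN' smor_comp_assoc)
  also have "\<dots> = ?c (?c ?A ?B) (?c (?c ?C ?D) ?T3)"
    by (simp only: BC[symmetric] smor_comp_assoc)
  finally show ?thesis
    unfolding hexagon_def T1 T3 AB CD .
qed


section \<open>Supermodules whose relations are checked on generators\<close>

definition invertible_diagonal :: "nat \<Rightarrow> smodule \<Rightarrow> bool" where
  "invertible_diagonal n M \<longleftrightarrow> (\<forall>i\<in>II n. \<forall>a\<in>bas M. \<forall>b\<in>bas M.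
      (\<Sum>c\<in>bas M. gact M (i, i) a c * gact M (- i, - i) c b) = (if a = b then 1 else 0))"

text \<open>The last two conditions correspond to the two families of relations. Involving
  generators only, they pass to tensor products directly.\<close>

definition good :: "nat \<Rightarrow> smodule \<Rightarrow> bool" where
  "good n M \<longleftrightarrow> presmod n M \<and> hexagon n M \<and> invertible_diagonal n M"

lemma good_is_smodule: "good n M \<Longrightarrow> is_smodule n M"
  unfolding good_def invertible_diagonal_def
  by (intro is_smodule_if_RLL RLL_if_hexagon) auto

lemma good_unit: "good n (smod_unit n)"
  by (simp add: good_def presmod_unit hexagon_unit invertible_diagonal_def)
     (simp add: smod_unit_def Uq_gens_def)

text \<open>In the coproduct of u_ii triangularity leaves only k = i, so u_ii is grouplike.\<close>

lemma gact_tensor_diagonal: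
  assumes M: "presmod n M" and N: "presmod n N" and "i \<in> II n" "a \<in> bas M" "b \<in> bas M"
  shows "gact (smod_tensor n M N) (i, i) (a @ a') (b @ b') = gact M (i, i) a b * gact N (i, i) a' b'"
proof -
  have l: "length a = wlen M" "length b = wlen M" using assms presmod_length[OF M] by auto
  have "gact M (i, k) a b * gact N (k, i) a' b' = 0" if "k \<noteq> i" for k
    using that presmod_gact[OF M, of i k a b] presmod_gact[OF N, of k i a' b']
    by (fastforce simp: Uq_gens_def)
  then have "gact (smod_tensor n M N) (i, i) (a @ a') (b @ b') =
    (\<Sum>k\<in>II n. if k = i then gact M (i, i) a b * gact N (i, i) a' b' else 0)"
    unfolding gact_tensor[OF M N] by (intro sum.cong HOL.refl) (auto simp: l)
  then show ?thesis using assms by simp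
qed

lemma good_tensor:
  assumes "good n M" "good n N"
  shows "good n (smod_tensor n M N)"
proof -
  have M: "presmod n M" and N: "presmod n N" using assms by (auto simp: good_def)
  have "invertible_diagonal n (smod_tensor n M N)"
    unfolding invertible_diagonal_def
  proof (intro ballI)
    fix i x y assume i: "i \<in> II n" and "x \<in> bas (smod_tensor n M N)" "y \<in> bas (smod_tensor n M N)"
    then obtain a a' b b' where x: "x = a @ a'" and y: "y = b @ b'" and
      *: "a \<in> bas M" "b \<in> bas M" "a' \<in> bas N" "b' \<in> bas N" by (auto simp: bas_tensor)
    have "length a = length b" using * presmod_length[OF M] by simp
    then have "(x = y) = (a = b \<and> a' = b')" by (simp add: x y)
    moreover have "(\<Sum>z\<in>bas (smod_tensor n M N). gact (smod_tensor n M N) (i, i) x z *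
        gact (smod_tensor n M N) (- i, - i) z y) =
      (\<Sum>c\<in>bas M. gact M (i, i) a c * gact M (- i, - i) c b) *
      (\<Sum>c\<in>bas N. gact N (i, i) a' c * gact N (- i, - i) c b')"
      by (simp add: sum_bas_tensor M sum_product)
        (intro sum.cong HOL.refl; simp add: x y gact_tensor_diagonal[OF M N] i *)
    ultimately show "(\<Sum>z\<in>bas (smod_tensor n M N). gact (smod_tensor n M N) (i, i) x z *
        gact (smod_tensor n M N) (- i, - i) z y) = (if x = y then 1 else 0)"
      using assms i * by (auto simp: good_def invertible_diagonal_def)
  qed
  then show ?thesis
    using assms presmod_tensor hexagon_tensor unfolding good_def by blast
qed


subsection \<open>Closure properties of the natural maps\<close>

lemma braid_natural_id: "presmod n M \<Longrightarrow> braid_natural n (smor_id M)"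
  using smor_comp_id_left[OF premor_Lt, of n M] smor_comp_id_right[OF premor_Lt, of n M]
  by (simp add: braid_natural_def smor_tensor_id presmod_V)

lemma braid_natural_comp:
  assumes g: "premor n g" and f: "premor n f" and e: "src g = tgt f"
    and "braid_natural n g" "braid_natural n f"
  shows "braid_natural n (smor_comp g f)"
proof -
  let ?c = smor_comp and ?t = "smor_tensor n" and ?V = "smor_id (Vmod n)"
  have "?c (Lt n (tgt g)) (?t (?c g f) ?V) = ?c (?c (Lt n (tgt g)) (?t g ?V)) (?t f ?V)"
    by (simp add: tensor_comp_id_right[OF g f e presmod_V] smor_comp_assoc)
  also have "\<dots> = ?c (?t ?V g) (?c (Lt n (tgt f)) (?t f ?V))"
    using assms(4) by (simp add: braid_natural_def smor_comp_assoc e)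
  also have "\<dots> = ?c (?t ?V (?c g f)) (Lt n (src f))"
    using assms(5) by (simp add: braid_natural_def smor_comp_assoc tensor_comp_id_left[OF g f e presmod_V])
  finally show ?thesis by (simp add: braid_natural_def)
qed

text \<open>Factor the tensor product as (f tensor 1)(1 tensor g). In each half the map slides past
  a braiding with the other factor, without sign even if it is odd, because braidings are
  even.\<close>

lemma braid_natural_tensor:
  assumes f: "premor n f" and g: "premor n g" and "braid_natural n f" "braid_natural n g"
  shows "braid_natural n (smor_tensor n f g)"
proof -
  note M = premor_presmod[OF f] and N = premor_presmod[OF g] and V = presmod_V[of n]
  note P = premor_tensor_id premor_Lt premor_id presmod_tensor M N V f g
  note S = smod_tensor_assoc[OF _ _ _, of n] M N V presmod_tensor
  let ?c = smor_comp and ?t = "smor_tensor n" and ?V = "smor_id (Vmod n)"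
  have 1: "braid_natural n (?t f (smor_id N))" if N: "presmod n N" for N
  proof -
    let ?N = "smor_id N" and ?M = "smor_id (src f)" and ?M' = "smor_id (tgt f)"
    have "?c (Lt n (smod_tensor n (tgt f) N)) (?t (?t f ?N) ?V) =
      ?c (?t (Lt n (tgt f)) ?N) (?c (?t ?M' (Lt n N)) (?t f (smor_id (smod_tensor n N (Vmod n)))))"
      by (simp add: Lt_tensor N P smor_comp_assoc smor_tensor_assoc smor_tensor_id)
    also have "?c (?t ?M' (Lt n N)) (?t f (smor_id (smod_tensor n N (Vmod n)))) =
       ?c (?t f (smor_id (smod_tensor n (Vmod n) N))) (?t ?M (Lt n N))"
      using tensor_split_even[OF f premor_Lt[OF N]] tensor_split[OF f premor_Lt[OF N]] by simp
    also have "?t f (smor_id (smod_tensor n (Vmod n) N)) = ?t (?t f ?V) ?N"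
      by (simp add: N P smor_tensor_assoc smor_tensor_id)
    also have "?c (?t (Lt n (tgt f)) ?N) (?c (?t (?t f ?V) ?N) (?t ?M (Lt n N))) =
       ?c (?t (?c (Lt n (tgt f)) (?t f ?V)) ?N) (?t ?M (Lt n N))"
      by (subst tensor_comp_id_right) (simp_all add: N P smor_comp_assoc)
    also have "\<dots> = ?c (?t (?c (?t ?V f) (Lt n (src f))) ?N) (?t ?M (Lt n N))"
      using assms(3) by (simp add: braid_natural_def)
    also have "\<dots> = ?c (?t ?V (?t f ?N)) (?c (?t (Lt n (src f)) ?N) (?t ?M (Lt n N)))"
      by (subst tensor_comp_id_right) (simp_all add: N P smor_comp_assoc smor_tensor_assoc)
    finally show ?thesis by (simp add: braid_natural_def Lt_tensor N P)
  qed
  have 2: "braid_natural n (?t (smor_id M) g)" if M: "presmod n M" for M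
  proof -
    let ?M = "smor_id M" and ?N = "smor_id (src g)" and ?N' = "smor_id (tgt g)"
    have "?c (Lt n (smod_tensor n M (tgt g))) (?t (?t ?M g) ?V) =
      ?c (?t (Lt n M) ?N') (?c (?t ?M (Lt n (tgt g))) (?t ?M (?t g ?V)))"
      by (simp add: Lt_tensor M P smor_comp_assoc smor_tensor_assoc)
    also have "?c (?t ?M (Lt n (tgt g))) (?t ?M (?t g ?V)) = ?t ?M (?c (Lt n (tgt g)) (?t g ?V))"
      by (subst tensor_comp_id_left) (simp_all add: M P)
    also have "\<dots> = ?t ?M (?c (?t ?V g) (Lt n (src g)))"
      using assms(4) by (simp add: braid_natural_def)
    also have "\<dots> = ?c (?t (smor_id (smod_tensor n M (Vmod n))) g) (?t ?M (Lt n (src g)))"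
      by (subst tensor_comp_id_left) (simp_all add: M P smor_tensor_assoc flip: smor_tensor_id)
    also have "?c (?t (Lt n M) ?N') (?c (?t (smor_id (smod_tensor n M (Vmod n))) g) (?t ?M (Lt n (src g))))
      = ?c (?c (?t (smor_id (smod_tensor n (Vmod n) M)) g) (?t (Lt n M) ?N)) (?t ?M (Lt n (src g)))"
      using tensor_split_even[OF premor_Lt[OF M] g] tensor_split[OF premor_Lt[OF M] g]
      by (simp add: smor_comp_assoc[symmetric])
    also have "\<dots> = ?c (?t ?V (?t ?M g)) (?c (?t (Lt n M) ?N) (?t ?M (Lt n (src g))))"
      by (simp add: M P smor_comp_assoc smor_tensor_assoc flip: smor_tensor_id)
    finally show ?thesis by (simp add: braid_natural_def Lt_tensor M P)
  qed
  have "braid_natural n (?c (?t f (smor_id (tgt g))) (?t (smor_id (src f)) g))"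
    by (intro braid_natural_comp P 1 2) simp
  then show ?thesis by (simp add: tensor_split[OF f g])
qed

lemma braid_natural_scale:
  assumes f: "premor n f" and "braid_natural n f" shows "braid_natural n (smor_scale r f)"
  using assms(2) unfolding braid_natural_iff_entries[OF f] braid_natural_iff_entries[OF premor_scale[OF f]]
  by (simp add: mult.left_commute[of _ r] mult.assoc flip: sum_distrib_left)

lemma braid_natural_plus:
  assumes f: "premor n f" and g: "premor n g" and e: "src f = src g" "tgt f = tgt g" "mpar f = mpar g"
    and "braid_natural n f" "braid_natural n g"
  shows "braid_natural n (smor_plus f g)"
  using assms(6,7) unfolding braid_natural_iff_entries[OF f] braid_natural_iff_entries[OF g]
    braid_natural_iff_entries[OF premor_plus[OF f g e]]
  by (simp add: e distrib_left distrib_right sum.distrib)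

lemma braid_natural_zero:
  assumes "presmod n M" "presmod n N" shows "braid_natural n (smor_zero M N e)"
  unfolding braid_natural_iff_entries[OF premor_zero[OF assms]] by simp

text \<open>The naturality square of \<open>f\<close> is composed with \<open>g\<close> on both
  sides. This handles r^-, which is given by a formula and not built from maps already known to be
  natural.\<close>

lemma braid_natural_inverse:
  assumes f: "premor n f" and g: "premor n g" and "braid_natural n f"
    and e: "src f = tgt g" "src g = tgt f"
    and fg: "smor_comp f g = smor_id (src g)" and gf: "smor_comp g f = smor_id (src f)"
  shows "braid_natural n g"
proof -
  note M = premor_presmod[OF f] premor_presmod[OF g] and V = presmod_V[of n]
  let ?c = smor_comp and ?t = "smor_tensor n" and ?V = "smor_id (Vmod n)"
  have fg': "?c (?t f ?V) (?t g ?V) = smor_id (smod_tensor n (src g) (Vmod n))"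
    using tensor_comp_id_right[OF f g e(1) V] by (simp add: fg smor_tensor_id e M V)
  have gf': "?c (?t ?V g) (?t ?V f) = smor_id (smod_tensor n (Vmod n) (src f))"
    using tensor_comp_id_left[OF g f e(2) V] by (simp add: gf smor_tensor_id e M V)
  have "?c (Lt n (src f)) (?t g ?V) = ?c (?c (?t ?V g) (?t ?V f)) (?c (Lt n (src f)) (?t g ?V))"
    using smor_comp_id_left[of n "?c (Lt n (src f)) (?t g ?V)"] gf' e
    by (simp add: premor_comp premor_tensor_id premor_Lt M V g)
  also have "\<dots> = ?c (?t ?V g) (?c (?c (?t ?V f) (Lt n (src f))) (?t g ?V))"
    by (simp add: smor_comp_assoc)
  also have "\<dots> = ?c (?t ?V g) (?c (Lt n (tgt f)) (?c (?t f ?V) (?t g ?V)))"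
    by (simp only: assms(3)[unfolded braid_natural_def, symmetric]) (simp only: smor_comp_assoc)
  also have "\<dots> = ?c (?t ?V g) (Lt n (src g))"
    using smor_comp_id_right[OF premor_Lt[OF M(2)]] by (simp add: fg' e)
  finally show ?thesis by (simp add: braid_natural_def e)
qed

section \<open>Existence of the antipode on generators\<close>

lemma falg_on_zero: "0 \<in> falg_on n" and falg_on_one: "1 \<in> falg_on n"
  by (simp_all add: falg_on_def)

lemma falg_on_add: "x \<in> falg_on n \<Longrightarrow> y \<in> falg_on n \<Longrightarrow> x + y \<in> falg_on n"
  unfolding falg_on_def using keys_add[of x y] by blast

lemma falg_on_uminus: "x \<in> falg_on n \<Longrightarrow> - x \<in> falg_on n"
  unfolding falg_on_def by (simp add: in_keys_iff)

lemma falg_on_mult: "x \<in> falg_on n \<Longrightarrow> y \<in> falg_on n \<Longrightarrow> x * y \<in> falg_on n"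
  unfolding falg_on_def using keys_mult[of x y] by fastforce

lemma falg_on_sum: "(\<And>i. i \<in> I \<Longrightarrow> f i \<in> falg_on n) \<Longrightarrow> sum f I \<in> falg_on n"
  by (induction I rule: infinite_finite_induct) (simp_all add: falg_on_zero falg_on_add)

lemma falg_hom_zero: "0 \<in> falg_hom n d"
  by (simp add: falg_hom_def falg_on_zero)

lemma falg_hom_uminus: "x \<in> falg_hom n d \<Longrightarrow> - x \<in> falg_hom n d"
  by (simp add: falg_hom_def falg_on_uminus in_keys_iff)

lemma falg_hom_add: "x \<in> falg_hom n d \<Longrightarrow> y \<in> falg_hom n d \<Longrightarrow> x + y \<in> falg_hom n d"
  unfolding falg_hom_def using keys_add[of x y] falg_on_add by blast

lemma falg_hom_sum: "(\<And>i. i \<in> I \<Longrightarrow> f i \<in> falg_hom n d) \<Longrightarrow> sum f I \<in> falg_hom n d"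
  by (induction I rule: infinite_finite_induct) (simp_all add: falg_hom_zero falg_hom_add)

lemma word_par_plus: "word_par (v + w) = word_par v + word_par w"
  by (simp add: word_par_def)

lemma falg_hom_mult:
  assumes "x \<in> falg_hom n d" "y \<in> falg_hom n e" shows "x * y \<in> falg_hom n (d + e)"
proof -
  have "word_par w = d + e" if "w \<in> Poly_Mapping.keys (x * y)" for w
    using that keys_mult[of x y] assms by (auto simp: falg_hom_def word_par_plus)
  then show ?thesis using assms by (auto simp: falg_hom_def falg_on_mult)
qed

lemma ugen_hom: "i \<in> II n \<Longrightarrow> j \<in> II n \<Longrightarrow> i \<le> j \<Longrightarrow> ugen i j \<in> falg_hom n (pr i + pr j)"
  by (simp add: ugen_def falg_hom_def falg_on_def Uq_gens_def word_par_def)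

lemma falg_hom_on: "x \<in> falg_hom n d \<Longrightarrow> x \<in> falg_on n"
  by (simp add: falg_hom_def)

lemma Lcoef_hom: "i \<in> II n \<Longrightarrow> j \<in> II n \<Longrightarrow> Lcoef i j \<in> falg_hom n (pr i + pr j)"
  by (simp add: Lcoef_def ugen_hom falg_hom_zero)

lemma Uq_ideal_uminus: "x \<in> Uq_ideal n \<Longrightarrow> - x \<in> Uq_ideal n"
  using Uq_ideal.mult[of x n "- 1" 1] by (simp add: falg_on_one falg_on_uminus)

lemma Uq_eq_refl: "x \<in> falg_on n \<Longrightarrow> Uq_eq n x x"
  by (simp add: Uq_eq_def Uq_ideal.zero)

lemma Uq_eq_sym: "Uq_eq n x y \<Longrightarrow> Uq_eq n y x"
  using Uq_ideal_uminus[of "x - y" n] by (simp add: Uq_eq_def)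

lemma Uq_eq_trans: "Uq_eq n x y \<Longrightarrow> Uq_eq n y z \<Longrightarrow> Uq_eq n x z"
  using Uq_ideal.add[of "x - y" n "y - z"] by (simp add: Uq_eq_def)

lemma Uq_eq_add: "Uq_eq n x x' \<Longrightarrow> Uq_eq n y y' \<Longrightarrow> Uq_eq n (x + y) (x' + y')"
  using Uq_ideal.add[of "x - x'" n "y - y'"] by (simp add: Uq_eq_def falg_on_add algebra_simps)

lemma Uq_eq_mult:
  assumes "Uq_eq n x x'" "Uq_eq n y y'" shows "Uq_eq n (x * y) (x' * y')"
proof -
  have "1 * (x - x') * y + x' * (y - y') * 1 \<in> Uq_ideal n"
    using assms by (intro Uq_ideal.add Uq_ideal.mult) (auto simp: Uq_eq_def falg_on_one)
  then show ?thesis using assms by (simp add: Uq_eq_def falg_on_mult algebra_simps)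
qed

lemma Uq_eq_sum: "(\<And>i. i \<in> I \<Longrightarrow> Uq_eq n (f i) (g i)) \<Longrightarrow> Uq_eq n (sum f I) (sum g I)"
  by (induction I rule: infinite_finite_induct) (simp_all add: Uq_eq_refl falg_on_zero Uq_eq_add)

lemma Uq_eq_inverse:
  assumes "i \<in> II n"
  shows "Uq_eq n (ugen i i * ugen (- i) (- i)) 1"
proof -
  have "ugen i i \<in> falg_on n" "ugen (- i) (- i) \<in> falg_on n"
    using ugen_hom[of i n i] ugen_hom[of "- i" n "- i"] assms by (auto dest: falg_hom_on)
  then show ?thesis
    using Uq_ideal.inv[OF assms] by (simp add: Uq_eq_def falg_on_mult falg_on_one)
qed

text \<open>Back substitution; \<open>d i\<close> stands for an inverse of \<open>A i i\<close>.\<close>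

function tri_inv :: "(int \<Rightarrow> int \<Rightarrow> falg) \<Rightarrow> (int \<Rightarrow> falg) \<Rightarrow> int \<Rightarrow> int \<Rightarrow> falg" where
  "tri_inv A d i k = (if i = k then d i else if k < i then 0
     else - (d i * (\<Sum>j\<in>{i<..k} - {0}. A i j * tri_inv A d j k)))"
  by auto
termination by (relation "measure (\<lambda>(A, d, i, k). nat (k - i))") auto

declare tri_inv.simps [simp del]

lemma tri_inv_diag [simp]: "tri_inv A d i i = d i"
  and tri_inv_lower [simp]: "k < i \<Longrightarrow> tri_inv A d i k = 0"
  by (simp_all add: tri_inv.simps)

lemma II_between: "i \<in> II n \<Longrightarrow> k \<in> II n \<Longrightarrow> i \<le> j \<Longrightarrow> j \<le> k \<Longrightarrow> j \<noteq> 0 \<Longrightarrow> j \<in> II n"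
  by (auto simp: II_def)

definition tri_hom :: "nat \<Rightarrow> (int \<Rightarrow> int \<Rightarrow> falg) \<Rightarrow> bool" where
  "tri_hom n A \<longleftrightarrow> (\<forall>i\<in>II n. \<forall>j\<in>II n. A i j \<in> falg_hom n (pr i + pr j)) \<and> (\<forall>i j. j < i \<longrightarrow> A i j = 0)"

lemma tri_hom_on: "tri_hom n A \<Longrightarrow> i \<in> II n \<Longrightarrow> j \<in> II n \<Longrightarrow> A i j \<in> falg_on n"
  unfolding tri_hom_def using falg_hom_on by blast

lemma tri_hom_tri_inv:
  assumes A: "tri_hom n A" and d: "\<And>i. i \<in> II n \<Longrightarrow> d i \<in> falg_hom n 0"
  shows "tri_hom n (tri_inv A d)"
proof -
  have "i \<in> II n \<Longrightarrow> k \<in> II n \<Longrightarrow> tri_inv A d i k \<in> falg_hom n (pr i + pr k)" for i k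
    using A d
  proof (induction A d i k rule: tri_inv.induct)
    case (1 A d i k)
    have "A i j * tri_inv A d j k \<in> falg_hom n (pr i + pr k)" if "j \<in> {i<..k} - {0}" "i < k" for j
    proof -
      have j: "j \<in> II n" using II_between[OF 1(2,3), of j] that by auto
      have "tri_inv A d j k \<in> falg_hom n (pr j + pr k)"
        by (rule 1(1)) (use that j 1(3-5) in simp_all)
      moreover have "A i j \<in> falg_hom n (pr i + pr j)"
        using 1(2,4) j by (simp add: tri_hom_def)
      ultimately have "A i j * tri_inv A d j k \<in> falg_hom n ((pr i + pr j) + (pr j + pr k))"
        by (intro falg_hom_mult)
      then show ?thesis by (simp add: add.assoc)
    qed
    then have "i < k \<Longrightarrow> d i * (\<Sum>j\<in>{i<..k} - {0}. A i j * tri_inv A d j k) \<in> falg_hom n (0 + (pr i + pr k))"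
      by (intro falg_hom_mult[OF 1(5)[OF 1(2)]] falg_hom_sum) simp
    then show ?case
      using 1(2,5) by (subst tri_inv.simps) (auto simp: falg_hom_zero falg_hom_uminus)
  qed
  then show ?thesis by (simp add: tri_hom_def)
qed

lemma tri_inv_right:
  assumes A: "tri_hom n A" and d: "\<And>i. i \<in> II n \<Longrightarrow> d i \<in> falg_hom n 0"
    and inv: "\<And>i. i \<in> II n \<Longrightarrow> Uq_eq n (A i i * d i) 1"
    and i: "i \<in> II n" and k: "k \<in> II n"
  shows "Uq_eq n (\<Sum>j\<in>II n. A i j * tri_inv A d j k) (if i = k then 1 else 0)"
proof -
  have 0: "A i j * tri_inv A d j k = 0" if "j < i \<or> k < j" for j
    using that A by (auto simp: tri_hom_def)
  consider "k < i" | "i = k" | "i < k" by linarith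
  then show ?thesis
  proof cases
    case 1
    then have "(\<Sum>j\<in>II n. A i j * tri_inv A d j k) = 0"
      by (intro sum.neutral ballI 0) auto
    then show ?thesis using 1 by (simp add: Uq_eq_refl falg_on_zero)
  next
    case 2
    have "A i j * tri_inv A d j k = (if j = i then A i i * d i else 0)" for j
      using 0[of j] 2 by (cases j i rule: linorder_cases) auto
    then have "(\<Sum>j\<in>II n. A i j * tri_inv A d j k) = A i i * d i"
      using i by simp
    then show ?thesis using 2 inv[OF i] by simp
  next
    case 3
    let ?W = "\<Sum>j\<in>{i<..k} - {0}. A i j * tri_inv A d j k"
    have W: "?W \<in> falg_on n"
    proof (rule falg_on_sum)
      fix j assume "j \<in> {i<..k} - {0}"
      then have "j \<in> II n" using II_between[OF i k] by auto
      then show "A i j * tri_inv A d j k \<in> falg_on n"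
        using tri_hom_on[OF A] tri_hom_on[OF tri_hom_tri_inv[OF A d]] i k by (intro falg_on_mult) auto
    qed
    \<comment> \<open>\<open>?W\<close> is the part of the row strictly right of the diagonal. Back
      substitution puts -(d i) \<open>?W\<close> on the diagonal, and since
      \<open>A i i * d i\<close> is 1 up to \<open>Uq_eq\<close>, the two cancel.\<close>
    then have "Uq_eq n (- 1 * (A i i * d i) * ?W + ?W) (- 1 * 1 * ?W + ?W)"
      by (intro Uq_eq_add Uq_eq_mult Uq_eq_refl inv i falg_on_uminus falg_on_one)
    moreover have "(\<Sum>j\<in>II n. A i j * tri_inv A d j k) = (\<Sum>j\<in>insert i ({i<..k} - {0}). A i j * tri_inv A d j k)"
    proof (rule sum.mono_neutral_right)
      show "insert i ({i<..k} - {0}) \<subseteq> II n" using i by (auto intro: II_between[OF i k])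
      show "\<forall>j\<in>II n - insert i ({i<..k} - {0}). A i j * tri_inv A d j k = 0"
        using II_nonzero by (intro ballI 0) force
    qed simp
    moreover have "A i i * tri_inv A d i k = - 1 * (A i i * d i) * ?W"
      using 3 by (subst tri_inv.simps) (simp add: mult.assoc)
    ultimately show ?thesis using 3 by simp
  qed
qed

text \<open>Parity changes at most once along a chain, so one of the two factors of the exponent is
  0. Hence the signs in \<open>is_antipode\<close> are invisible for triangular matrices.\<close>

lemma psign_triangular:
  assumes "i \<le> j" "j \<le> k" shows "psign ((pr i + pr j) * (pr j + pr k)) = 1"
proof -
  have "pr j = pr i \<or> pr j = pr k" using assms by (auto simp: pr_def)
  then show ?thesis by auto
qed

lemma psign_tri_hom:
  assumes "tri_hom n A" "tri_hom n B"
  shows "psign ((pr i + pr j) * (pr j + pr k)) * (A i j * B j k) = A i j * B j k"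
  using assms by (cases "i \<le> j \<and> j \<le> k") (auto simp: psign_triangular tri_hom_def not_le)

text \<open>The right inverse \<open>s\<close> of \<open>L\<close> is again triangular, so it has a right inverse itself, which must be
  \<open>L\<close>; hence \<open>s\<close> is also a left inverse of \<open>L\<close>.\<close>

lemma ex_antipode: "is_antipode n (tri_inv Lcoef (\<lambda>i. ugen (- i) (- i)))"
proof -
  let ?s = "tri_inv Lcoef (\<lambda>i. ugen (- i) (- i))"
  let ?t = "tri_inv ?s (\<lambda>i. ugen i i)"
  have diag: "ugen i i \<in> falg_hom n 0" "ugen (- i) (- i) \<in> falg_hom n 0" if "i \<in> II n" for i
    using ugen_hom[of i n i] ugen_hom[of "- i" n "- i"] that by simp_all
  have L: "tri_hom n Lcoef" by (auto simp: tri_hom_def Lcoef_hom) (simp add: Lcoef_def)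
  have s: "tri_hom n ?s" and t: "tri_hom n ?t"
    by (intro tri_hom_tri_inv L diag; simp)+
  have Ls: "Uq_eq n (\<Sum>j\<in>II n. Lcoef i j * ?s j k) (if i = k then 1 else 0)" if "i \<in> II n" "k \<in> II n" for i k
    by (rule tri_inv_right[OF L diag(2) _ that]) (simp_all add: Lcoef_def Uq_eq_inverse)
  have st: "Uq_eq n (\<Sum>j\<in>II n. ?s i j * ?t j k) (if i = k then 1 else 0)" if "i \<in> II n" "k \<in> II n" for i k
    by (rule tri_inv_right[OF s diag(1) _ that]) (use Uq_eq_inverse[of "- _" n] in simp_all)
  note on = tri_hom_on[OF L] tri_hom_on[OF s] tri_hom_on[OF t]
  have tL: "Uq_eq n (?t i k) (Lcoef i k)" if i: "i \<in> II n" and k: "k \<in> II n" for i k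
  proof -
    have "Uq_eq n (\<Sum>j\<in>II n. Lcoef i j * (\<Sum>l\<in>II n. ?s j l * ?t l k)) (\<Sum>j\<in>II n. Lcoef i j * (if j = k then 1 else 0))"
      by (intro Uq_eq_sum Uq_eq_mult Uq_eq_refl st on i k)
    then have 1: "Uq_eq n (\<Sum>j\<in>II n. Lcoef i j * (\<Sum>l\<in>II n. ?s j l * ?t l k)) (Lcoef i k)"
      using k by (simp add: mult_delta_right)
    have "Uq_eq n (\<Sum>l\<in>II n. (\<Sum>j\<in>II n. Lcoef i j * ?s j l) * ?t l k) (\<Sum>l\<in>II n. (if i = l then 1 else 0) * ?t l k)"
      by (intro Uq_eq_sum Uq_eq_mult Uq_eq_refl Ls on i k)
    then have "Uq_eq n (\<Sum>l\<in>II n. (\<Sum>j\<in>II n. Lcoef i j * ?s j l) * ?t l k) (?t i k)"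
      using i by (simp add: mult_delta_left)
    also have "(\<Sum>l\<in>II n. (\<Sum>j\<in>II n. Lcoef i j * ?s j l) * ?t l k) =
       (\<Sum>j\<in>II n. Lcoef i j * (\<Sum>l\<in>II n. ?s j l * ?t l k))"
      by (simp add: sum_distrib_left sum_distrib_right mult.assoc, rule sum.swap)
    finally show ?thesis using 1 Uq_eq_sym Uq_eq_trans by blast
  qed
  have sL: "Uq_eq n (\<Sum>j\<in>II n. ?s i j * Lcoef j k) (if i = k then 1 else 0)" if "i \<in> II n" "k \<in> II n" for i k
    by (rule Uq_eq_trans[OF _ st[OF that]])
      (intro Uq_eq_sum Uq_eq_mult Uq_eq_refl Uq_eq_sym[OF tL] on that)
  show ?thesis
    unfolding is_antipode_def psign_tri_hom[OF L s] psign_tri_hom[OF s L]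
    using s Ls sL unfolding tri_hom_def by blast
qed

text \<open>This property is all that enters the computation of the action of the antipode on
  \<open>V\<close> in \<open>act_V_antipode\<close>.\<close>

lemma is_antipode_Uq_antipode: "is_antipode n (Uq_antipode n)"
  unfolding Uq_antipode_def by (rule someI[of "is_antipode n", OF ex_antipode])

section \<open>The braiding as a morphism of supermodules\<close>

text \<open>The two sign exponents differ by p(i) times the total parity of the four indices, which
  is 0 wherever Theta has a nonzero entry.\<close>

lemma Lt_V: "Lt n (Vmod n) = Tmap n"
proof (rule premor_eqI[OF premor_Lt[OF presmod_V] premor_T])
  fix x y assume "x \<in> bas (tgt (Lt n (Vmod n)))" "y \<in> bas (src (Lt n (Vmod n)))"
  then obtain i a b j where x: "x = i # [a]" and y: "y = [b] @ [j]" and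
    *: "i \<in> II n" "a \<in> II n" "b \<in> II n" "j \<in> II n"
    by (auto simp: bas_VV)
  have "psign (pr j * pr b + pr i + pr i * pr j) * Theta a b i j =
      psign (pr i * pr a + (pr i + pr j) * pr b) * Theta a b i j"
  proof (cases "Theta a b i j = 0")
    case False
    then have "pr a + pr b = pr i + pr j" using Theta_parity * II_nonzero by blast
    then show ?thesis by (cases "pr a"; cases "pr b"; cases "pr i"; cases "pr j"; simp)
  qed simp
  then show "mat (Lt n (Vmod n)) x y = mat (Tmap n) x y"
    unfolding x y using *
    by (subst mat_Lt) (auto simp: lam_def gact_V mat_Tmap_Theta)
qed simp_all

lemma lam_V: "i \<in> II n \<Longrightarrow> a \<in> II n \<Longrightarrow> b \<in> II n \<Longrightarrow> j \<in> II n \<Longrightarrow>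
    lam (Vmod n) i [a] [b] j = mat (Tmap n) [i, a] [b, j]"
  using mat_Lt[of i n j "[a]" "Vmod n" "[b]"] by (simp add: Lt_V)

lemma col_T:
  assumes "a \<in> II n" "b \<in> II n"
  shows "mat (smor_comp f (Tmap n)) u [a, b] = Tcol (\<lambda>x y. mat f u [x, y]) a b"
  using sum_Tmap[OF assms, of "\<lambda>x y. mat f u [x, y]"] by (simp add: smor_comp_sel(4) sum_bas_VV)

lemma mat_T_eq: "a \<in> II n \<Longrightarrow> b \<in> II n \<Longrightarrow>
    mat (Tmap n) u [a, b] = Tcol (\<lambda>x y. mat (smor_id (VV n)) u [x, y]) a b"
  using col_T[of a n b "smor_id (VV n)" u] smor_comp_id_left[OF premor_T] by simp

lemma Tcol_cong:
  assumes "\<And>x y. x \<in> {a, b, - a} \<Longrightarrow> y \<in> {a, b, - b} \<Longrightarrow> f x y = g x y"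
  shows "Tcol f a b = Tcol g a b"
  using assms by (simp add: Tcol_def)

lemma Tcol_linear: "Tcol (\<lambda>x y. f x y + r * g x y) a b = Tcol f a b + r * Tcol g a b"
  by (simp add: Tcol_def algebra_simps)

lemma col_T1:
  assumes "a \<in> II n" "b \<in> II n" "c \<in> II n"
  shows "mat (smor_comp f (smor_tensor n (Tmap n) (smor_id (Vmod n)))) u [a, b, c] =
    T1 (\<lambda>x y z. mat f u [x, y, z]) a b c"
proof -
  have "mat (smor_comp f (smor_tensor n (Tmap n) (smor_id (Vmod n)))) u ([a, b] @ [c]) =
    (\<Sum>x\<in>bas (tgt (Tmap n)). mat f u (x @ [c]) * mat (Tmap n) x [a, b])"
    by (rule comp_col_right[OF premor_T presmod_V]) (use assms in auto)
  then show ?thesis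
    using sum_Tmap[OF assms(1,2), of "\<lambda>x y. mat f u [x, y, c]"] by (simp add: sum_bas_VV T1_def)
qed

lemma col_T2:
  assumes "a \<in> II n" "b \<in> II n" "c \<in> II n"
  shows "mat (smor_comp f (smor_tensor n (smor_id (Vmod n)) (Tmap n))) u [a, b, c] =
    T2 (\<lambda>x y z. mat f u [x, y, z]) a b c"
proof -
  have "mat (smor_comp f (smor_tensor n (smor_id (Vmod n)) (Tmap n))) u ([a] @ [b, c]) =
    psign (mpar (Tmap n) * par (Vmod n) [a]) * (\<Sum>x\<in>bas (tgt (Tmap n)). mat f u ([a] @ x) * mat (Tmap n) x [b, c])"
    by (rule comp_col_left[OF presmod_V premor_T]) (use assms in auto)
  then show ?thesis
    using sum_Tmap[OF assms(2,3), of "\<lambda>x y. mat f u [a, x, y]"] by (simp add: sum_bas_VV T2_def)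
qed

lemma T1_cong:
  assumes "a \<in> II n" "b \<in> II n" "c \<in> II n"
    and "\<And>x y z. x \<in> II n \<Longrightarrow> y \<in> II n \<Longrightarrow> z \<in> II n \<Longrightarrow> F x y z = G x y z"
  shows "T1 F a b c = T1 G a b c" "T2 F a b c = T2 G a b c"
  unfolding T1_def T2_def by (rule Tcol_cong; use assms in force)+

text \<open>For a fixed row \<open>u\<close>, both composites arise from a row of the identity by
  successive precompositions. \<open>col_T1\<close> and \<open>col_T2\<close> turn these into
  \<open>T1\<close> and \<open>T2\<close>, so that \<open>T_braid\<close> applies.\<close>

lemma hexagon_V: "hexagon n (Vmod n)"
proof -
  let ?T1 = "smor_tensor n (Tmap n) (smor_id (Vmod n))"
  let ?T2 = "smor_tensor n (smor_id (Vmod n)) (Tmap n)"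
  let ?L = "smor_comp ?T1 (smor_comp ?T2 ?T1)" and ?R = "smor_comp ?T2 (smor_comp ?T1 ?T2)"
  note V = presmod_V[of n]
  note st = smod_tensor_assoc[OF V V V]
  have 1: "premor n ?T1" and 2: "premor n ?T2" by (intro premor_tensor_id premor_T V)+
  have id1: "smor_comp (smor_id (smod_tensor n (Vmod n) (VV n))) ?T1 = ?T1"
    and id2: "smor_comp (smor_id (smod_tensor n (Vmod n) (VV n))) ?T2 = ?T2"
    using smor_comp_id_left[OF 1] smor_comp_id_left[OF 2] by (simp_all add: st)
  have "?L = ?R"
  proof (rule premor_eqI[of n])
    show "premor n ?L" "premor n ?R" by (intro premor_comp 1 2; simp add: st)+
    fix u v assume "v \<in> bas (src ?L)"
    then obtain a b c where v: "v = [a, b, c]" and abc: "a \<in> II n" "b \<in> II n" "c \<in> II n"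
      by (auto simp: st bas_V_left bas_VV)
    let ?I = "\<lambda>x y z. mat (smor_id (smod_tensor n (Vmod n) (VV n))) u [x, y, z]"
    have "mat ?L u [a, b, c] = T1 (\<lambda>x y z. mat (smor_comp ?T1 ?T2) u [x, y, z]) a b c"
      by (simp add: col_T1 abc flip: smor_comp_assoc)
    also have "\<dots> = T1 (T2 (T1 ?I)) a b c"
    proof (rule T1_cong[OF abc])
      fix x y z assume xyz: "x \<in> II n" "y \<in> II n" "z \<in> II n"
      have "mat (smor_comp ?T1 ?T2) u [x, y, z] = T2 (\<lambda>x y z. mat ?T1 u [x, y, z]) x y z"
        by (rule col_T2[OF xyz])
      also have "\<dots> = T2 (T1 ?I) x y z"
        by (rule T1_cong[OF xyz]) (metis col_T1 id1)
      finally show "mat (smor_comp ?T1 ?T2) u [x, y, z] = T2 (T1 ?I) x y z" .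
    qed
    also have "\<dots> = T2 (T1 (T2 ?I)) a b c"
      by (rule T_braid) (use abc II_nonzero in auto)
    also have "\<dots> = T2 (\<lambda>x y z. mat (smor_comp ?T2 ?T1) u [x, y, z]) a b c"
    proof (rule T1_cong[OF abc, symmetric])
      fix x y z assume xyz: "x \<in> II n" "y \<in> II n" "z \<in> II n"
      have "mat (smor_comp ?T2 ?T1) u [x, y, z] = T1 (\<lambda>x y z. mat ?T2 u [x, y, z]) x y z"
        by (rule col_T1[OF xyz])
      also have "\<dots> = T1 (T2 ?I) x y z"
        by (rule T1_cong[OF xyz]) (metis col_T2 id2)
      finally show "mat (smor_comp ?T2 ?T1) u [x, y, z] = T1 (T2 ?I) x y z" .
    qed
    also have "\<dots> = mat ?R u [a, b, c]"
      by (simp add: col_T2 abc flip: smor_comp_assoc)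
    finally show "mat ?L u v = mat ?R u v" by (simp add: v)
  qed (simp_all add: st)
  then show ?thesis by (simp add: hexagon_def Lt_V)
qed

lemma gact_V_diagonal:
  "i \<in> II n \<Longrightarrow> a \<in> II n \<Longrightarrow> b \<in> II n \<Longrightarrow> gact (Vmod n) (i, i) [a] [b] = (if a = b then qvar powi phi a i else 0)"
  by (simp add: gact_V Theta_def)

lemma phi_uminus: "i \<noteq> 0 \<Longrightarrow> phi a (- i) = - phi a i"
  by (auto simp: phi_def)

lemma good_V: "good n (Vmod n)"
proof -
  have "(\<Sum>c\<in>bas (Vmod n). gact (Vmod n) (i, i) [a] c * gact (Vmod n) (- i, - i) c [b]) = (if a = b then 1 else 0)"
    if *: "i \<in> II n" "a \<in> II n" "b \<in> II n" for i a b
  proof -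
    have "(\<Sum>c\<in>bas (Vmod n). gact (Vmod n) (i, i) [a] c * gact (Vmod n) (- i, - i) c [b]) =
      (\<Sum>c\<in>II n. if c = a then if a = b then 1 else 0 else 0)"
      unfolding V_sel sum_singletons
      by (intro sum.cong HOL.refl)
        (use * II_nonzero[OF *(1)] in \<open>auto simp: gact_V_diagonal phi_uminus power_int_minus\<close>)
    then show ?thesis using * by simp
  qed
  then show ?thesis
    by (simp add: good_def presmod_V hexagon_V invertible_diagonal_def)
qed

text \<open>Since the braiding of \<open>V\<close> with itself is T, naturality of T unfolds by
  \<open>Lt_tensor\<close> to the braid relation itself.\<close>

lemma braid_natural_T: "braid_natural n (Tmap n)"
  using hexagon_V[of n] unfolding braid_natural_def hexagon_def
  by (simp add: Lt_tensor presmod_V Lt_V smor_comp_assoc)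


subsection \<open>The inverse braiding\<close>

definition Tinv :: "nat \<Rightarrow> smor" where
  "Tinv n = smor_plus (Tmap n) (smor_scale (- zvar) (smor_id (VV n)))"

lemma Tinv_sel [simp]: "src (Tinv n) = VV n" "tgt (Tinv n) = VV n" "mpar (Tinv n) = 0"
  by (simp_all add: Tinv_def)

lemma premor_Tinv: "premor n (Tinv n)"
  unfolding Tinv_def
  by (intro premor_plus premor_scale premor_id premor_T presmod_tensor presmod_V) simp_all

lemma braid_natural_Tinv: "braid_natural n (Tinv n)"
  unfolding Tinv_def
  by (intro braid_natural_plus braid_natural_scale braid_natural_id braid_natural_T
      premor_scale premor_id premor_T presmod_tensor presmod_V) simp_all

lemma mat_Tinv: "mat (Tinv n) u [a, b] = mat (Tmap n) u [a, b] + (- zvar) * mat (smor_id (VV n)) u [a, b]"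
  by (simp add: Tinv_def)

lemma T_Tinv: "smor_comp (Tmap n) (Tinv n) = smor_id (VV n)"
proof (rule premor_eqI[OF premor_comp[OF premor_T premor_Tinv] premor_id[OF presmod_tensor[OF presmod_V presmod_V]]])
  fix u v assume u: "v \<in> bas (src (smor_comp (Tmap n) (Tinv n)))" "u \<in> bas (tgt (smor_comp (Tmap n) (Tinv n)))"
  then obtain a b where v: "v = [a, b]" and ab: "a \<in> II n" "b \<in> II n" by (auto simp: bas_VV)
  let ?I = "\<lambda>x y. mat (smor_id (VV n)) u [x, y]"
  have id: "(\<Sum>c\<in>bas (VV n). mat (Tmap n) u c * mat (smor_id (VV n)) c [a, b]) = mat (Tmap n) u [a, b]"
    using smor_comp_id_right[OF premor_T, THEN arg_cong[where f = "\<lambda>f. mat f u [a, b]"]]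
    by (simp add: smor_comp_sel(4))
  have "mat (smor_comp (Tmap n) (Tinv n)) u v = mat (smor_comp (Tmap n) (Tmap n)) u v
      - zvar * (\<Sum>c\<in>bas (VV n). mat (Tmap n) u c * mat (smor_id (VV n)) c [a, b])"
    unfolding v smor_comp_sel(4) Tinv_sel Tmap_sel Tinv_def smor_plus_sel smor_scale_sel
    by (simp add: right_diff_distrib sum_subtractf sum_distrib_left ac_simps)
  also have "\<dots> = Tcol (\<lambda>x y. mat (Tmap n) u [x, y]) a b - zvar * mat (Tmap n) u [a, b]"
    by (simp only: v col_T[OF ab] id)
  also have "Tcol (\<lambda>x y. mat (Tmap n) u [x, y]) a b = Tcol (Tcol ?I) a b"
    by (rule Tcol_cong) (use ab in \<open>auto simp: mat_T_eq simp del: smor_id_sel(4)\<close>)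
  also have "\<dots> = zvar * Tcol ?I a b + ?I a b"
    by (rule Tcol_Hecke) (use ab II_nonzero in auto)
  finally show "mat (smor_comp (Tmap n) (Tinv n)) u v = mat (smor_id (VV n)) u v"
    by (simp add: v mat_T_eq ab del: smor_id_sel(4))
qed simp_all

lemma Tinv_T: "smor_comp (Tinv n) (Tmap n) = smor_id (VV n)"
proof (rule premor_eqI[OF premor_comp[OF premor_Tinv premor_T] premor_id[OF presmod_tensor[OF presmod_V presmod_V]]])
  fix u v assume u: "v \<in> bas (src (smor_comp (Tinv n) (Tmap n)))" "u \<in> bas (tgt (smor_comp (Tinv n) (Tmap n)))"
  then obtain a b where v: "v = [a, b]" and ab: "a \<in> II n" "b \<in> II n" by (auto simp: bas_VV)
  let ?I = "\<lambda>x y. mat (smor_id (VV n)) u [x, y]"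
  have "mat (smor_comp (Tinv n) (Tmap n)) u v = Tcol (\<lambda>x y. mat (Tinv n) u [x, y]) a b"
    by (simp only: v col_T[OF ab])
  also have "\<dots> = Tcol (\<lambda>x y. Tcol ?I x y + (- zvar) * ?I x y) a b"
    by (rule Tcol_cong) (use ab in \<open>auto simp: mat_Tinv mat_T_eq simp del: smor_id_sel(4)\<close>)
  also have "\<dots> = zvar * Tcol ?I a b + ?I a b + (- zvar) * Tcol ?I a b"
    unfolding Tcol_linear by (subst Tcol_Hecke) (use ab II_nonzero in auto)
  finally show "mat (smor_comp (Tinv n) (Tmap n)) u v = mat (smor_id (VV n)) u v"
    by (simp add: v del: smor_id_sel(4))
qed simp_all

text \<open>Subtracting z times the identity replaces z on \<open>a < b\<close> by -z on
  \<open>b <= a\<close>, which is what keeps the inverse triangular after transposition.\<close>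

lemma Tinv_entries:
  assumes "x \<in> II n" "y \<in> II n" "a \<in> II n" "b \<in> II n"
  shows "mat (Tinv n) [x, y] [a, b] =
    (if x = b \<and> y = a then psign (pr a * pr b) * qvar powi phi a b else 0)
    - (if x = a \<and> y = b \<and> b \<le> a then zvar else 0)
    + (if x = - a \<and> y = - b \<and> - a < b then zvar * psign (pr b) else 0)"
  using assms by (auto simp: mat_Tinv mat_Tmap)

section \<open>The dual supermodule\<close>

lemma Vdual_sel [simp]: "wlen (Vdual n) = 1" "bas (Vdual n) = (\<lambda>i. [i]) ` II n"
  "par (Vdual n) = par (Vmod n)"
  by (simp_all add: smod_dual_def)

lemma gact_V_eq_T:
  assumes "i \<in> II n" "a \<in> II n" "b \<in> II n" "j \<in> II n"
  shows "gact (Vmod n) (i, j) [a] [b] = psign (pr j * pr b + pr i + pr i * pr j) * mat (Tmap n) [i, a] [b, j]"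
  using lam_V[OF assms, symmetric] assms by (simp add: lam_def)

lemma T_triangular:
  assumes "i \<in> II n" "a \<in> II n" "b \<in> II n" "j \<in> II n" "mat (Tmap n) [i, a] [b, j] \<noteq> 0"
  shows "i \<le> j"
proof (rule ccontr)
  assume "\<not> i \<le> j"
  then have "\<not> (i = j \<and> a = b)" "\<not> (i = b \<and> a = j \<and> b < j)" "\<not> (i = - b \<and> a = - j \<and> - b < j)"
    by linarith+
  then show False using assms(5) by (simp only: mat_Tmap[OF assms(1-4)] if_False add_0_left HOL.simp_thms)
qed

lemma Tinv_triangular:
  assumes "i \<in> II n" "a \<in> II n" "b \<in> II n" "j \<in> II n" "mat (Tinv n) [b, i] [j, a] \<noteq> 0"
  shows "i \<le> j"
proof (rule ccontr)
  assume "\<not> i \<le> j"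
  then have "\<not> (b = a \<and> i = j)" "\<not> (b = j \<and> i = a \<and> a \<le> j)" "\<not> (b = - j \<and> i = - a \<and> - j < a)"
    by linarith+
  then show False
    using assms(5) by (simp only: Tinv_entries[OF assms(3,1,4,2)] if_False diff_0_right add_0_left HOL.simp_thms)
qed

text \<open>The left-inverse half of \<open>is_antipode\<close>, transported to \<open>V\<close>.
  This is legitimate because \<open>good_V\<close> already makes the action respect
  \<open>Uq_eq\<close>; the signs drop out by triangularity.\<close>

lemma act_V_antipode_Lcoef:
  assumes i: "i \<in> II n" and k: "k \<in> II n" and b: "b \<in> II n" and a: "a \<in> II n"
  shows "(\<Sum>j\<in>II n. \<Sum>c\<in>II n. act (Vmod n) (Uq_antipode n i j) [b] [c] * gact (Vmod n) (j, k) [c] [a])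
    = (if i = k \<and> b = a then 1 else 0)"
proof -
  note A = is_antipode_Uq_antipode[of n, unfolded is_antipode_def]
  note V = presmod_V[of n]
  have that_act: "act (Vmod n) x = act (Vmod n) y" if "Uq_eq n x y" for x y
    using good_is_smodule[OF good_V[of n]] that by (simp add: is_smodule_def)
  have "act (Vmod n) (\<Sum>j\<in>II n. psign ((pr i + pr j) * (pr j + pr k)) * (Uq_antipode n i j * Lcoef j k))
     = act (Vmod n) (if i = k then 1 else 0)"
    using A[THEN conjunct2, rule_format, OF i k, THEN conjunct2] by (rule that_act)
  then have "(\<Sum>j\<in>II n. psign ((pr i + pr j) * (pr j + pr k)) *
      (\<Sum>c\<in>II n. act (Vmod n) (Uq_antipode n i j) [b] [c] * gact (Vmod n) (j, k) [c] [a]))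
     = act (Vmod n) (if i = k then 1 else 0) [b] [a]"
    by (simp add: fun_eq_iff act_sum act_psign act_mult[OF V] act_Lcoef[OF V] sum_singletons)
  also have "\<dots> = (if i = k \<and> b = a then 1 else 0)"
    using b by (auto simp: act_one)
  also have "(\<Sum>j\<in>II n. psign ((pr i + pr j) * (pr j + pr k)) *
      (\<Sum>c\<in>II n. act (Vmod n) (Uq_antipode n i j) [b] [c] * gact (Vmod n) (j, k) [c] [a])) =
      (\<Sum>j\<in>II n. \<Sum>c\<in>II n. act (Vmod n) (Uq_antipode n i j) [b] [c] * gact (Vmod n) (j, k) [c] [a])"
  proof (rule sum.cong[OF HOL.refl])
    fix j assume j: "j \<in> II n"
    show "psign ((pr i + pr j) * (pr j + pr k)) *
      (\<Sum>c\<in>II n. act (Vmod n) (Uq_antipode n i j) [b] [c] * gact (Vmod n) (j, k) [c] [a]) =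
      (\<Sum>c\<in>II n. act (Vmod n) (Uq_antipode n i j) [b] [c] * gact (Vmod n) (j, k) [c] [a])"
    proof (cases "i \<le> j \<and> j \<le> k")
      case True
      then show ?thesis by (simp add: psign_triangular)
    next
      case False
      then have "Uq_antipode n i j = 0 \<or> (\<forall>c. gact (Vmod n) (j, k) [c] [a] = 0)"
        using A i j presmod_gact_0[OF V, of j k] by (auto simp: Uq_gens_def not_le)
      then show ?thesis by auto
    qed
  qed
  finally show ?thesis .
qed

lemma sum_swap4:
  "(\<Sum>k\<in>A. \<Sum>c\<in>B. \<Sum>m\<in>C. \<Sum>d\<in>D. F k c m d) = (\<Sum>m\<in>C. \<Sum>d\<in>D. \<Sum>k\<in>A. \<Sum>c\<in>B. F k c m d)"
proof -
  have "(\<Sum>k\<in>A. \<Sum>c\<in>B. \<Sum>m\<in>C. \<Sum>d\<in>D. F k c m d) = (\<Sum>k\<in>A. \<Sum>m\<in>C. \<Sum>d\<in>D. \<Sum>c\<in>B. F k c m d)"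
    by (subst sum.swap) (simp add: sum.swap[of _ D B])
  also have "\<dots> = (\<Sum>m\<in>C. \<Sum>d\<in>D. \<Sum>k\<in>A. \<Sum>c\<in>B. F k c m d)"
    by (subst sum.swap) (simp add: sum.swap[of _ D A])
  finally show ?thesis .
qed

text \<open>On pairs (generator index, basis index), \<open>?X\<close> is a left inverse of the
  matrix \<open>?G\<close> by the antipode axiom and \<open>?Y\<close> is a right inverse because T
  times its inverse is 1. Associativity of X G Y gives \<open>?X = ?Y\<close>.\<close>

lemma act_V_antipode:
  assumes i: "i \<in> II n" and j: "j \<in> II n" and b: "b \<in> II n" and a: "a \<in> II n"
  shows "act (Vmod n) (Uq_antipode n i j) [b] [a] =
    psign (pr i + pr i * pr j + pr i * pr b) * mat (Tinv n) [b, i] [j, a]"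
proof -
  let ?X = "\<lambda>i j b a. act (Vmod n) (Uq_antipode n i j) [b] [a]"
  let ?Y = "\<lambda>i j b a. psign (pr i + pr i * pr j + pr i * pr b) * mat (Tinv n) [b, i] [j, a]"
  let ?G = "\<lambda>i j b a. gact (Vmod n) (i, j) [b] [a]"
  have Y: "(\<Sum>m\<in>II n. \<Sum>d\<in>II n. ?G k m c d * ?Y m j d a) = (if k = j \<and> c = a then 1 else 0)"
    if *: "k \<in> II n" "c \<in> II n" for k c
  proof -
    have "?G k m c d * ?Y m j d a = psign (pr k * pr j + pr k) * (mat (Tmap n) [k, c] [d, m] * mat (Tinv n) [d, m] [j, a])"
      if m: "m \<in> II n" "d \<in> II n" for m d
    proof (cases "mat (Tmap n) [k, c] [d, m] = 0 \<or> mat (Tinv n) [d, m] [j, a] = 0")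
      case True
      then show ?thesis using * m by (auto simp: gact_V_eq_T)
    next
      case False
      then have "k \<le> m" "m \<le> j" using T_triangular Tinv_triangular * m j a by blast+
      \<comment> \<open>Only chains k <= m <= j survive, and on these the sign no longer depends on
        \<open>m\<close> and \<open>d\<close>.\<close>
      then have "pr m = pr k \<or> pr m = pr j" by (auto simp: pr_def)
      then have "psign (pr m * pr d + pr k + pr k * pr m) * psign (pr m + pr m * pr j + pr m * pr d)
         = (psign (pr k * pr j + pr k) :: Cq)"
        by (cases "pr d"; cases "pr k"; cases "pr j"; auto)
      then show ?thesis using * m by (simp add: gact_V_eq_T)
    qed
    then have "(\<Sum>m\<in>II n. \<Sum>d\<in>II n. ?G k m c d * ?Y m j d a) =
      (\<Sum>m\<in>II n. \<Sum>d\<in>II n. psign (pr k * pr j + pr k) * (mat (Tmap n) [k, c] [d, m] * mat (Tinv n) [d, m] [j, a]))"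
      by (intro sum.cong HOL.refl) blast
    also have "\<dots> = psign (pr k * pr j + pr k) * mat (smor_comp (Tmap n) (Tinv n)) [k, c] [j, a]"
      by (subst sum.swap) (simp add: smor_comp_sel(4) sum_bas_VV sum_distrib_left)
    also have "\<dots> = (if k = j \<and> c = a then 1 else 0)"
      using * by (simp add: T_Tinv)
    finally show ?thesis .
  qed
  have "?X i j b a = (\<Sum>k\<in>II n. if k = j then \<Sum>c\<in>II n. if c = a then ?X i j b a else 0 else 0)"
    using j a by simp
  also have "\<dots> = (\<Sum>k\<in>II n. \<Sum>c\<in>II n. ?X i k b c * (\<Sum>m\<in>II n. \<Sum>d\<in>II n. ?G k m c d * ?Y m j d a))"
    by (intro sum.cong HOL.refl) (auto simp: Y mult_delta_right j a)
  also have "\<dots> = (\<Sum>m\<in>II n. \<Sum>d\<in>II n. (\<Sum>k\<in>II n. \<Sum>c\<in>II n. ?X i k b c * ?G k m c d) * ?Y m j d a)"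
  proof -
    show ?thesis
      by (simp only: sum_distrib_left sum_distrib_right mult.assoc) (rule sum_swap4)
  qed
  also have "\<dots> = (\<Sum>m\<in>II n. if m = i then \<Sum>d\<in>II n. if d = b then ?Y i j b a else 0 else 0)"
    by (intro sum.cong HOL.refl)
       (use act_V_antipode_Lcoef[OF i _ b] b in \<open>auto simp: mult_delta_left\<close>)
  also have "\<dots> = ?Y i j b a"
    using i b by simp
  finally show ?thesis .
qed

lemma gact_dual:
  assumes "i \<in> II n" "j \<in> II n" "a \<in> II n" "b \<in> II n"
  shows "gact (Vdual n) (i, j) [a] [b] = psign (pr j * pr b + pr i + pr i * pr j) * mat (Tinv n) [b, i] [j, a]"
proof -
  have "psign ((pr i + pr j) * pr b) * psign (pr i + pr i * pr j + pr i * pr b)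
     = (psign (pr j * pr b + pr i + pr i * pr j) :: Cq)"
    by (cases "pr i"; cases "pr j"; cases "pr b"; simp)
  moreover have "mat (Tinv n) [b, i] [j, a] = 0" if "\<not> i \<le> j"
    using Tinv_triangular that assms by blast
  ultimately show ?thesis
    using assms by (auto simp: smod_dual_def Uq_gens_def act_V_antipode simp flip: mult.assoc)
qed

lemma presmod_Vdual: "presmod n (Vdual n)"
  unfolding presmod_def
proof (intro conjI allI impI ballI)
  fix i j a b assume n0: "gact (Vdual n) (i, j) a b \<noteq> 0"
  then show ij: "(i, j) \<in> Uq_gens n" and a: "a \<in> bas (Vdual n)" and b: "b \<in> bas (Vdual n)"
    using act_0_outside[OF presmod_V, of b n a "Uq_antipode n i j"]
    by (auto simp: smod_dual_def split: if_splits)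
  then obtain a' b' where ab: "a = [a']" "b = [b']" "a' \<in> II n" "b' \<in> II n" by auto
  then have *: "i \<in> II n" "j \<in> II n" using ij by (auto simp: Uq_gens_def)
  then have "mat (Tinv n) [b', i] [j, a'] \<noteq> 0" using n0 ab by (auto simp: gact_dual)
  from premor_parity[OF premor_Tinv this]
  show "par (Vdual n) a + par (Vdual n) b = pr i + pr j"
    using * ab by (cases "pr i"; cases "pr j"; cases "pr a'"; cases "pr b'"; simp)
qed (use presmod_par[OF presmod_V[of n]] in auto)

text \<open>The signs of the dual action, of the antipode and of \<open>lam\<close> cancel. The two
  indices of the dual appear transposed, which is how passing to the mate shows in
  coordinates.\<close>

lemma lam_dual: "i \<in> II n \<Longrightarrow> j \<in> II n \<Longrightarrow> a \<in> II n \<Longrightarrow> b \<in> II n \<Longrightarrow>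
    lam (Vdual n) i [a] [b] j = mat (Tinv n) [b, i] [j, a]"
  by (simp add: lam_def gact_dual)

text \<open>Writing S for the inverse of T, the relation T2 S1 S2 = S1 S2 T1 follows from the braid
  relation by inserting S1 S2 T2 T1 = 1 on the left.\<close>

lemma mixed_braid:
  "smor_comp (smor_tensor n (smor_id (Vmod n)) (Tmap n))
      (smor_comp (smor_tensor n (Tinv n) (smor_id (Vmod n))) (smor_tensor n (smor_id (Vmod n)) (Tinv n))) =
   smor_comp (smor_comp (smor_tensor n (Tinv n) (smor_id (Vmod n))) (smor_tensor n (smor_id (Vmod n)) (Tinv n)))
      (smor_tensor n (Tmap n) (smor_id (Vmod n)))"
proof -
  note V = presmod_V[of n]
  note st = smod_tensor_assoc[OF V V V]
  let ?c = smor_comp and ?V = "smor_id (Vmod n)" and ?I = "smor_id (smod_tensor n (Vmod n) (VV n))"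
  let ?T1 = "smor_tensor n (Tmap n) ?V" and ?T2 = "smor_tensor n ?V (Tmap n)"
  let ?S1 = "smor_tensor n (Tinv n) ?V" and ?S2 = "smor_tensor n ?V (Tinv n)"
  have P: "premor n ?T1" "premor n ?T2" "premor n ?S1" "premor n ?S2"
    by (intro premor_tensor_id premor_T premor_Tinv V)+
  have ST: "?c ?S1 ?T1 = ?I" "?c ?S2 ?T2 = ?I" "?c ?T1 ?S1 = ?I" "?c ?T2 ?S2 = ?I"
    using tensor_comp_id_right[OF premor_Tinv premor_T _ V] tensor_comp_id_left[OF premor_Tinv premor_T _ V]
      tensor_comp_id_right[OF premor_T premor_Tinv _ V] tensor_comp_id_left[OF premor_T premor_Tinv _ V]
    by (simp_all add: Tinv_T T_Tinv smor_tensor_id V presmod_tensor st)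
  have I: "?c ?I ?T1 = ?T1" "?c ?S2 ?I = ?S2" "?c ?I ?S2 = ?S2" "?c ?T2 ?I = ?T2"
    using P[THEN smor_comp_id_left] P[THEN smor_comp_id_right] by (simp_all add: st)
  have braid: "?c ?T1 (?c ?T2 ?T1) = ?c ?T2 (?c ?T1 ?T2)"
    using hexagon_V[of n] by (simp add: hexagon_def Lt_V)
  have cancel: "?c ?S1 (?c ?S2 (?c ?T2 (?c ?T1 X))) = X" if "?c ?I X = X" for X
  proof -
    have "?c ?S1 (?c ?S2 (?c ?T2 (?c ?T1 X))) = ?c ?S1 (?c (?c (?c ?S2 ?T2) ?T1) X)"
      by (simp only: smor_comp_assoc)
    also have "\<dots> = ?c ?S1 (?c ?T1 X)"
      by (simp only: ST I)
    also have "\<dots> = ?c (?c ?S1 ?T1) X"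
      by (simp only: smor_comp_assoc)
    finally show ?thesis by (simp only: ST that)
  qed
  have pre: "premor n (?c ?T2 (?c ?S1 ?S2))" by (intro premor_comp P) (simp_all add: st)
  have "?c ?T2 (?c ?S1 ?S2) = ?c ?S1 (?c ?S2 (?c ?T2 (?c ?T1 (?c ?T2 (?c ?S1 ?S2)))))"
    by (rule cancel[symmetric]) (use smor_comp_id_left[OF pre] in \<open>simp add: st\<close>)
  also have "\<dots> = ?c ?S1 (?c ?S2 (?c (?c ?T2 (?c ?T1 ?T2)) (?c ?S1 ?S2)))"
    by (simp only: smor_comp_assoc)
  also have "\<dots> = ?c ?S1 (?c ?S2 (?c ?T1 (?c ?T2 (?c (?c ?T1 ?S1) ?S2))))"
    by (simp only: braid[symmetric] smor_comp_assoc)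
  also have "\<dots> = ?c ?S1 (?c ?S2 (?c ?T1 ?I))"
    by (simp only: ST I)
  also have "?c ?T1 ?I = ?T1" using smor_comp_id_right[OF P(1)] by (simp add: st)
  finally show ?thesis by (simp only: smor_comp_assoc)
qed

text \<open>After transposing the indices of the dual, both sides become entries at row
  \<open>[b, i, k]\<close> and column \<open>[j, l, a]\<close> of composites on the third tensor
  power of \<open>V\<close>, and the identity is \<open>mixed_braid\<close>.\<close>

lemma hexagon_dual: "hexagon n (Vdual n)"
  unfolding hexagon_iff_entries[OF presmod_Vdual] hexagon_entries_def
proof (intro ballI)
  note V = presmod_V[of n]
  note st = smod_tensor_assoc[OF V V V]
  let ?V = "smor_id (Vmod n)"
  let ?S1 = "smor_tensor n (Tinv n) ?V" and ?S2 = "smor_tensor n ?V (Tinv n)"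
  let ?SS = "smor_comp ?S1 ?S2"
  fix i k j l a' b' assume *: "i \<in> II n" "k \<in> II n" "j \<in> II n" "l \<in> II n"
    and "a' \<in> bas (Vdual n)" "b' \<in> bas (Vdual n)"
  then obtain a b where ab: "a' = [a]" "b' = [b]" "a \<in> II n" "b \<in> II n" by auto
  have SS: "mat ?SS [b, x, y] [j, l, a] = (\<Sum>c\<in>II n. mat (Tinv n) [b, x] [j, c] * mat (Tinv n) [c, y] [l, a])"
    if h: "b \<in> II n" "x \<in> II n" "y \<in> II n" "j \<in> II n" "l \<in> II n" "a \<in> II n" for b x y j l a
  proof -
    have S2: "mat ?S2 [p, c, y] [j, l, a] = (if p = j then mat (Tinv n) [c, y] [l, a] else 0)"
      if "p \<in> II n" for p c
      using mat_tensor_append[of "[p]" "smor_id (Vmod n)" "[j]" n "Tinv n" "[c, y]" "[l, a]"] that h by simp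
    have "mat ?SS ([b, x] @ [y]) [j, l, a] = (\<Sum>w\<in>bas (src (Tinv n)). mat (Tinv n) [b, x] w * mat ?S2 (w @ [y]) [j, l, a])"
      by (rule comp_row_right[OF premor_Tinv V]) (use h in \<open>auto simp: st\<close>)
    also have "\<dots> = (\<Sum>p\<in>II n. \<Sum>c\<in>II n. mat (Tinv n) [b, x] [p, c] * mat ?S2 [p, c, y] [j, l, a])"
      by (simp add: sum_bas_VV)
    also have "\<dots> = (\<Sum>p\<in>II n. if p = j then (\<Sum>c\<in>II n. mat (Tinv n) [b, x] [j, c] * mat (Tinv n) [c, y] [l, a]) else 0)"
      by (intro sum.cong HOL.refl) (simp add: S2)
    finally show ?thesis using h by simp
  qed
  have "(\<Sum>x\<in>II n. \<Sum>y\<in>II n. mat (Tmap n) [i, k] [x, y] *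
        (\<Sum>c\<in>bas (Vdual n). lam (Vdual n) x c b' j * lam (Vdual n) y a' c l)) =
     (\<Sum>x\<in>II n. \<Sum>y\<in>II n. mat (Tmap n) [i, k] [x, y] * mat ?SS [b, x, y] [j, l, a])"
    using * ab by (simp add: sum_singletons lam_dual SS)
  also have "\<dots> = mat (smor_comp (smor_tensor n ?V (Tmap n)) ?SS) ([b] @ [i, k]) [j, l, a]"
    by (subst comp_row_left[OF V premor_T]) (use * ab in \<open>auto simp: st sum_bas_VV\<close>)
  also have "\<dots> = mat (smor_comp ?SS (smor_tensor n (Tmap n) ?V)) [b, i, k] ([j, l] @ [a])"
    by (simp only: mixed_braid) simp
  also have "\<dots> = (\<Sum>x\<in>II n. \<Sum>y\<in>II n. mat ?SS [b, i, k] [x, y, a] * mat (Tmap n) [x, y] [j, l])"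
    by (subst comp_col_right[OF premor_T V]) (use * ab in \<open>auto simp: sum_bas_VV\<close>)
  also have "\<dots> = (\<Sum>x\<in>II n. \<Sum>y\<in>II n. (\<Sum>c\<in>bas (Vdual n). lam (Vdual n) i c b' x * lam (Vdual n) k a' c y) *
        mat (Tmap n) [x, y] [j, l])"
    using * ab by (simp add: sum_singletons lam_dual SS)
  finally show "(\<Sum>x\<in>II n. \<Sum>y\<in>II n. mat (Tmap n) [i, k] [x, y] *
        (\<Sum>c\<in>bas (Vdual n). lam (Vdual n) x c b' j * lam (Vdual n) y a' c l)) =
     (\<Sum>x\<in>II n. \<Sum>y\<in>II n. (\<Sum>c\<in>bas (Vdual n). lam (Vdual n) i c b' x * lam (Vdual n) k a' c y) *
        mat (Tmap n) [x, y] [j, l])" .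
qed

lemma gact_dual_diagonal:
  assumes "i \<in> II n" "a \<in> II n" "b \<in> II n"
  shows "gact (Vdual n) (i, i) [a] [b] = (if a = b then qvar powi (- phi a i) else 0)"
proof -
  have n0: "i \<noteq> 0" "a \<noteq> 0" using assms II_nonzero by auto
  \<comment> \<open>At \<open>a = i\<close> the correction by z exchanges q and its inverse: q - z =
    1/q for positive i, and -(-1/q - z) = q for negative i. At \<open>a = - i\<close> the exponents
    agree without correction.\<close>
  have 1: "psign (pr i * pr a) * (psign (pr i * pr a) * qvar powi phi i a - (if a = i then zvar else 0)) =
     qvar powi (- phi a i)"
  proof (cases "\<bar>a\<bar> = \<bar>i\<bar>")
    case True
    then consider "a = i" "0 < i" | "a = i" "i < 0" | "a = - i" using n0 by linarith
    then show ?thesis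
      by cases (use n0 in \<open>auto simp: phi_def pr_def zvar_def power_int_minus right_diff_distrib simp flip: mult.assoc\<close>)
  qed (auto simp: phi_def)
  have "(b = i \<and> i = a \<and> a \<le> i) = (a = b \<and> a = i)" "\<not> (b = - i \<and> i = - a \<and> - i < a)"
    by linarith+
  moreover have "(b = a \<and> i = i) = (a = b)" by blast
  ultimately have "mat (Tinv n) [b, i] [i, a] =
      (if a = b then psign (pr i * pr a) * qvar powi phi i a - (if a = i then zvar else 0) else 0)"
    by (simp only: Tinv_entries[OF assms(3,1,1,2)]) simp
  then show ?thesis
    using 1 by (cases "a = b") (use assms in \<open>simp_all add: gact_dual\<close>)
qed

lemma good_Vdual: "good n (Vdual n)"
proof -
  have "(\<Sum>c\<in>bas (Vdual n). gact (Vdual n) (i, i) [a] c * gact (Vdual n) (- i, - i) c [b]) = (if a = b then 1 else 0)"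
    if *: "i \<in> II n" "a \<in> II n" "b \<in> II n" for i a b
  proof -
    have "(\<Sum>c\<in>bas (Vdual n). gact (Vdual n) (i, i) [a] c * gact (Vdual n) (- i, - i) c [b]) =
      (\<Sum>c\<in>II n. if c = a then if a = b then 1 else 0 else 0)"
      unfolding Vdual_sel sum_singletons
      by (intro sum.cong HOL.refl)
        (use * II_nonzero[OF *(1)] in \<open>auto simp: gact_dual_diagonal phi_uminus power_int_minus\<close>)
    then show ?thesis using * by simp
  qed
  then show ?thesis
    by (simp add: good_def presmod_Vdual hexagon_dual invertible_diagonal_def)
qed


section \<open>Evaluation, coevaluation and the odd endomorphism\<close>

lemma ev_sel [simp]: "src (ev n) = smod_tensor n (Vdual n) (Vmod n)" "tgt (ev n) = smod_unit n"
  "mpar (ev n) = 0" "mat (ev n) [] [a, b] = (if a = b \<and> a \<in> II n then 1 else 0)"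
  by (auto simp: ev_def)

lemma coev_sel [simp]: "src (coev n) = smod_unit n" "tgt (coev n) = smod_tensor n (Vmod n) (Vdual n)"
  "mpar (coev n) = 0" "mat (coev n) [a, b] [] = (if a = b \<and> a \<in> II n then 1 else 0)"
  by (auto simp: coev_def)

lemma bas_letters:
  assumes "bas M = (\<lambda>i. [i]) ` II n" "bas N = (\<lambda>i. [i]) ` II n"
  shows "bas (smod_tensor n M N) = (\<Union>i\<in>II n. (\<lambda>j. [i, j]) ` II n)"
    "[i, j] \<in> bas (smod_tensor n M N) \<longleftrightarrow> i \<in> II n \<and> j \<in> II n"
  by (auto simp: bas_tensor_UN assms)

lemma sum_bas_letters:
  assumes "presmod n M" "bas M = (\<lambda>i. [i]) ` II n" "bas N = (\<lambda>i. [i]) ` II n"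
  shows "(\<Sum>x\<in>bas (smod_tensor n M N). F x) = (\<Sum>i\<in>II n. \<Sum>j\<in>II n. F [i, j])"
  by (simp add: sum_bas_tensor assms sum_singletons)

lemma premor_ev: "premor n (ev n)"
  unfolding premor_def
proof (intro conjI allI impI)
  fix a b assume "mat (ev n) a b \<noteq> 0"
  then obtain i where *: "a = []" "b = [i, i]" "i \<in> II n" by (auto simp: ev_def split: if_splits)
  then show "a \<in> bas (tgt (ev n))" "b \<in> bas (src (ev n))" by (auto simp: bas_letters)
  show "par (tgt (ev n)) a + par (src (ev n)) b = mpar (ev n)"
    using par_tensor_append[OF presmod_Vdual, of "[i]" n "[i]" "Vmod n"] * by simp
qed (simp_all add: presmod_tensor presmod_V presmod_Vdual presmod_unit)

lemma premor_coev: "premor n (coev n)"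
  unfolding premor_def
proof (intro conjI allI impI)
  fix a b assume "mat (coev n) a b \<noteq> 0"
  then obtain i where *: "b = []" "a = [i, i]" "i \<in> II n" by (auto simp: coev_def split: if_splits)
  then show "a \<in> bas (tgt (coev n))" "b \<in> bas (src (coev n))" by (auto simp: bas_letters)
  show "par (tgt (coev n)) a + par (src (coev n)) b = mpar (coev n)"
    using par_tensor_append[OF presmod_V, of "[i]" n "[i]" "Vdual n"] * by simp
qed (simp_all add: presmod_tensor presmod_V presmod_Vdual presmod_unit)

lemma lam_unit: "i \<in> II n \<Longrightarrow> j \<in> II n \<Longrightarrow> lam (smod_unit n) i [] [] j = (if i = j then 1 else 0)"
  by (auto simp: lam_def smod_unit_def Uq_gens_def)

text \<open>Composing the braidings of \<open>Vdual\<close> and \<open>V\<close> and contracting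
  with ev gives the entries of T^-1 T, which is the identity.\<close>

lemma braid_natural_ev: "braid_natural n (ev n)"
  unfolding braid_natural_iff_entries[OF premor_ev]
proof (intro ballI)
  fix i j a b assume ij: "i \<in> II n" "j \<in> II n" and "a \<in> bas (tgt (ev n))" "b \<in> bas (src (ev n))"
  then obtain p r where a: "a = []" and b: "b = [p, r]" and pr: "p \<in> II n" "r \<in> II n"
    by (auto simp: bas_letters)
  have "(\<Sum>c\<in>bas (src (ev n)). mat (ev n) a c * lam (src (ev n)) i c b j) =
    (\<Sum>c\<in>II n. \<Sum>d\<in>II n. if d = c then lam (smod_tensor n (Vdual n) (Vmod n)) i ([c] @ [c]) ([p] @ [r]) j else 0)"
    by (simp add: sum_bas_letters presmod_Vdual a b mult_delta_left sum.delta')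
  also have "\<dots> = (\<Sum>c\<in>II n. lam (smod_tensor n (Vdual n) (Vmod n)) i ([c] @ [c]) ([p] @ [r]) j)"
    by simp
  also have "\<dots> = (\<Sum>c\<in>II n. \<Sum>k\<in>II n. mat (Tinv n) [p, i] [k, c] * mat (Tmap n) [k, c] [r, j])"
    using ij pr by (intro sum.cong HOL.refl, subst lam_tensor[OF presmod_Vdual presmod_V])
      (auto simp: lam_dual lam_V)
  also have "\<dots> = mat (smor_comp (Tinv n) (Tmap n)) [p, i] [r, j]"
    by (subst sum.swap) (simp add: smor_comp_sel(4) sum_bas_VV)
  also have "\<dots> = (if p = r \<and> i = j then 1 else 0)"
    using ij pr by (simp add: Tinv_T)
  finally show "(\<Sum>c\<in>bas (tgt (ev n)). lam (tgt (ev n)) i a c j * mat (ev n) c b) =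
       psign (mpar (ev n) * pr i) * (\<Sum>c\<in>bas (src (ev n)). mat (ev n) a c * lam (src (ev n)) i c b j)"
    using ij pr by (simp add: a b lam_unit)
qed

text \<open>As for \<open>ev\<close>, with the factors in the other order: contracting with coev
  gives the entries of T T^-1.\<close>

lemma braid_natural_coev: "braid_natural n (coev n)"
  unfolding braid_natural_iff_entries[OF premor_coev]
proof (intro ballI)
  fix i j a b assume ij: "i \<in> II n" "j \<in> II n" and "a \<in> bas (tgt (coev n))" "b \<in> bas (src (coev n))"
  then obtain p r where b: "b = []" and a: "a = [p, r]" and pr: "p \<in> II n" "r \<in> II n"
    by (auto simp: bas_letters)
  have "(\<Sum>c\<in>bas (tgt (coev n)). lam (tgt (coev n)) i a c j * mat (coev n) c b) =
    (\<Sum>c\<in>II n. \<Sum>d\<in>II n. if d = c then lam (smod_tensor n (Vmod n) (Vdual n)) i ([p] @ [r]) ([c] @ [c]) j else 0)"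
    by (simp add: sum_bas_letters presmod_V a b mult_delta_right sum.delta')
  also have "\<dots> = (\<Sum>c\<in>II n. lam (smod_tensor n (Vmod n) (Vdual n)) i ([p] @ [r]) ([c] @ [c]) j)"
    by simp
  also have "\<dots> = (\<Sum>c\<in>II n. \<Sum>k\<in>II n. mat (Tmap n) [i, p] [c, k] * mat (Tinv n) [c, k] [j, r])"
    using ij pr by (intro sum.cong HOL.refl, subst lam_tensor[OF presmod_V presmod_Vdual])
      (auto simp: lam_dual lam_V)
  also have "\<dots> = mat (smor_comp (Tmap n) (Tinv n)) [i, p] [j, r]"
    by (simp add: smor_comp_sel(4) sum_bas_VV)
  also have "\<dots> = (if p = r \<and> i = j then 1 else 0)"
    using ij pr by (auto simp: T_Tinv)
  finally show "(\<Sum>c\<in>bas (tgt (coev n)). lam (tgt (coev n)) i a c j * mat (coev n) c b) =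
       psign (mpar (coev n) * pr i) * (\<Sum>c\<in>bas (src (coev n)). mat (coev n) a c * lam (src (coev n)) i c b j)"
    using ij pr by (simp add: a b lam_unit)
qed

lemma J_sel [simp]: "src (Jmap n) = Vmod n" "tgt (Jmap n) = Vmod n" "mpar (Jmap n) = 1"
  "mat (Jmap n) [x] [a] = (if x = - a \<and> a \<in> II n then psign (pr a) else 0)"
  by (auto simp: Jmap_def)

lemma premor_J: "premor n (Jmap n)"
  unfolding premor_def
proof (intro conjI allI impI)
  fix a b assume "mat (Jmap n) a b \<noteq> 0"
  then obtain i where *: "a = [- i]" "b = [i]" "i \<in> II n" by (auto simp: Jmap_def split: if_splits)
  then show "a \<in> bas (tgt (Jmap n))" "b \<in> bas (src (Jmap n))" by auto
  show "par (tgt (Jmap n)) a + par (src (Jmap n)) b = mpar (Jmap n)"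
    using * II_nonzero by (simp add: pr_uminus ac_simps)
qed (simp_all add: presmod_V)

lemma col_J1:
  assumes "a \<in> II n" "N = Vmod n \<or> N = Vdual n" "b \<in> II n"
  shows "mat (smor_comp f (smor_tensor n (Jmap n) (smor_id N))) u [a, b] = psign (pr a) * mat f u [- a, b]"
proof -
  have "mat (smor_comp f (smor_tensor n (Jmap n) (smor_id N))) u ([a] @ [b]) =
    (\<Sum>x\<in>bas (tgt (Jmap n)). mat f u (x @ [b]) * mat (Jmap n) x [a])"
    by (rule comp_col_right[OF premor_J]) (use assms presmod_V presmod_Vdual in auto)
  also have "\<dots> = (\<Sum>x\<in>II n. if x = - a then psign (pr a) * mat f u [- a, b] else 0)"
    using assms by (simp add: sum_singletons mult_delta_right)
  finally show ?thesis using assms by simp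
qed

lemma col_J2:
  assumes "a \<in> II n" "b \<in> II n"
  shows "mat (smor_comp f (smor_tensor n (smor_id (Vmod n)) (Jmap n))) u [a, b] = psign (pr a) * psign (pr b) * mat f u [a, - b]"
proof -
  have "mat (smor_comp f (smor_tensor n (smor_id (Vmod n)) (Jmap n))) u ([a] @ [b]) =
    psign (mpar (Jmap n) * par (Vmod n) [a]) * (\<Sum>x\<in>bas (tgt (Jmap n)). mat f u ([a] @ x) * mat (Jmap n) x [b])"
    by (rule comp_col_left[OF presmod_V premor_J]) (use assms in auto)
  also have "(\<Sum>x\<in>bas (tgt (Jmap n)). mat f u ([a] @ x) * mat (Jmap n) x [b]) =
     (\<Sum>x\<in>II n. if x = - b then psign (pr b) * mat f u [a, - b] else 0)"
    using assms by (simp add: sum_singletons mult_delta_right)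
  finally show ?thesis using assms by simp
qed

lemma T_J:
  "smor_comp (Tmap n) (smor_tensor n (Jmap n) (smor_id (Vmod n))) =
   smor_comp (smor_tensor n (smor_id (Vmod n)) (Jmap n)) (Tmap n)" (is "?L = ?R")
proof (rule premor_eqI[of n])
  note V = presmod_V[of n]
  show "premor n ?L" "premor n ?R"
    by (intro premor_comp premor_tensor_id premor_T premor_J V; simp)+
  fix u v assume "v \<in> bas (src ?L)"
  then obtain a b where v: "v = [a, b]" and ab: "a \<in> II n" "b \<in> II n" by (auto simp: bas_VV)
  let ?I = "\<lambda>x y. mat (smor_id (VV n)) u [x, y]"
  have "mat ?L u v = psign (pr a) * Tcol ?I (- a) b"
    by (simp add: v col_J1 mat_T_eq ab del: smor_id_sel(4))
  also have "\<dots> = Tcol (\<lambda>x y. psign (pr x) * psign (pr y) * ?I x (- y)) a b"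
    by (rule Tcol_odd) (use ab II_nonzero in auto)
  also have "\<dots> = Tcol (\<lambda>x y. mat (smor_tensor n (smor_id (Vmod n)) (Jmap n)) u [x, y]) a b"
  proof (rule Tcol_cong)
    fix x y assume "x \<in> {a, b, - a}" "y \<in> {a, b, - b}"
    then have "x \<in> II n" "y \<in> II n" using ab by auto
    then have "mat (smor_comp (smor_id (VV n)) (smor_tensor n (smor_id (Vmod n)) (Jmap n))) u [x, y]
      = psign (pr x) * psign (pr y) * ?I x (- y)" by (rule col_J2)
    then show "psign (pr x) * psign (pr y) * ?I x (- y) = mat (smor_tensor n (smor_id (Vmod n)) (Jmap n)) u [x, y]"
      using smor_comp_id_left[OF premor_tensor_id(2)[OF premor_J V]] by simp
  qed
  also have "\<dots> = mat ?R u v" by (simp only: v col_T[OF ab])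
  finally show "mat ?L u v = mat ?R u v" .
qed simp_all

text \<open>The braiding of \<open>V\<close> with itself is T, so this is the relation between T and
  J.\<close>

lemma braid_natural_J: "braid_natural n (Jmap n)"
  using T_J by (simp add: braid_natural_def Lt_V)

lemma J_J: "smor_comp (Jmap n) (Jmap n) = smor_scale (- 1) (smor_id (Vmod n))"
proof (rule premor_eqI[of n])
  show "premor n (smor_comp (Jmap n) (Jmap n))" "premor n (smor_scale (- 1) (smor_id (Vmod n)))"
    by (intro premor_comp premor_scale premor_id premor_J presmod_V; simp)+
  fix u v assume "v \<in> bas (src (smor_comp (Jmap n) (Jmap n)))" "u \<in> bas (tgt (smor_comp (Jmap n) (Jmap n)))"
  then obtain a b where v: "v = [a]" "a \<in> II n" and u: "u = [b]" "b \<in> II n" by auto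
  have "(\<Sum>x\<in>II n. mat (Jmap n) [b] [x] * mat (Jmap n) [x] [a]) =
    (\<Sum>x\<in>II n. if x = - a then if b = a then - 1 else 0 else 0)"
    by (intro sum.cong HOL.refl) (use v u II_nonzero[OF v(2)] in \<open>auto simp: pr_uminus psign_add\<close>)
  then show "mat (smor_comp (Jmap n) (Jmap n)) u v = mat (smor_scale (- 1) (smor_id (Vmod n))) u v"
    using u v by (auto simp: smor_comp_sel(4) sum_singletons)
qed simp_all

section \<open>The inverse of the mate of the braiding\<close>

lemma zvar_nonzero: "zvar \<noteq> 0"
proof
  assume "zvar = 0"
  then have "qvar * qvar = 1" by (simp add: qvar_square)
  then show False by (simp add: qvar_def One_fract_def eq_fract one_pCons)
qed

text \<open>\<open>tele u m\<close> is constant across the missing index \<open>0\<close>, which lets the sum telescope over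
  an interval of integers.\<close>

definition tele :: "Cq \<Rightarrow> int \<Rightarrow> Cq" where
  "tele u m = (if m > 0 then u powi (1 - 2 * m) else u powi (2 * m - 1))"

lemma tele_nonzero_arg: "m \<noteq> 0 \<Longrightarrow> tele u m = u powi (sgn m - 2 * \<bar>m\<bar>)"
  by (auto simp: tele_def sgn_if abs_if)

text \<open>The powers of u grow towards the origin and fall beyond it, and the sign of the parity
  makes both halves telescope in the same direction.\<close>

lemma tele_step:
  assumes "u \<noteq> 0" "m \<noteq> 0"
  shows "(u - inverse u) * psign (pr m) * u powi (- 2 * \<bar>m\<bar>) = tele u m - tele u (m + 1)"
proof (cases "m > 0")
  case True
  have "u * u powi (- 2 * m) = u powi (1 - 2 * m)" "inverse u * u powi (- 2 * m) = u powi (1 - 2 * (m + 1))"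
    using assms(1) power_int_add[of u 1 "- 2 * m"] power_int_add[of u "-1" "- 2 * m"]
    by (simp_all add: power_int_minus algebra_simps)
  then show ?thesis using True by (simp add: tele_def pr_pos left_diff_distrib)
next
  case False
  then have m: "m < 0" using assms by simp
  have "u * u powi (2 * m) = u powi (2 * (m + 1) - 1)" "inverse u * u powi (2 * m) = u powi (2 * m - 1)"
    using assms(1) power_int_add[of u 1 "2 * m"] power_int_add[of u "-1" "2 * m"]
    by (simp_all add: power_int_minus algebra_simps)
  then show ?thesis using m by (simp add: tele_def pr_neg left_diff_distrib)
qed

lemma telescope:
  assumes u: "u \<noteq> 0" and "i < m" and i: "i \<noteq> 0"
  shows "(\<Sum>k\<in>{i<..<m} - {0}. (u - inverse u) * psign (pr k) * u powi (- 2 * \<bar>k\<bar>)) =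
    u powi (- sgn i - 2 * \<bar>i\<bar>) - tele u m"
  using assms(2)
proof (induction m rule: int_gr_induct)
  case base
  \<comment> \<open>The lower end is the value of \<open>tele\<close> at i + 1. For i = -1 this is
    the skipped index 0, where the second branch of \<open>tele\<close> gives u^-1.\<close>
  have "u powi (- sgn i - 2 * \<bar>i\<bar>) = tele u (i + 1)"
    using i by (auto simp: tele_def sgn_if abs_if)
  moreover have "{i<..<i + 1} = {}" by auto
  ultimately show ?case by simp
next
  case (step m)
  show ?case
  proof (cases "m = 0")
    case True
    then have "{i<..<m + 1} - {0} = {i<..<m} - {0}" "tele u (m + 1) = tele u m"
      by (auto simp: tele_def)
    then show ?thesis using step by simp
  next
    case False
    then have "{i<..<m + 1} - {0} = insert m ({i<..<m} - {0})" using step by auto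
    then show ?thesis using step tele_step[OF u False] by simp
  qed
qed

abbreviation (input) "qpos k \<equiv> qvar powi (2 * \<bar>k\<bar>)"
abbreviation (input) "qneg k \<equiv> qvar powi (- 2 * \<bar>k\<bar>)"
abbreviation (input) "qdiff i k \<equiv> qvar powi (2 * \<bar>i\<bar> - 2 * \<bar>k\<bar>)"

lemma telescope_q:
  assumes "i < m" "i \<noteq> 0"
  shows "(\<Sum>k\<in>{i<..<m} - {0}. zvar * (psign (pr k) * qneg k)) =
    qvar powi (- sgn i - 2 * \<bar>i\<bar>) - tele qvar m"
  using telescope[OF qvar_nonzero assms] by (simp add: zvar_def mult.assoc)

text \<open>This is \<open>telescope\<close> at u = 1/q, where u - 1/u = -z reverses the
  sign.\<close>

lemma telescope_inverse_q:
  assumes "i < m" "i \<noteq> 0"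
  shows "(\<Sum>k\<in>{i<..<m} - {0}. zvar * (psign (pr k) * qpos k)) =
    tele (inverse qvar) m - qvar powi (sgn i + 2 * \<bar>i\<bar>)"
proof -
  have e: "inverse qvar powi k = qvar powi (- k)" for k
    by (simp add: power_int_minus power_int_inverse)
  have z: "inverse qvar - inverse (inverse qvar) = - zvar" by (simp add: zvar_def)
  show ?thesis
    using telescope[of "inverse qvar", OF _ assms, unfolded z e]
    by (simp add: sum_negf mult.assoc add.commute[of "sgn i"] minus_equation_iff[of "sum _ _"])
qed

lemma tele_inverse_q: "m \<noteq> 0 \<Longrightarrow> tele (inverse qvar) m = qvar powi (2 * \<bar>m\<bar> - sgn m)"
  by (simp add: tele_nonzero_arg power_int_inverse flip: power_int_minus)

text \<open>The rows that occur below consist of an end term at \<open>y\<close> and terms with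
  \<open>p < y\<close>, so a sum over all larger indices becomes an end term plus an interval sum
  that can telescope.\<close>

lemma sum_above:
  assumes "i \<in> II n" "y \<in> II n"
  shows "(\<Sum>p\<in>{p \<in> II n. i < p}. (if p = y then A p else 0) + (if p < y then B p else 0)) =
    (if i < y then A y + (\<Sum>p\<in>{i<..<y} - {0}. B p) else (0::Cq))"
proof -
  have "(\<Sum>p\<in>{p \<in> II n. i < p}. if p < y then B p else 0) = (\<Sum>p\<in>{p \<in> {p \<in> II n. i < p}. p < y}. B p)"
    by (rule sum.inter_filter[symmetric]) simp
  also have "{p \<in> {p \<in> II n. i < p}. p < y} = {i<..<y} - {0}"
    using assms by (auto simp: II_def)
  finally have B: "(\<Sum>p\<in>{p \<in> II n. i < p}. if p < y then B p else 0) = (\<Sum>p\<in>{i<..<y} - {0}. B p)" .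
  have "{i<..<y} - {0} = {}" if "\<not> i < y" using that by auto
  then show ?thesis using assms by (auto simp: sum.distrib B)
qed


subsection \<open>The mate of the braiding\<close>

text \<open>The morphism l^+ with T, ev and coev inserted for its generators.\<close>

definition Tmate :: "nat \<Rightarrow> smor" where
  "Tmate n = smor_comp (smor_tensor n (ev n) (smor_tensor n (smor_id (Vmod n)) (smor_id (Vdual n))))
     (smor_comp (smor_tensor n (smor_id (Vdual n)) (smor_tensor n (Tmap n) (smor_id (Vdual n))))
       (smor_tensor n (smor_id (Vdual n)) (smor_tensor n (smor_id (Vmod n)) (coev n))))"

lemma Tmate_props:
  "premor n (Tmate n)" "src (Tmate n) = smod_tensor n (Vdual n) (Vmod n)"
  "tgt (Tmate n) = smod_tensor n (Vmod n) (Vdual n)" "mpar (Tmate n) = 0" "braid_natural n (Tmate n)"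
proof -
  note P = presmod_V[of n] presmod_Vdual[of n] presmod_unit[of n] presmod_tensor premor_T premor_ev premor_coev
    premor_id premor_tensor
  note S = smod_tensor_assoc[OF _ _ _, of n] smod_tensor_unit_left smod_tensor_unit_right
  show "premor n (Tmate n)" unfolding Tmate_def
    by (intro premor_comp P) (simp_all add: P S)
  show "braid_natural n (Tmate n)" unfolding Tmate_def
    by (intro premor_comp braid_natural_comp braid_natural_tensor braid_natural_T braid_natural_ev
        braid_natural_coev braid_natural_id P)
       (simp_all add: P S)
qed (simp_all add: Tmate_def smod_tensor_unit_left smod_tensor_unit_right presmod_V presmod_Vdual presmod_tensor)

text \<open>Bending strands only moves indices: the input index of the dual becomes an output of T,
  and its output index an input of T. No sign arises, since T, ev and coev are even.\<close>

lemma mat_Tmate: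
  assumes "x \<in> II n" "y \<in> II n" "a \<in> II n" "b \<in> II n"
  shows "mat (Tmate n) [x, y] [a, b] = mat (Tmap n) [a, x] [b, y]"
proof -
  let ?D = "smor_id (Vdual n)" and ?V = "smor_id (Vmod n)" and ?t = "smor_tensor n"
  let ?E = "?t (ev n) (?t ?V ?D)" and ?M = "?t ?D (?t (Tmap n) ?D)"
  let ?DV = "smor_id (smod_tensor n (Vdual n) (Vmod n))"
  note V = presmod_V[of n] and D = presmod_Vdual[of n]
  have DV: "presmod n (smod_tensor n (Vdual n) (Vmod n))" by (intro presmod_tensor V D)
  have C: "?t ?D (?t ?V (coev n)) = ?t ?DV (coev n)"
    by (simp add: smor_tensor_assoc premor_id V D premor_coev flip: smor_tensor_id)
  have E: "mat ?E [x, y] [a', b', c', d'] = (if b' = a' \<and> c' = x \<and> d' = y \<and> a' \<in> II n then 1 else 0)"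
    if "c' \<in> II n" "d' \<in> II n" for a' b' c' d'
    using mat_tensor_append[of "[]" "ev n" "[a', b']" n "?t ?V ?D" "[x, y]" "[c', d']"] assms that
    by (auto simp: smor_tensor_id V D bas_letters)
  have M: "mat (smor_comp ?E ?M) [x, y] [a, b, k, k] = (if k = y then mat (Tmap n) [a, x] [b, y] else 0)"
    if k: "k \<in> II n" for k
  proof -
    have TD: "mat (?t (Tmap n) ?D) ([p, r] @ [s]) ([b, k] @ [k]) = (if s = k then mat (Tmap n) [p, r] [b, k] else 0)"
      if "s \<in> II n" for p r s
      by (subst mat_tensor_append) (use that in auto)
    have "mat (smor_comp ?E ?M) [x, y] ([a] @ [b, k, k]) = psign (mpar (?t (Tmap n) ?D) * par (Vdual n) [a]) *
      (\<Sum>w\<in>bas (tgt (?t (Tmap n) ?D)). mat ?E [x, y] ([a] @ w) * mat (?t (Tmap n) ?D) w [b, k, k])"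
      by (rule comp_col_left[OF D premor_tensor_id(1)[OF premor_T D]])
        (use assms k in \<open>auto simp: bas_tensor_UN[of n "VV n"] bas_VV\<close>)
    also have "\<dots> = (\<Sum>p\<in>II n. \<Sum>r\<in>II n. \<Sum>s\<in>II n. mat ?E [x, y] [a, p, r, s] *
        mat (?t (Tmap n) ?D) ([p, r] @ [s]) ([b, k] @ [k]))"
      by (simp add: sum_bas_tensor[OF presmod_tensor[OF V V]] sum_bas_VV sum_singletons)
    also have "\<dots> = (\<Sum>p\<in>II n. \<Sum>r\<in>II n. \<Sum>s\<in>II n. if s = k then if r = x then if p = a then
        if k = y then mat (Tmap n) [a, x] [b, y] else 0 else 0 else 0 else 0)"
      by (intro sum.cong HOL.refl, unfold TD) (use assms k in \<open>auto simp: E\<close>)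
    also have "\<dots> = (if k = y then mat (Tmap n) [a, x] [b, y] else 0)"
      using assms k by simp
    finally show ?thesis by simp
  qed
  \<comment> \<open>The source of \<open>coev n\<close> has the empty word as its only basis vector,
    hence the split \<open>[a, b] @ []\<close>.\<close>
  have "mat (Tmate n) [x, y] [a, b] = mat (smor_comp (smor_comp ?E ?M) (?t ?DV (coev n))) [x, y] ([a, b] @ [])"
    by (simp add: Tmate_def C smor_comp_assoc)
  also have "\<dots> = psign (mpar (coev n) * par (smod_tensor n (Vdual n) (Vmod n)) [a, b]) *
      (\<Sum>w\<in>bas (tgt (coev n)). mat (smor_comp ?E ?M) [x, y] ([a, b] @ w) * mat (coev n) w [])"
    by (rule comp_col_left[OF DV premor_coev]) (use assms in \<open>auto simp: bas_letters\<close>)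
  also have "\<dots> = (\<Sum>k\<in>II n. mat (smor_comp ?E ?M) [x, y] [a, b, k, k])"
    by (simp add: sum_bas_letters V mult_delta_right)
  also have "\<dots> = mat (Tmap n) [a, x] [b, y]"
    using assms by (simp add: M)
  finally show ?thesis .
qed


subsection \<open>The explicit inverse\<close>

text \<open>Written in the shape of the formula to be proved, so that \<open>image_Rmap\<close> is
  immediate.\<close>

definition Rmap :: "nat \<Rightarrow> smor" where
  "Rmap n = \<lparr> src = smod_tensor n (Vmod n) (Vdual n), tgt = smod_tensor n (Vdual n) (Vmod n), mpar = 0,
     mat = (\<lambda>x y. if \<exists>i\<in>II n. \<exists>j\<in>II n. y = [i, j] then
        psign (pr (y ! 0) * pr (y ! 1)) * qvar powi (- phi (y ! 0) (y ! 1)) * bvec [y ! 1, y ! 0] x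
      - zvar * (if y ! 0 = y ! 1 then 1 else 0) *
          (\<Sum>k\<in>{k \<in> II n. k > y ! 0}.
             psign (pr (y ! 0) + pr k) * qvar powi (2 * \<bar>y ! 0\<bar> - 2 * \<bar>k\<bar>) * bvec [k, k] x)
      - zvar * (if y ! 0 = - (y ! 1) then 1 else 0) *
          (\<Sum>k\<in>{k \<in> II n. k > y ! 1}.
             psign (pr k) * qvar powi (2 * \<bar>y ! 0\<bar> - 2 * \<bar>k\<bar>) * bvec [k, - k] x)
       else 0) \<rparr>"

lemma Rmap_sel [simp]: "src (Rmap n) = smod_tensor n (Vmod n) (Vdual n)"
  "tgt (Rmap n) = smod_tensor n (Vdual n) (Vmod n)" "mpar (Rmap n) = 0"
  by (simp_all add: Rmap_def)

lemma image_Rmap: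
  assumes "i \<in> II n" "j \<in> II n"
  shows "image_of (Rmap n) [i, j] = (\<lambda>x.
        psign (pr i * pr j) * qvar powi (- phi i j) * bvec [j, i] x
      - zvar * (if i = j then 1 else 0) *
          (\<Sum>k\<in>{k \<in> II n. k > i}.
             psign (pr i + pr k) * qvar powi (2 * \<bar>i\<bar> - 2 * \<bar>k\<bar>) * bvec [k, k] x)
      - zvar * (if i = - j then 1 else 0) *
          (\<Sum>k\<in>{k \<in> II n. k > j}.
             psign (pr k) * qvar powi (2 * \<bar>i\<bar> - 2 * \<bar>k\<bar>) * bvec [k, - k] x))"
  using assms by (simp add: image_of_def Rmap_def)

lemma mat_Rmap:
  assumes "p \<in> II n" "r \<in> II n" "i \<in> II n" "j \<in> II n"
  shows "mat (Rmap n) [p, r] [i, j] =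
    (if p = j \<and> r = i then psign (pr i * pr j) * qvar powi (- phi i j) else 0)
    - (if i = j \<and> p = r \<and> i < p then zvar * (psign (pr i + pr p) * qdiff i p) else 0)
    - (if i = - j \<and> r = - p \<and> j < p then zvar * (psign (pr p) * qdiff i p) else 0)"
proof -
  have 1: "(\<Sum>k\<in>{k \<in> II n. k > i}. c k * bvec [k, k] [p, r]) = (if p = r \<and> i < p then c p else (0::Cq))" for c
  proof -
    have "(\<Sum>k\<in>{k \<in> II n. k > i}. c k * bvec [k, k] [p, r]) =
      (\<Sum>k\<in>{k \<in> II n. k > i}. if k = p then if p = r then c p else 0 else 0)"
      by (intro sum.cong HOL.refl) (auto simp: bvec_def)
    then show ?thesis using assms by auto
  qed
  have 2: "(\<Sum>k\<in>{k \<in> II n. k > j}. c k * bvec [k, - k] [p, r]) = (if r = - p \<and> j < p then c p else (0::Cq))" for c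
  proof -
    have "(\<Sum>k\<in>{k \<in> II n. k > j}. c k * bvec [k, - k] [p, r]) =
      (\<Sum>k\<in>{k \<in> II n. k > j}. if k = p then if r = - p then c p else 0 else 0)"
      by (intro sum.cong HOL.refl) (auto simp: bvec_def)
    then show ?thesis using assms by auto
  qed
  have 3: "zvar * (if P then 1 else 0) * (if Q then c else 0) = (if P \<and> Q then zvar * c else 0)" for P Q c
    by simp
  have 4: "c * bvec [j, i] [p, r] = (if p = j \<and> r = i then c else 0)" for c
    by (simp add: bvec_def)
  have "mat (Rmap n) [p, r] [i, j] = image_of (Rmap n) [i, j] [p, r]" by (simp add: image_of_def)
  then show ?thesis
    unfolding image_Rmap[OF assms(3,4)] 1 2 3 4 .
qed

lemma premor_Rmap: "premor n (Rmap n)"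
  unfolding premor_def
proof (intro conjI allI impI)
  fix x y assume n0: "mat (Rmap n) x y \<noteq> 0"
  then obtain i j where y: "y = [i, j]" and ij: "i \<in> II n" "j \<in> II n"
    by (auto simp: Rmap_def split: if_splits)
  have "\<exists>p\<in>II n. \<exists>r\<in>II n. x = [p, r]"
  proof (rule ccontr)
    assume "\<not> ?thesis"
    then have "bvec [p, r] x = 0" if "p \<in> II n" "r \<in> II n" for p r
      using that by (auto simp: bvec_def)
    then have "image_of (Rmap n) [i, j] x = 0"
      unfolding image_Rmap[OF ij] using ij by simp
    then show False using n0 by (simp add: y image_of_def)
  qed
  then obtain p r where x: "x = [p, r]" and pr: "p \<in> II n" "r \<in> II n" by blast
  show "x \<in> bas (tgt (Rmap n))" "y \<in> bas (src (Rmap n))"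
    using x y ij pr by (auto simp: bas_letters)
  have "pr p + pr r = pr i + pr j"
  proof (rule ccontr)
    assume ne: "pr p + pr r \<noteq> pr i + pr j"
    have "\<not> (p = j \<and> r = i)" using ne by (auto simp: add.commute)
    moreover have "\<not> (i = j \<and> p = r \<and> i < p)" using ne by auto
    moreover have "\<not> (i = - j \<and> r = - p \<and> j < p)"
    proof
      assume "i = - j \<and> r = - p \<and> j < p"
      then have "pr i = pr j + 1" "pr r = pr p + 1" using pr_uminus II_nonzero ij pr by auto
      then show False using ne by (simp add: add.left_commute)
    qed
    ultimately have "mat (Rmap n) [p, r] [i, j] = 0"
      by (simp only: mat_Rmap[OF pr ij] if_False diff_0_right)
    then show False using n0 x y by simp
  qed
  then show "par (tgt (Rmap n)) x + par (src (Rmap n)) y = mpar (Rmap n)"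
    using par_tensor_append[OF presmod_Vdual, of "[p]" n "[r]" "Vmod n"]
      par_tensor_append[OF presmod_V, of "[i]" n "[j]" "Vdual n"] x y ij pr by simp
qed (simp_all add: presmod_tensor presmod_V presmod_Vdual)

lemma phi_diag: "i \<noteq> 0 \<Longrightarrow> phi i i = sgn i" "i \<noteq> 0 \<Longrightarrow> phi (- i) i = sgn i"
  by (auto simp: phi_def)

text \<open>Separates the outer index from the summation index, so that its power leaves the
  telescoping sum.\<close>

lemma q_power_split: "qdiff i p = qpos i * qneg p"
  using power_int_add[of qvar "2 * \<bar>i\<bar>" "- 2 * \<bar>p\<bar>"] by simp

lemma psign_powi_cancel:
  "psign e * qvar powi k * (psign e * qvar powi (- k)) = 1"
  "psign e * qvar powi (- k) * (psign e * qvar powi k) = 1"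
  by (cases e; simp add: power_int_minus)+

lemma telescope_left:
  assumes "i \<in> II n" "y \<in> II n" "i < y"
  shows "qpos i * (qneg y * qvar powi sgn y +
     (\<Sum>p\<in>{i<..<y} - {0}. zvar * (psign (pr p) * qneg p))) = qvar powi (- sgn i)"
proof -
  have n0: "i \<noteq> 0" "y \<noteq> 0" using assms II_nonzero by auto
  \<comment> \<open>The end term at \<open>y\<close> is exactly the amount that the telescoped sum
    over i < p < y subtracts.\<close>
  have "qneg y * qvar powi sgn y = tele qvar y"
    using n0 power_int_add[of qvar "- 2 * \<bar>y\<bar>" "sgn y"] by (simp add: tele_nonzero_arg)
  then have "qneg y * qvar powi sgn y +
     (\<Sum>p\<in>{i<..<y} - {0}. zvar * (psign (pr p) * qneg p)) = qvar powi (- sgn i - 2 * \<bar>i\<bar>)"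
    using telescope_q[OF assms(3) n0(1)] by simp
  then show ?thesis
    using power_int_add[of qvar "2 * \<bar>i\<bar>" "- sgn i - 2 * \<bar>i\<bar>"] by simp
qed

lemma telescope_left':
  assumes "i \<in> II n" "y \<in> II n" "i < y"
  shows "psign e * qpos i * (qneg y * qvar powi sgn y) +
     (\<Sum>p\<in>{i<..<y} - {0}. psign e * qpos i * (zvar * (psign (pr p) * qneg p))) =
     psign e * qvar powi (- sgn i)"
proof -
  have "c * A + (\<Sum>p\<in>S. c * B p) = c * (A + (\<Sum>p\<in>S. B p))" for c A :: Cq and B and S :: "int set"
    by (simp add: sum_distrib_left distrib_left)
  then show ?thesis by (simp only: mult.assoc[of "psign e" _ "_ + _"] telescope_left[OF assms])
qed

text \<open>The first summand cancels the lower end of the sum telescoped at 1/q;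
  \<open>qneg p\<close> removes the large power from the upper end.\<close>

lemma telescope_right:
  assumes "a \<in> II n" "p \<in> II n" "a < p"
  shows "qvar powi sgn a * qpos a * qneg p +
    qneg p * (\<Sum>y\<in>{a<..<p} - {0}. zvar * (psign (pr y) * qpos y)) = qvar powi (- sgn p)"
proof -
  have n0: "a \<noteq> 0" "p \<noteq> 0" using assms II_nonzero by auto
  have "qvar powi sgn a * qpos a = qvar powi (sgn a + 2 * \<bar>a\<bar>)"
    by (simp add: power_int_add)
  then have "qvar powi sgn a * qpos a * qneg p +
    qneg p * (\<Sum>y\<in>{a<..<p} - {0}. zvar * (psign (pr y) * qpos y))
    = qneg p * qvar powi (2 * \<bar>p\<bar> - sgn p)"
    unfolding telescope_inverse_q[OF assms(3) n0(1)] tele_inverse_q[OF n0(2)] by (simp add: algebra_simps)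
  then show ?thesis
    using power_int_add[of qvar "- 2 * \<bar>p\<bar>" "2 * \<bar>p\<bar> - sgn p"] by simp
qed

lemma Rmap_column:
  assumes "i \<in> II n" "j \<in> II n"
  shows "(\<Sum>p\<in>II n. \<Sum>r\<in>II n. g p r * mat (Rmap n) [p, r] [i, j]) =
    g j i * (psign (pr i * pr j) * qvar powi (- phi i j))
    - (if i = j then zvar * (\<Sum>p\<in>{p \<in> II n. i < p}. g p p * (psign (pr i + pr p) * qdiff i p)) else 0)
    - (if i = - j then zvar * (\<Sum>p\<in>{p \<in> II n. j < p}. g p (- p) * (psign (pr p) * qdiff i p)) else 0)"
proof -
  let ?A = "psign (pr i * pr j) * qvar powi (- phi i j)"
  let ?B = "\<lambda>p. psign (pr i + pr p) * qdiff i p"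
  let ?C = "\<lambda>p. psign (pr p) * qdiff i p"
  have "(\<Sum>p\<in>II n. \<Sum>r\<in>II n. g p r * mat (Rmap n) [p, r] [i, j]) =
    (\<Sum>p\<in>II n. \<Sum>r\<in>II n. (if r = i then if p = j then g j i * ?A else 0 else 0)
       - (if r = p then if i = j \<and> i < p then zvar * (g p p * ?B p) else 0 else 0)
       - (if r = - p then if i = - j \<and> j < p then zvar * (g p (- p) * ?C p) else 0 else 0))"
    by (intro sum.cong HOL.refl) (auto simp: mat_Rmap assms algebra_simps)
  also have "\<dots> = g j i * ?A - (\<Sum>p\<in>II n. if i = j \<and> i < p then zvar * (g p p * ?B p) else 0)
     - (\<Sum>p\<in>II n. if i = - j \<and> j < p then zvar * (g p (- p) * ?C p) else 0)"
    using assms by (simp add: sum_subtractf)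
  finally show ?thesis
    using II_nonzero[OF assms(1)] by (auto simp: sum.inter_filter sum_distrib_left mult_delta_right cong: if_cong)
qed

text \<open>In column (i, j) the leading term of r^- yields the identity and two error terms
  proportional to z (\<open>S3\<close>). The telescoped sums \<open>S1\<close>, for i = j, and
  \<open>S2\<close>, for i = -j, are exactly these errors.\<close>

lemma Tmate_Rmap: "smor_comp (Tmate n) (Rmap n) = smor_id (smod_tensor n (Vmod n) (Vdual n))"
proof (rule premor_eqI[of n])
  show "premor n (smor_comp (Tmate n) (Rmap n))" "premor n (smor_id (smod_tensor n (Vmod n) (Vdual n)))"
    by (intro premor_comp premor_id Tmate_props premor_Rmap presmod_tensor presmod_V presmod_Vdual; simp add: Tmate_props)+
  fix u v assume "u \<in> bas (tgt (smor_comp (Tmate n) (Rmap n)))" "v \<in> bas (src (smor_comp (Tmate n) (Rmap n)))"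
  then obtain x y i j where u: "u = [x, y]" and v: "v = [i, j]" and
    *: "x \<in> II n" "y \<in> II n" "i \<in> II n" "j \<in> II n"
    by (auto simp: bas_letters Tmate_props)
  have n0: "i \<noteq> 0" "j \<noteq> 0" "x \<noteq> 0" "y \<noteq> 0" using * II_nonzero by auto
  let ?A = "psign (pr i * pr j) * qvar powi (- phi i j)"
  have "mat (smor_comp (Tmate n) (Rmap n)) u v =
    (\<Sum>p\<in>II n. \<Sum>r\<in>II n. mat (Tmap n) [p, x] [r, y] * mat (Rmap n) [p, r] [i, j])"
    by (simp add: u v smor_comp_sel(4) sum_bas_letters presmod_Vdual mat_Tmate *)
  also have "\<dots> = (if x = i \<and> y = j then 1 else 0)"
  proof -
    \<comment> \<open>Only p = y, from the leading term of T, and p < y, from its z term,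
      contribute. All dependence on \<open>p\<close> is isolated so that the sum telescopes.\<close>
    have diag: "mat (Tmap n) [p, x] [p, y] * (psign (pr i + pr p) * qdiff i p)
      = (if p = y then if x = y then psign (pr i) * qpos i * (qneg y * qvar powi sgn y) else 0 else 0)
        + (if p < y then if x = y then psign (pr i) * qpos i * (zvar * (psign (pr p) * qneg p)) else 0 else 0)"
      if "p \<in> II n" for p
      using that * II_nonzero[OF that]
      by (auto simp: mat_Tmap phi_diag psign_add q_power_split)
    have anti: "mat (Tmap n) [p, x] [- p, y] * (psign (pr p) * qdiff j p)
      = (if p = y then if x = - y then psign (pr y) * qpos j * (qneg y * qvar powi sgn y) else 0 else 0)
        + (if p < y then if x = - y then psign (pr y) * qpos j * (zvar * (psign (pr p) * qneg p)) else 0 else 0)"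
      if "p \<in> II n" for p
      using that * II_nonzero[OF that]
      by (auto simp: mat_Tmap phi_diag pr_uminus distrib_right q_power_split)
    have S1: "(\<Sum>p\<in>{p \<in> II n. i < p}. mat (Tmap n) [p, x] [p, y] * (psign (pr i + pr p) * qdiff i p))
      = (if i < y \<and> x = y then psign (pr i) * qvar powi (- sgn i) else 0)"
    proof -
      have "(\<Sum>p\<in>{p \<in> II n. i < p}. mat (Tmap n) [p, x] [p, y] * (psign (pr i + pr p) * qdiff i p))
        = (if i < y then (if x = y then psign (pr i) * qpos i * (qneg y * qvar powi sgn y) else 0)
          + (\<Sum>p\<in>{i<..<y} - {0}. if x = y then psign (pr i) * qpos i * (zvar * (psign (pr p) * qneg p)) else 0) else 0)"
        by (subst sum_above[OF *(3,2), symmetric], rule sum.cong[OF HOL.refl], rule diag) simp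
      then show ?thesis
        using telescope_left'[OF *(3,2)] by simp
    qed
    have S2: "(\<Sum>p\<in>{p \<in> II n. j < p}. mat (Tmap n) [p, x] [- p, y] * (psign (pr p) * qdiff j p))
      = (if j < y \<and> x = - y then psign (pr y) * qvar powi (- sgn j) else 0)"
    proof -
      have "(\<Sum>p\<in>{p \<in> II n. j < p}. mat (Tmap n) [p, x] [- p, y] * (psign (pr p) * qdiff j p))
        = (if j < y then (if x = - y then psign (pr y) * qpos j * (qneg y * qvar powi sgn y) else 0)
          + (\<Sum>p\<in>{j<..<y} - {0}. if x = - y then psign (pr y) * qpos j * (zvar * (psign (pr p) * qneg p)) else 0) else 0)"
        by (subst sum_above[OF *(4,2), symmetric], rule sum.cong[OF HOL.refl], rule anti) simp
      then show ?thesis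
        using telescope_left'[OF *(4,2)] by simp
    qed
    have S3: "mat (Tmap n) [j, x] [i, y] * ?A = (if x = i \<and> y = j then 1 else 0)
       + (if i = j \<and> x = y \<and> i < y then zvar * (psign (pr i) * qvar powi (- sgn i)) else 0)
       + (if i = - j \<and> x = - y \<and> j < y then zvar * (psign (pr y) * qvar powi (- sgn j)) else 0)"
    proof -
      have "(if j = y \<and> x = i then psign (pr i * pr y) * qvar powi phi i y else 0) * ?A = (if x = i \<and> y = j then 1 else 0)"
        by (auto simp: psign_powi_cancel)
      moreover have "(if j = i \<and> x = y \<and> i < y then zvar else 0) * ?A =
          (if i = j \<and> x = y \<and> i < y then zvar * (psign (pr i) * qvar powi (- sgn i)) else 0)"
        using n0 by (cases "i = j") (auto simp: phi_diag)
      moreover have "(if j = - i \<and> x = - y \<and> - i < y then zvar * psign (pr y) else 0) * ?A =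
          (if i = - j \<and> x = - y \<and> j < y then zvar * (psign (pr y) * qvar powi (- sgn j)) else 0)"
        using n0 by (cases "i = - j") (auto simp: pr_uminus phi_diag distrib_right)
      ultimately show ?thesis
        by (simp only: mat_Tmap[OF *(4,1,3,2)] distrib_right)
    qed
    have "(if i = j then zvar * (\<Sum>p\<in>{p \<in> II n. i < p}. mat (Tmap n) [p, x] [p, y] *
          (psign (pr i + pr p) * qdiff i p)) else 0) =
        (if i = j \<and> x = y \<and> i < y then zvar * (psign (pr i) * qvar powi (- sgn i)) else 0)"
      unfolding S1 by simp
    moreover have "(if i = - j then zvar * (\<Sum>p\<in>{p \<in> II n. j < p}. mat (Tmap n) [p, x] [- p, y] *
          (psign (pr p) * qdiff i p)) else 0) =
        (if i = - j \<and> x = - y \<and> j < y then zvar * (psign (pr y) * qvar powi (- sgn j)) else 0)"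
    proof (cases "i = - j")
      case True
      \<comment> \<open>\<open>S2\<close> is written with |j|, the form in which the sum over p > j
        telescopes; r^- has |i|, which is the same here.\<close>
      then have "\<bar>i\<bar> = \<bar>j\<bar>" by simp
      then show ?thesis unfolding \<open>\<bar>i\<bar> = \<bar>j\<bar>\<close> S2 by simp
    qed simp
    moreover have "X + B + C - B - C = X" for X B C :: Cq by simp
    ultimately show ?thesis
      unfolding Rmap_column[OF *(3,4)] S3 by (simp only:)
  qed
  finally show "mat (smor_comp (Tmate n) (Rmap n)) u v = mat (smor_id (smod_tensor n (Vmod n) (Vdual n))) u v"
    using * by (simp add: u v bas_letters(2))
qed (simp_all add: Tmate_props)

lemma Tmate_column:
  assumes "a \<in> II n" "b \<in> II n"
  shows "(\<Sum>x\<in>II n. \<Sum>y\<in>II n. g x y * mat (Tmap n) [a, x] [b, y]) =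
    g b a * (psign (pr a * pr b) * qvar powi phi b a)
    + (if a = b then zvar * (\<Sum>y\<in>{y \<in> II n. a < y}. g y y) else 0)
    + (if a = - b then zvar * (\<Sum>y\<in>{y \<in> II n. a < y}. psign (pr y) * g (- y) y) else 0)"
proof -
  have ab: "a = - b \<longleftrightarrow> b = - a" by auto
  have "g x y * mat (Tmap n) [a, x] [b, y] =
       (if y = a then if x = b then g b a * (psign (pr a * pr b) * qvar powi phi b a) else 0 else 0)
       + (if x = y then if a = b \<and> a < y then zvar * g y y else 0 else 0)
       + (if x = - y then if a = - b \<and> a < y then zvar * (psign (pr y) * g (- y) y) else 0 else 0)"
    if xy: "x \<in> II n" "y \<in> II n" for x y
  proof -
    have "g x y * (if a = y \<and> x = b then psign (pr b * pr y) * qvar powi phi b y else 0) =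
      (if y = a then if x = b then g b a * (psign (pr a * pr b) * qvar powi phi b a) else 0 else 0)"
      by (auto simp: mult.commute[of "pr a"])
    moreover have "g x y * (if a = b \<and> x = y \<and> b < y then zvar else 0) =
      (if x = y then if a = b \<and> a < y then zvar * g y y else 0 else 0)" by auto
    moreover have "g x y * (if a = - b \<and> x = - y \<and> - b < y then zvar * psign (pr y) else 0) =
      (if x = - y then if a = - b \<and> a < y then zvar * (psign (pr y) * g (- y) y) else 0 else 0)"
      by (cases "a = - b"; cases "x = - y") (simp_all add: ac_simps)
    ultimately show ?thesis
      by (simp only: mat_Tmap[OF assms(1) xy(1) assms(2) xy(2)] distrib_left)
  qed
  then have "(\<Sum>x\<in>II n. \<Sum>y\<in>II n. g x y * mat (Tmap n) [a, x] [b, y]) =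
    (\<Sum>x\<in>II n. \<Sum>y\<in>II n. (if y = a then if x = b then g b a * (psign (pr a * pr b) * qvar powi phi b a) else 0 else 0)
       + (if x = y then if a = b \<and> a < y then zvar * g y y else 0 else 0)
       + (if x = - y then if a = - b \<and> a < y then zvar * (psign (pr y) * g (- y) y) else 0 else 0))"
    by simp
  also have "\<dots> = (\<Sum>y\<in>II n. \<Sum>x\<in>II n. (if y = a then if x = b then g b a * (psign (pr a * pr b) * qvar powi phi b a) else 0 else 0)
       + (if x = y then if a = b \<and> a < y then zvar * g y y else 0 else 0)
       + (if x = - y then if a = - b \<and> a < y then zvar * (psign (pr y) * g (- y) y) else 0 else 0))"
    by (rule sum.swap)
  also have "\<dots> = (\<Sum>y\<in>II n. (if y = a then g b a * (psign (pr a * pr b) * qvar powi phi b a) else 0)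
       + (if a = b \<and> a < y then zvar * g y y else 0)
       + (if a = - b \<and> a < y then zvar * (psign (pr y) * g (- y) y) else 0))"
    by (intro sum.cong HOL.refl) (use assms in \<open>simp add: sum.distrib\<close>)
  finally show ?thesis
    using assms II_nonzero[OF assms(1)]
    by (auto simp: sum.distrib sum.inter_filter sum_distrib_left mult_delta_right cong: if_cong)
qed

text \<open>The cancellation is that of \<open>Tmate_Rmap\<close>, but the summation index now sits
  in the input of r^-, so its power of q is \<open>qpos y\<close> and the sum telescopes at
  1/q.\<close>

lemma Rmap_Tmate: "smor_comp (Rmap n) (Tmate n) = smor_id (smod_tensor n (Vdual n) (Vmod n))"
proof (rule premor_eqI[of n])
  show "premor n (smor_comp (Rmap n) (Tmate n))" "premor n (smor_id (smod_tensor n (Vdual n) (Vmod n)))"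
    by (intro premor_comp premor_id Tmate_props premor_Rmap presmod_tensor presmod_V presmod_Vdual; simp add: Tmate_props)+
  fix u v assume "u \<in> bas (tgt (smor_comp (Rmap n) (Tmate n)))" "v \<in> bas (src (smor_comp (Rmap n) (Tmate n)))"
  then obtain p r a b where u: "u = [p, r]" and v: "v = [a, b]" and
    *: "p \<in> II n" "r \<in> II n" "a \<in> II n" "b \<in> II n"
    by (auto simp: bas_letters Tmate_props)
  have n0: "p \<noteq> 0" "r \<noteq> 0" "a \<noteq> 0" "b \<noteq> 0" using * II_nonzero by auto
  let ?A = "psign (pr a * pr b) * qvar powi phi b a"
  let ?W = "qvar powi sgn a * qpos a * qneg p"
  have "mat (smor_comp (Rmap n) (Tmate n)) u v =
    (\<Sum>x\<in>II n. \<Sum>y\<in>II n. mat (Rmap n) [p, r] [x, y] * mat (Tmap n) [a, x] [b, y])"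
    by (simp add: u v smor_comp_sel(4) Tmate_props sum_bas_letters presmod_V mat_Tmate *)
  also have "\<dots> = (if p = a \<and> r = b then 1 else 0)"
  proof -
    have W: "qvar powi (- sgn p) - qneg p *
        (\<Sum>y\<in>{a<..<p} - {0}. zvar * (psign (pr y) * qpos y)) = ?W" if "a < p"
      using telescope_right[OF *(3,1) that] by (simp add: algebra_simps)
    have diag: "mat (Rmap n) [p, r] [y, y] =
      (if y = p then if p = r then psign (pr p) * qvar powi (- sgn p) else 0 else 0)
      + (if y < p then if p = r then - (psign (pr p) * qneg p) *
          (zvar * (psign (pr y) * qpos y)) else 0 else 0)"
      if y: "y \<in> II n" for y
      using * II_nonzero[OF y] y
      by (simp add: mat_Rmap phi_diag psign_add q_power_split)
    have anti: "psign (pr y) * mat (Rmap n) [p, r] [- y, y] =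
      (if y = p then if r = - p then psign (pr p) * qvar powi (- sgn p) else 0 else 0)
      + (if y < p then if r = - p then - (psign (pr p) * qneg p) *
          (zvar * (psign (pr y) * qpos y)) else 0 else 0)"
      if y: "y \<in> II n" for y
      using * II_nonzero[OF y] y
      by (simp add: mat_Rmap phi_diag pr_uminus distrib_right q_power_split)
    have S1: "(\<Sum>y\<in>{y \<in> II n. a < y}. mat (Rmap n) [p, r] [y, y])
      = (if a < p \<and> p = r then psign (pr p) * ?W else 0)"
    proof -
      have eq: "(\<Sum>y\<in>{y \<in> II n. a < y}. mat (Rmap n) [p, r] [y, y])
        = (if a < p then (if p = r then psign (pr p) * qvar powi (- sgn p) else 0)
          + (\<Sum>y\<in>{a<..<p} - {0}. if p = r then - (psign (pr p) * qneg p) *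
          (zvar * (psign (pr y) * qpos y)) else 0) else 0)"
        by (subst sum_above[OF *(3,1), symmetric], rule sum.cong[OF HOL.refl], rule diag) simp
      have tele: "psign (pr p) * qvar powi (- sgn p) + (\<Sum>y\<in>{a<..<p} - {0}. - (psign (pr p) * qneg p) *
          (zvar * (psign (pr y) * qpos y))) = psign (pr p) * ?W" if "a < p"
        unfolding W[OF that, symmetric] by (simp add: right_diff_distrib sum_distrib_left sum_negf mult.assoc)
      show ?thesis
      proof (cases "p = r")
        case True
        then have "(a < p \<and> p = r) = (a < p)" by simp
        then show ?thesis
          unfolding eq if_P[OF True] using tele by (cases "a < p") (simp_all only: if_True if_False)
      qed (simp add: eq)
    qed
    have S2: "(\<Sum>y\<in>{y \<in> II n. a < y}. psign (pr y) * mat (Rmap n) [p, r] [- y, y])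
      = (if a < p \<and> r = - p then psign (pr p) * ?W else 0)"
    proof -
      have eq: "(\<Sum>y\<in>{y \<in> II n. a < y}. psign (pr y) * mat (Rmap n) [p, r] [- y, y])
        = (if a < p then (if r = - p then psign (pr p) * qvar powi (- sgn p) else 0)
          + (\<Sum>y\<in>{a<..<p} - {0}. if r = - p then - (psign (pr p) * qneg p) *
          (zvar * (psign (pr y) * qpos y)) else 0) else 0)"
        by (subst sum_above[OF *(3,1), symmetric], rule sum.cong[OF HOL.refl], rule anti) simp
      have tele: "psign (pr p) * qvar powi (- sgn p) + (\<Sum>y\<in>{a<..<p} - {0}. - (psign (pr p) * qneg p) *
          (zvar * (psign (pr y) * qpos y))) = psign (pr p) * ?W" if "a < p"
        unfolding W[OF that, symmetric] by (simp add: right_diff_distrib sum_distrib_left sum_negf mult.assoc)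
      show ?thesis
      proof (cases "r = - p")
        case True
        then have "(a < p \<and> r = - p) = (a < p)" by simp
        then show ?thesis
          unfolding eq if_P[OF True] using tele by (cases "a < p") (simp_all only: if_True if_False)
      qed (simp add: eq)
    qed
    have S3: "mat (Rmap n) [p, r] [b, a] * ?A = (if p = a \<and> r = b then 1 else 0)
       - (if a = b \<and> a < p \<and> p = r then zvar * (psign (pr p) * ?W) else 0)
       - (if a = - b \<and> a < p \<and> r = - p then zvar * (psign (pr p) * ?W) else 0)"
    proof -
      have "(if p = a \<and> r = b then psign (pr b * pr a) * qvar powi (- phi b a) else 0) * ?A = (if p = a \<and> r = b then 1 else 0)"
        by (auto simp: psign_powi_cancel mult.commute[of "pr b"])
      moreover have "(if b = a \<and> p = r \<and> b < p then zvar * (psign (pr b + pr p) * qdiff b p) else 0) * ?A =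
          (if a = b \<and> a < p \<and> p = r then zvar * (psign (pr p) * ?W) else 0)"
        using n0 by (cases "a = b") (auto simp: phi_diag psign_add q_power_split)
      moreover have "(if b = - a \<and> r = - p \<and> a < p then zvar * (psign (pr p) * qdiff b p) else 0) * ?A =
          (if a = - b \<and> a < p \<and> r = - p then zvar * (psign (pr p) * ?W) else 0)"
        using n0 by (cases "b = - a") (auto simp: pr_uminus phi_diag distrib_left q_power_split)
      ultimately show ?thesis
        by (simp only: mat_Rmap[OF *(1,2,4,3)] left_diff_distrib)
    qed
    have "(if P then zvar * (if Q then c else 0) else 0) = (if P \<and> Q then zvar * c else 0)" for P Q c
      by simp
    moreover have "X - B - C + B + C = X" for X B C :: Cq by simp
    ultimately show ?thesis
      unfolding Tmate_column[OF *(3,4)] S1 S2 S3 by (simp only:)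
  qed
  finally show "mat (smor_comp (Rmap n) (Tmate n)) u v = mat (smor_id (smod_tensor n (Vdual n) (Vmod n))) u v"
    using * by (simp add: u v bas_letters(2))
qed (simp_all add: Tmate_props)

text \<open>Equivariance of the explicit formula is inherited from its inverse, a composite of
  natural maps.\<close>

lemma braid_natural_Rmap: "braid_natural n (Rmap n)"
  by (rule braid_natural_inverse[OF Tmate_props(1) premor_Rmap Tmate_props(5)])
     (simp_all add: Tmate_props Tmate_Rmap Rmap_Tmate)


subsection \<open>The right evaluation\<close>

lemma mat_ev_Rmap: "mat (smor_comp (ev n) (Rmap n)) [] [i, j] = (\<Sum>p\<in>II n. mat (Rmap n) [p, p] [i, j])"
  by (simp add: smor_comp_sel(4) sum_bas_letters presmod_Vdual mult_delta_left)

lemma comp_coev: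
  "mat (smor_comp f (coev n)) u [] = (\<Sum>i\<in>II n. mat f u [i, i])"
  by (simp add: smor_comp_sel(4) sum_bas_letters presmod_V mult_delta_right)

text \<open>The leading term of r^- cancels the lower end of the telescoped sum and leaves the upper
  end. On these vectors cap_R is thus, up to a constant, weighted by (-1)^p(i) q^(2|i|).\<close>

lemma ev_Rmap_diagonal:
  assumes i: "i \<in> II n"
  shows "mat (smor_comp (ev n) (Rmap n)) [] [i, i] =
    qvar powi (- 1 - 2 * int n) * (psign (pr i) * qpos i)"
proof -
  have n0: "i \<noteq> 0" using i II_nonzero by auto
  \<comment> \<open>n + 1 is the first integer above the index set, so the sum runs over an open
    interval without 0.\<close>
  have above: "{p \<in> II n. i < p} = {i<..<int n + 1} - {0}" and lt: "i < int n + 1"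
    using i by (auto simp: II_def)
  have "(\<Sum>p\<in>II n. mat (Rmap n) [p, p] [i, i]) = (\<Sum>p\<in>II n. (if p = i then psign (pr i) * qvar powi (- sgn i) else 0)
    - (if i < p then psign (pr i) * qpos i * (zvar * (psign (pr p) * qneg p)) else 0))"
    by (intro sum.cong HOL.refl) (use i n0 in \<open>simp add: mat_Rmap phi_diag psign_add q_power_split\<close>)
  also have "\<dots> = psign (pr i) * qvar powi (- sgn i) - psign (pr i) * qpos i *
     (\<Sum>p\<in>{i<..<int n + 1} - {0}. zvar * (psign (pr p) * qneg p))"
    unfolding above[symmetric] using i by (simp add: sum_subtractf sum.inter_filter sum_distrib_left mult_delta_right cong: if_cong)
  also have "\<dots> = psign (pr i) * qpos i * tele qvar (int n + 1)"
    unfolding telescope_q[OF lt n0]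
    using power_int_add[of qvar "2 * \<bar>i\<bar>" "- sgn i - 2 * \<bar>i\<bar>"] by (simp add: algebra_simps)
  also have "tele qvar (int n + 1) = qvar powi (- 1 - 2 * int n)"
    by (simp add: tele_def algebra_simps)
  finally show ?thesis by (simp add: mat_ev_Rmap mult.commute)
qed

lemma ev_Rmap_coev: "smor_comp (smor_comp (ev n) (Rmap n)) (coev n) = smor_zero (smod_unit n) (smod_unit n) 0"
proof (rule premor_eqI[of n])
  show "premor n (smor_comp (smor_comp (ev n) (Rmap n)) (coev n))"
    by (intro premor_comp premor_ev premor_Rmap premor_coev) simp_all
  show "premor n (smor_zero (smod_unit n) (smod_unit n) 0)"
    by (intro premor_zero presmod_unit)
  \<comment> \<open>The bounds -n - 1 and n + 1 are symmetric, so both ends of the telescoped sum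
    equal q^(2n+1) and cancel. The factor z is then removed by \<open>zvar_nonzero\<close>.\<close>
  have "II n = {- int n - 1<..<int n + 1} - {0}" by (auto simp: II_def)
  then have "zvar * (\<Sum>i\<in>II n. psign (pr i) * qpos i) = 0"
    using telescope_inverse_q[of "- int n - 1" "int n + 1"]
    by (simp add: sum_distrib_left tele_inverse_q sgn_if algebra_simps)
  then have "(\<Sum>i\<in>II n. psign (pr i) * qpos i) = 0"
    using zvar_nonzero by simp
  then have "mat (smor_comp (smor_comp (ev n) (Rmap n)) (coev n)) [] [] = 0"
    by (simp add: comp_coev ev_Rmap_diagonal flip: sum_distrib_left)
  then show "mat (smor_comp (smor_comp (ev n) (Rmap n)) (coev n)) a b = mat (smor_zero (smod_unit n) (smod_unit n) 0) a b"
    if "a \<in> bas (tgt (smor_comp (smor_comp (ev n) (Rmap n)) (coev n)))"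
      "b \<in> bas (src (smor_comp (smor_comp (ev n) (Rmap n)) (coev n)))" for a b
    using that by simp
qed simp_all

text \<open>J leads to vectors v_{-i} tensor v_i^*. Their images under r^- are combinations of v_k^*
  tensor v_{-k}, which ev kills.\<close>

lemma ev_Rmap_J_coev:
  "smor_comp (smor_comp (ev n) (Rmap n)) (smor_comp (smor_tensor n (Jmap n) (smor_id (Vdual n))) (coev n)) =
   smor_zero (smod_unit n) (smod_unit n) 1" (is "?L = ?R")
proof (rule premor_eqI[of n])
  show "premor n ?L"
    by (intro premor_comp premor_ev premor_Rmap premor_coev premor_tensor_id premor_J presmod_Vdual) simp_all
  show "premor n ?R" by (intro premor_zero presmod_unit)
  have "mat (smor_comp (ev n) (Rmap n)) [] [- i, i] = 0" if i: "i \<in> II n" for i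
    unfolding mat_ev_Rmap by (rule sum.neutral) (use i II_nonzero in \<open>auto simp: mat_Rmap\<close>)
  then have "mat ?L [] [] = 0"
    by (simp add: comp_coev col_J1 flip: smor_comp_assoc)
  then show "mat ?L a b = mat ?R a b" if "a \<in> bas (tgt ?L)" "b \<in> bas (src ?L)" for a b
    using that by simp
qed simp_all

section \<open>The functor\<close>

text \<open>Stated for an arbitrary \<open>u\<close>, because the zigzag identity has to be verified
  for coev and later has to force the image of cup_L.\<close>

lemma zigzag_entries:
  assumes u: "premor n u" "src u = smod_unit n" "tgt u = smod_tensor n (Vmod n) (Vdual n)"
    and xk: "x \<in> II n" "k \<in> II n"
  shows "mat (smor_comp (smor_tensor n (smor_id (Vmod n)) (ev n)) (smor_tensor n u (smor_id (Vmod n)))) [x] [k]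
    = mat u [x, k] []"
proof -
  let ?F = "smor_tensor n (smor_id (Vmod n)) (ev n)"
  have e: "mat ?F [x] [i, j, k] = (if j = k then if i = x then 1 else 0 else 0)" for i j
    using mat_tensor_append[of "[x]" "smor_id (Vmod n)" "[i]" n "ev n" "[]" "[j, k]"] xk by auto
  have "mat (smor_comp ?F (smor_tensor n u (smor_id (Vmod n)))) [x] ([] @ [k]) =
    (\<Sum>w\<in>bas (tgt u). mat ?F [x] (w @ [k]) * mat u w [])"
    by (rule comp_col_right[OF u(1) presmod_V]) (use u xk in auto)
  also have "\<dots> = (\<Sum>i\<in>II n. \<Sum>j\<in>II n. if j = k then if i = x then mat u [x, k] [] else 0 else 0)"
    by (simp add: u sum_bas_letters presmod_V e mult_delta_left) (intro sum.cong HOL.refl; auto)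
  finally show ?thesis using xk by simp
qed

lemma zigzag_V:
  "smor_comp (smor_tensor n (smor_id (Vmod n)) (ev n)) (smor_tensor n (coev n) (smor_id (Vmod n))) = smor_id (Vmod n)"
  (is "?L = _")
proof (rule premor_eqI[of n])
  note V = presmod_V[of n] and D = presmod_Vdual[of n]
  show "premor n ?L"
    by (intro premor_comp premor_tensor_id premor_ev premor_coev V) (simp add: smod_tensor_assoc V D)
  show st: "src ?L = src (smor_id (Vmod n))" "tgt ?L = tgt (smor_id (Vmod n))"
    by (simp_all add: smod_tensor_unit_left smod_tensor_unit_right V)
  fix a b assume "a \<in> bas (tgt ?L)" "b \<in> bas (src ?L)"
  then show "mat ?L a b = mat (smor_id (Vmod n)) a b"
    unfolding st by (auto simp: zigzag_entries premor_coev split: if_splits)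
qed (simp_all add: premor_id presmod_V)

lemma zigzag_Vdual:
  "smor_comp (smor_tensor n (ev n) (smor_id (Vdual n))) (smor_tensor n (smor_id (Vdual n)) (coev n)) = smor_id (Vdual n)"
  (is "?L = _")
proof (rule premor_eqI[of n])
  note V = presmod_V[of n] and D = presmod_Vdual[of n]
  show "premor n ?L"
    by (intro premor_comp premor_tensor_id premor_ev premor_coev D) (simp add: smod_tensor_assoc V D)
  show st: "src ?L = src (smor_id (Vdual n))" "tgt ?L = tgt (smor_id (Vdual n))"
    by (simp_all add: smod_tensor_unit_left smod_tensor_unit_right D)
  fix a b assume "a \<in> bas (tgt ?L)" "b \<in> bas (src ?L)"
  then obtain x k where a: "a = [x]" and b: "b = [k]" and xk: "x \<in> II n" "k \<in> II n"
    unfolding st by auto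
  have e: "mat (smor_tensor n (ev n) (smor_id (Vdual n))) [x] [k, i, j] = (if i = k \<and> j = x then 1 else 0)"
    if "i \<in> II n" "j \<in> II n" for i j
    using mat_tensor_append[of "[]" "ev n" "[k, i]" n "smor_id (Vdual n)" "[x]" "[j]"] xk that by auto
  have "mat ?L [x] ([k] @ []) = psign (mpar (coev n) * par (Vdual n) [k]) *
    (\<Sum>w\<in>bas (tgt (coev n)). mat (smor_tensor n (ev n) (smor_id (Vdual n))) [x] ([k] @ w) * mat (coev n) w [])"
    by (rule comp_col_left[OF D premor_coev]) (use xk in auto)
  also have "\<dots> = (\<Sum>i\<in>II n. mat (smor_tensor n (ev n) (smor_id (Vdual n))) [x] [k, i, i])"
    by (simp add: sum_bas_letters V mult_delta_right)
  also have "\<dots> = (\<Sum>i\<in>II n. if i = k then if k = x then 1 else 0 else 0)"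
    by (intro sum.cong HOL.refl) (auto simp: e)
  finally show "mat ?L a b = mat (smor_id (Vdual n)) a b"
    using xk by (simp add: a b)
qed (simp_all add: premor_id presmod_Vdual)


section \<open>Interpretation of formal terms\<close>

primrec iobj :: "nat \<Rightarrow> updown list \<Rightarrow> smodule" where
  "iobj n [] = smod_unit n"
| "iobj n (a # X) = smod_tensor n (case a of Up \<Rightarrow> Vmod n | Dn \<Rightarrow> Vdual n) (iobj n X)"

primrec igen :: "nat \<Rightarrow> qgen \<Rightarrow> smor" where
  "igen n UPlus = Tmap n"
| "igen n UMinus = Tinv n"
| "igen n RMinus = Rmap n"
| "igen n CapL = ev n"
| "igen n CupL = coev n"
| "igen n Cdot = Jmap n"

primrec imor :: "nat \<Rightarrow> Cq qterm \<Rightarrow> smor" where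
  "imor n (QGen g) = igen n g"
| "imor n (QId X) = smor_id (iobj n X)"
| "imor n (QZero X Y e) = smor_zero (iobj n X) (iobj n Y) e"
| "imor n (QAdd s t) = smor_plus (imor n s) (imor n t)"
| "imor n (QScale a t) = smor_scale a (imor n t)"
| "imor n (s \<circ>\<^sub>Q t) = smor_comp (imor n s) (imor n t)"
| "imor n (s \<otimes>\<^sub>Q t) = smor_tensor n (imor n s) (imor n t)"

lemma good_iobj: "good n (iobj n X)"
  by (induction X) (auto simp: good_unit split: updown.split intro!: good_tensor good_V good_Vdual)

lemma presmod_iobj [simp]: "presmod n (iobj n X)"
  using good_iobj by (simp add: good_def)

lemma iobj_append: "iobj n (X @ Y) = smod_tensor n (iobj n X) (iobj n Y)"
  by (induction X)
     (auto simp: smod_tensor_unit_left smod_tensor_assoc presmod_V presmod_Vdual split: updown.split)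

lemma iobj_simps [simp]: "iobj n [Up] = Vmod n" "iobj n [Dn] = Vdual n"
  "iobj n [Up, Up] = VV n" "iobj n [Up, Dn] = smod_tensor n (Vmod n) (Vdual n)"
  "iobj n [Dn, Up] = smod_tensor n (Vdual n) (Vmod n)"
  by (simp_all add: smod_tensor_unit_right presmod_V presmod_Vdual)

declare iobj.simps(2) [simp del]

text \<open>The induction carries naturality instead of equivariance, since naturality is what
  composition and tensor products preserve formally; it is converted once, in
  \<open>imor_Hom\<close>.\<close>

lemma imor_typed:
  "qwf t \<Longrightarrow> premor n (imor n t) \<and> src (imor n t) = iobj n (qdom t) \<and> tgt (imor n t) = iobj n (qcod t) \<and>
     mpar (imor n t) = qpar t \<and> braid_natural n (imor n t)"
proof (induction t)
  case (QGen g)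
  show ?case
    by (cases g)
       (simp_all add: gpar_def premor_T premor_Tinv premor_Rmap premor_ev premor_coev premor_J
         braid_natural_T braid_natural_Tinv braid_natural_Rmap braid_natural_ev braid_natural_coev braid_natural_J
        )
next
  case (QAdd s t)
  then show ?case by (simp add: premor_plus braid_natural_plus)
next
  case (QScale a t)
  then show ?case by (simp add: premor_scale braid_natural_scale)
next
  case (QComp s t)
  then show ?case by (simp add: premor_comp braid_natural_comp)
next
  case (QTens s t)
  then show ?case by (simp add: premor_tensor braid_natural_tensor iobj_append)
qed (simp_all add: premor_id premor_zero braid_natural_id braid_natural_zero)

lemma imor_sel:
  assumes "qwf t"
  shows "premor n (imor n t)" "src (imor n t) = iobj n (qdom t)" "tgt (imor n t) = iobj n (qcod t)"
    "mpar (imor n t) = qpar t"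
  using imor_typed[OF assms] by auto

lemma imor_Hom:
  assumes "qwf t"
  shows "imor n t \<in> smod_Hom n (iobj n (qdom t)) (iobj n (qcod t)) (qpar t)"
  using smod_Hom_if_intertwines[of n "imor n t"] intertwines_if_braid_natural[of n "imor n t"]
    imor_typed[OF assms, of n] by auto

lemma smor_eqI:
  fixes f g :: smor
  assumes "src f = src g" "tgt f = tgt g" "mpar f = mpar g" "\<And>a b. mat f a b = mat g a b"
  shows "f = g"
  using assms by (intro smor.equality ext) auto

text \<open>Cases 1 to 24 are the axioms of a linear strict monoidal supercategory and hold for
  matrices of the right type; cases 25 to 36 are the defining relations of Q(z).\<close>

lemma imor_qax:
  assumes "qax zvar s t" "qwf s" "qwf t"
  shows "imor n s = imor n t"
  using assms
proof (induction rule: qax.induct, goal_cases)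
  case (1 r s t)
  show ?case by (rule smor_eqI) (simp_all add: add.assoc)
next
  case (2 s t)
  then show ?case by (intro smor_eqI) (simp_all add: imor_sel add.commute)
next
  case (3 t)
  show ?case by (rule smor_eqI) simp_all
next
  case (4 t)
  then show ?case by (intro smor_eqI) (simp_all add: imor_sel)
next
  case (5 a s t)
  show ?case by (rule smor_eqI) (simp_all add: distrib_left)
next
  case (6 a b t)
  show ?case by (rule smor_eqI) (simp_all add: distrib_right)
next
  case (7 a b t)
  show ?case by (rule smor_eqI) (simp_all add: mult.assoc)
next
  case (8 t)
  show ?case by (rule smor_eqI) simp_all
next
  case (9 r s t)
  show ?case by (rule smor_eqI) (simp_all add: smor_comp_sel(4) distrib_right sum.distrib)
next
  case (10 r s t)
  then show ?case by (intro smor_eqI) (simp_all add: smor_comp_sel(4) distrib_left sum.distrib imor_sel)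
next
  case (11 a s t)
  show ?case by (rule smor_eqI) (simp_all add: smor_comp_sel(4) sum_distrib_left ac_simps)
next
  case (12 s a t)
  show ?case by (rule smor_eqI) (simp_all add: smor_comp_sel(4) sum_distrib_left ac_simps)
next
  case (13 r s t)
  then show ?case by (intro smor_eqI) (simp_all add: smor_tensor_def imor_sel algebra_simps)
next
  case (14 r s t)
  then show ?case by (intro smor_eqI) (simp_all add: smor_tensor_def imor_sel algebra_simps)
next
  case (15 a s t)
  show ?case by (rule smor_eqI) (simp_all add: smor_tensor_def)
next
  case (16 s a t)
  show ?case by (rule smor_eqI) (simp_all add: smor_tensor_def)
next
  case (17 r s t)
  show ?case by (simp add: smor_comp_assoc)
next
  case (18 t)
  then show ?case using smor_comp_id_left[of n "imor n t"] by (simp add: imor_sel)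
next
  case (19 t)
  then show ?case using smor_comp_id_right[of n "imor n t"] by (simp add: imor_sel)
next
  case (20 r s t)
  then show ?case by (simp add: smor_tensor_assoc imor_sel)
next
  case (21 t)
  then show ?case by (simp add: smor_tensor_unit_left imor_sel)
next
  case (22 t)
  then show ?case by (simp add: smor_tensor_unit_right imor_sel)
next
  case (23 X Y)
  show ?case by (simp add: smor_tensor_id iobj_append)
next
  case (24 f' g f g')
  then have "qdom f' = qcod f" "qdom g = qcod g'" by simp_all
  then show ?case
    using smor_interchange[of n "imor n f'" "imor n g" "imor n f" "imor n g'"] 24
    by (simp add: imor_sel)
next
  case 25
  show ?case by (simp add: Tinv_T)
next
  case 26
  show ?case by (simp add: T_Tinv)
next
  case 27
  show ?case using Tmate_Rmap[of n] by (simp add: lplus_def Tmate_def)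
next
  case 28
  show ?case using Rmap_Tmate[of n] by (simp add: lplus_def Tmate_def)
next
  case 29
  show ?case using hexagon_V[of n] by (simp add: hexagon_def Lt_V)
next
  case 30
  show ?case by (rule smor_eqI) (simp_all add: Tinv_def)
next
  case 31
  show ?case by (simp add: J_J)
next
  case 32
  show ?case by (simp add: T_J)
next
  case 33
  show ?case using ev_Rmap_J_coev[of n] by (simp add: capR_def)
next
  case 34
  show ?case using ev_Rmap_coev[of n] by (simp add: capR_def)
next
  case 35
  show ?case by (simp add: zigzag_V)
next
  case 36
  show ?case by (simp add: zigzag_Vdual)
qed

lemma imor_qeq: "qeq zvar s t \<Longrightarrow> imor n s = imor n t"
  by (induction rule: qeq.induct) (auto intro: imor_qax)


subsection \<open>Congruence classes\<close>

lemma qclass_eqI: "qeq z s t \<Longrightarrow> qclass z s = qclass z t"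
  unfolding qclass_def using qeq.trans qeq.sym by blast

lemma qclass_self: "qwf t \<Longrightarrow> t \<in> qclass z t"
  by (simp add: qclass_def qeq.refl)

text \<open>Operations on congruence classes are unions over representatives. Such a union is again
  a class because all its members coincide.\<close>

lemma UN_constant:
  assumes "s \<in> A" "\<And>s'. s' \<in> A \<Longrightarrow> F s' = C" shows "(\<Union>s'\<in>A. F s') = C"
  using assms by auto

lemma UN_constant2:
  assumes "s \<in> A" "t \<in> B" "\<And>s' t'. s' \<in> A \<Longrightarrow> t' \<in> B \<Longrightarrow> F s' t' = C"
  shows "(\<Union>s'\<in>A. \<Union>t'\<in>B. F s' t') = C"
proof (rule UN_constant[OF assms(1)])
  fix s' assume "s' \<in> A"
  then show "(\<Union>t'\<in>B. F s' t') = C" by (intro UN_constant[OF assms(2)] assms(3))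
qed

lemma Qcat_Plus:
  assumes "qwf (QAdd s t)"
  shows "Plus (Qcat z) (qclass z s) (qclass z t) = qclass z (QAdd s t)"
proof -
  have "qclass z (QAdd s' t') = qclass z (QAdd s t)" if "s' \<in> qclass z s" "t' \<in> qclass z t" for s' t'
    using that qclass_eqI[OF qeq.add[of z s s' t t']] assms by (simp add: qclass_def)
  with assms show ?thesis
    unfolding Qcat_def monoidal_supercat.simps by (intro UN_constant2[OF qclass_self qclass_self]) simp_all
qed

lemma Qcat_Scale:
  assumes "qwf t"
  shows "Scale (Qcat z) a (qclass z t) = qclass z (QScale a t)"
proof -
  have "qclass z (QScale a t') = qclass z (QScale a t)" if "t' \<in> qclass z t" for t'
    using that qclass_eqI[OF qeq.scale[of z t t']] by (simp add: qclass_def)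
  then show ?thesis
    unfolding Qcat_def monoidal_supercat.simps by (rule UN_constant[OF qclass_self[OF assms]])
qed

lemma Qcat_Comp:
  assumes "qwf (s \<circ>\<^sub>Q t)"
  shows "Comp (Qcat z) (qclass z s) (qclass z t) = qclass z (s \<circ>\<^sub>Q t)"
proof -
  have "qclass z (s' \<circ>\<^sub>Q t') = qclass z (s \<circ>\<^sub>Q t)" if "s' \<in> qclass z s" "t' \<in> qclass z t" for s' t'
    using that qclass_eqI[OF qeq.comp[of z s s' t t']] assms by (simp add: qclass_def)
  with assms show ?thesis
    unfolding Qcat_def monoidal_supercat.simps by (intro UN_constant2[OF qclass_self qclass_self]) simp_all
qed

lemma Qcat_TensM:
  assumes "qwf (s \<otimes>\<^sub>Q t)"
  shows "TensM (Qcat z) (qclass z s) (qclass z t) = qclass z (s \<otimes>\<^sub>Q t)"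
proof -
  have "qclass z (s' \<otimes>\<^sub>Q t') = qclass z (s \<otimes>\<^sub>Q t)" if "s' \<in> qclass z s" "t' \<in> qclass z t" for s' t'
    using that qclass_eqI[OF qeq.tens[of z s s' t t']] by (simp add: qclass_def)
  with assms show ?thesis
    unfolding Qcat_def monoidal_supercat.simps by (intro UN_constant2[OF qclass_self qclass_self]) simp_all
qed

lemma Qcat_sel [simp]: "Ob (Qcat z) = UNIV" "Idt (Qcat z) X = qclass z (QId X)"
  "UnitO (Qcat z) = []" "TensO (Qcat z) X Y = X @ Y"
  by (simp_all add: Qcat_def)

lemma Qcat_Hom: "f \<in> Hom (Qcat z) X Y e \<longleftrightarrow>
    (\<exists>t. f = qclass z t \<and> qwf t \<and> qdom t = X \<and> qcod t = Y \<and> qpar t = e)"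
  by (auto simp: Qcat_def)

lemma Uq_smod_sel [simp]: "Ob (Uq_smod n) = {M. is_smodule n M}" "Hom (Uq_smod n) = smod_Hom n"
  "Plus (Uq_smod n) = smor_plus" "Scale (Uq_smod n) = smor_scale" "Idt (Uq_smod n) = smor_id"
  "Comp (Uq_smod n) = smor_comp" "UnitO (Uq_smod n) = smod_unit n" "TensO (Uq_smod n) = smod_tensor n"
  "TensM (Uq_smod n) = smor_tensor n"
  by (simp_all add: Uq_smod_def fun_eq_iff smor_plus_def smor_scale_def)

definition Fmor :: "nat \<Rightarrow> Cq qmor \<Rightarrow> smor" where
  "Fmor n A = imor n (SOME t. t \<in> A)"

lemma Fmor_qclass:
  assumes "qwf t" shows "Fmor n (qclass zvar t) = imor n t"
proof -
  have "(SOME s. s \<in> qclass zvar t) \<in> qclass zvar t"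
    by (rule someI, rule qclass_self[OF assms])
  then show ?thesis by (simp add: Fmor_def qclass_def imor_qeq[of t])
qed

text \<open>Moves the functor axioms from congruence classes to representatives, so that existence
  and uniqueness can both be argued by induction on terms.\<close>

lemma monoidal_superfunctor_terms:
  "monoidal_superfunctor (Qcat z) (Uq_smod n) FO FM \<longleftrightarrow>
     (\<forall>X. is_smodule n (FO X)) \<and>
     (\<forall>t. qwf t \<longrightarrow> FM (qclass z t) \<in> smod_Hom n (FO (qdom t)) (FO (qcod t)) (qpar t)) \<and>
     (\<forall>s t. qwf (QAdd s t) \<longrightarrow> FM (qclass z (QAdd s t)) = smor_plus (FM (qclass z s)) (FM (qclass z t))) \<and>
     (\<forall>a t. qwf t \<longrightarrow> FM (qclass z (QScale a t)) = smor_scale a (FM (qclass z t))) \<and>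
     (\<forall>X. FM (qclass z (QId X)) = smor_id (FO X)) \<and>
     (\<forall>s t. qwf (s \<circ>\<^sub>Q t) \<longrightarrow> FM (qclass z (s \<circ>\<^sub>Q t)) = smor_comp (FM (qclass z s)) (FM (qclass z t))) \<and>
     FO [] = smod_unit n \<and>
     (\<forall>X Y. FO (X @ Y) = smod_tensor n (FO X) (FO Y)) \<and>
     (\<forall>s t. qwf (s \<otimes>\<^sub>Q t) \<longrightarrow> FM (qclass z (s \<otimes>\<^sub>Q t)) = smor_tensor n (FM (qclass z s)) (FM (qclass z t)))"
proof -
  have Hom: "(\<forall>f\<in>Hom (Qcat z) X Y e. P f) \<longleftrightarrow>
      (\<forall>t. qwf t \<longrightarrow> qdom t = X \<longrightarrow> qcod t = Y \<longrightarrow> qpar t = e \<longrightarrow> P (qclass z t))" for X Y e P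
    unfolding Ball_def Qcat_Hom by blast
  have "(\<forall>X Y e s. qwf s \<longrightarrow> qdom s = X \<longrightarrow> qcod s = Y \<longrightarrow> qpar s = e \<longrightarrow>
      (\<forall>t. qwf t \<longrightarrow> qdom t = X \<longrightarrow> qcod t = Y \<longrightarrow> qpar t = e \<longrightarrow>
        FM (Plus (Qcat z) (qclass z s) (qclass z t)) = smor_plus (FM (qclass z s)) (FM (qclass z t)))) \<longleftrightarrow>
     (\<forall>s t. qwf (QAdd s t) \<longrightarrow> FM (qclass z (QAdd s t)) = smor_plus (FM (qclass z s)) (FM (qclass z t)))"
    by (simp add: Qcat_Plus[symmetric]) metis
  then show ?thesis
    unfolding monoidal_superfunctor_def Uq_smod_sel Qcat_sel Hom
    by (simp add: Qcat_Scale Qcat_Comp Qcat_TensM) (intro conj_cong HOL.refl; metis)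
qed

lemma is_Fn_Fmor: "is_Fn n (iobj n) (Fmor n)"
  unfolding is_Fn_def monoidal_superfunctor_terms
  using good_is_smodule[OF good_iobj] imor_Hom
  by (auto simp: Fmor_qclass iobj_append)


subsection \<open>Uniqueness\<close>

lemma inverse_unique:
  assumes "premor n g" "premor n g'" "src g = tgt f" "tgt g' = src f"
    and "smor_comp g f = smor_id (src f)" "smor_comp f g' = smor_id (src g)"
  shows "g = g'"
proof -
  have "g = smor_comp g (smor_comp f g')"
    using smor_comp_id_right[OF assms(1)] assms(6) by simp
  also have "\<dots> = g'"
    using smor_comp_id_left[OF assms(2)] assms(4,5) by (simp flip: smor_comp_assoc)
  finally show ?thesis .
qed

text \<open>The zigzag composite with ev has the entries of \<open>u\<close> as its own entries, so
  a single zigzag identity determines \<open>u\<close>.\<close>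

lemma coev_unique:
  assumes u: "premor n u" "src u = smod_unit n" "tgt u = smod_tensor n (Vmod n) (Vdual n)" "mpar u = 0"
    and zz: "smor_comp (smor_tensor n (smor_id (Vmod n)) (ev n)) (smor_tensor n u (smor_id (Vmod n))) = smor_id (Vmod n)"
  shows "u = coev n"
proof (rule premor_eqI[OF u(1) premor_coev])
  fix a b assume "a \<in> bas (tgt u)" "b \<in> bas (src u)"
  then obtain x k where "a = [x, k]" "b = []" "x \<in> II n" "k \<in> II n"
    by (auto simp: u bas_letters)
  then show "mat u a b = mat (coev n) a b"
    using zigzag_entries[OF u(1-3), of x k] zz by simp
qed (simp_all add: u)

text \<open>The images of the generators without a prescribed value are forced by relations in which
  the known ones occur; the rest is induction on terms.\<close>

lemma is_Fn_unique:
  assumes "is_Fn n GO GM"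
  shows "GO = iobj n" "qwf t \<Longrightarrow> GM (qclass zvar t) = imor n t"
proof -
  note F = assms[unfolded is_Fn_def monoidal_superfunctor_terms]
  let ?G = "\<lambda>t. GM (qclass zvar t)"
  have tens: "GO (X @ Y) = smod_tensor n (GO X) (GO Y)" and unit: "GO [] = smod_unit n"
    and up: "GO [Up] = Vmod n" and dn: "GO [Dn] = Vdual n" for X Y
    using F by auto
  show GO: "GO = iobj n"
  proof
    fix X show "GO X = iobj n X"
    proof (induction X)
      case (Cons a X)
      then show ?case using tens[of "[a]" X] by (cases a) (simp_all add: up dn iobj.simps(2))
    qed (simp add: unit)
  qed
  have hom: "premor n (?G t)" "src (?G t) = iobj n (qdom t)" "tgt (?G t) = iobj n (qcod t)" "mpar (?G t) = qpar t"
    if "qwf t" for t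
  proof -
    have "?G t \<in> smod_Hom n (iobj n (qdom t)) (iobj n (qcod t)) (qpar t)"
      using F that unfolding GO by blast
    from premor_if_smod_Hom[OF presmod_iobj presmod_iobj this]
    show "premor n (?G t)" "src (?G t) = iobj n (qdom t)" "tgt (?G t) = iobj n (qcod t)"
      "mpar (?G t) = qpar t" .
  qed
  have G: "qwf (QAdd s t) \<Longrightarrow> ?G (QAdd s t) = smor_plus (?G s) (?G t)"
    "qwf t \<Longrightarrow> ?G (QScale a t) = smor_scale a (?G t)" "?G (QId X) = smor_id (iobj n X)"
    "qwf (s \<circ>\<^sub>Q t) \<Longrightarrow> ?G (s \<circ>\<^sub>Q t) = smor_comp (?G s) (?G t)"
    "qwf (s \<otimes>\<^sub>Q t) \<Longrightarrow> ?G (s \<otimes>\<^sub>Q t) = smor_tensor n (?G s) (?G t)" for a s t X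
    using F unfolding GO by blast+
  have gens: "?G (QGen UPlus) = Tmap n" "?G (QGen CapL) = ev n" "?G (QGen Cdot) = Jmap n"
    using F by auto
  have ax: "?G s = ?G t" if "qax zvar s t" "qwf s" "qwf t" for s t
    using qclass_eqI[OF qeq.ax[OF that]] by simp
  have cup: "?G (QGen CupL) = coev n"
  proof (rule coev_unique)
    show "smor_comp (smor_tensor n (smor_id (Vmod n)) (ev n)) (smor_tensor n (?G (QGen CupL)) (smor_id (Vmod n)))
      = smor_id (Vmod n)"
      using ax[OF qax.intros(35)] by (simp add: G gens)
  qed (use hom[of "QGen CupL"] in \<open>simp_all add: gpar_def\<close>)
  have uminus: "?G (QGen UMinus) = Tinv n"
  proof (rule inverse_unique[where n = n and f = "Tmap n"])
    show "smor_comp (?G (QGen UMinus)) (Tmap n) = smor_id (src (Tmap n))"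
      using ax[OF qax.intros(25)] by (simp add: G gens)
  qed (use hom[of "QGen UMinus"] in \<open>simp_all add: premor_Tinv T_Tinv\<close>)
  \<comment> \<open>l^+ contains cup_L, so its image can be identified only now that cup_L is known;
    this in turn determines the inverse r^-.\<close>
  have lplus: "?G lplus = Tmate n"
    by (simp add: lplus_def Tmate_def G gens cup)
  have rminus: "?G (QGen RMinus) = Rmap n"
  proof (rule inverse_unique[where n = n and f = "Tmate n"])
    have "qwf lplus" "qcod lplus = [Up, Dn]" "qdom lplus = [Dn, Up]" by (simp_all add: lplus_def)
    note L = this
    show "smor_comp (?G (QGen RMinus)) (Tmate n) = smor_id (src (Tmate n))"
      using ax[OF qax.intros(28)] by (simp add: G lplus L Tmate_props)
  qed (use hom[of "QGen RMinus"] in \<open>simp_all add: premor_Rmap Tmate_props Tmate_Rmap\<close>)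
  show "qwf t \<Longrightarrow> ?G t = imor n t"
  proof (induction t)
    case (QGen g)
    show ?case using gens cup uminus rminus by (cases g) simp_all
  next
    case (QZero X Y e)
    let ?Z = "QZero X Y e :: Cq qterm"
    \<comment> \<open>Preservation of zero is not among the functor axioms; it follows from t + (-1)
      t = 0 with t the zero term itself.\<close>
    have "?G ?Z = smor_plus (?G ?Z) (smor_scale (- 1) (?G ?Z))"
      using ax[OF qax.intros(4)[of zvar ?Z]] by (simp add: G)
    also have "\<dots> = smor_zero (iobj n X) (iobj n Y) e"
      using hom[of ?Z] by (intro smor_eqI) simp_all
    finally show ?case by simp
  qed (simp_all add: G)
qed


theorem theorem4p3:
  fixes n :: nat
  shows "\<exists>FO FM. is_Fn n FO FM \<and>
    (\<forall>GO GM. is_Fn n GO GM \<longrightarrow>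
       (\<forall>X\<in>Ob (Qcat zvar). GO X = FO X) \<and>
       (\<forall>X\<in>Ob (Qcat zvar). \<forall>Y\<in>Ob (Qcat zvar). \<forall>e. \<forall>f\<in>Hom (Qcat zvar) X Y e. GM f = FM f)) \<and>
    smor_comp (FM (qclass zvar (QGen UMinus))) (Tmap n) = smor_id (VV n) \<and>
    smor_comp (Tmap n) (FM (qclass zvar (QGen UMinus))) = smor_id (VV n) \<and>
    FM (qclass zvar (QGen CupL)) = coev n \<and>
    FM (qclass zvar (QGen RMinus))
      \<in> Hom (Uq_smod n) (smod_tensor n (Vmod n) (Vdual n)) (smod_tensor n (Vdual n) (Vmod n)) 0 \<and>
    (\<forall>i\<in>II n. \<forall>j\<in>II n. image_of (FM (qclass zvar (QGen RMinus))) [i, j] = (\<lambda>x.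
        psign (pr i * pr j) * qvar powi (- phi i j) * bvec [j, i] x
      - zvar * (if i = j then 1 else 0) *
          (\<Sum>k\<in>{k \<in> II n. k > i}.
             psign (pr i + pr k) * qvar powi (2 * \<bar>i\<bar> - 2 * \<bar>k\<bar>) * bvec [k, k] x)
      - zvar * (if i = - j then 1 else 0) *
          (\<Sum>k\<in>{k \<in> II n. k > j}.
             psign (pr k) * qvar powi (2 * \<bar>i\<bar> - 2 * \<bar>k\<bar>) * bvec [k, - k] x)))"
proof (intro exI[of _ "iobj n"] exI[of _ "Fmor n"] conjI allI impI ballI)
  show "is_Fn n (iobj n) (Fmor n)" by (rule is_Fn_Fmor)
next
  fix GO GM X assume "is_Fn n GO GM"
  then show "GO X = iobj n X" by (simp add: is_Fn_unique(1)[of n GO GM])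
next
  fix GO GM X Y e f assume "is_Fn n GO GM" "f \<in> Hom (Qcat zvar) X Y e"
  then show "GM f = Fmor n f" by (auto simp: Qcat_Hom is_Fn_unique(2) Fmor_qclass)
next
  show "smor_comp (Fmor n (qclass zvar (QGen UMinus))) (Tmap n) = smor_id (VV n)"
    "smor_comp (Tmap n) (Fmor n (qclass zvar (QGen UMinus))) = smor_id (VV n)"
    "Fmor n (qclass zvar (QGen CupL)) = coev n"
    by (simp_all add: Fmor_qclass Tinv_T T_Tinv)
  show "Fmor n (qclass zvar (QGen RMinus))
      \<in> Hom (Uq_smod n) (smod_tensor n (Vmod n) (Vdual n)) (smod_tensor n (Vdual n) (Vmod n)) 0"
    using imor_Hom[of "QGen RMinus" n] by (simp add: Fmor_qclass gpar_def)
next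
  fix i j assume "i \<in> II n" "j \<in> II n"
  then show "image_of (Fmor n (qclass zvar (QGen RMinus))) [i, j] = (\<lambda>x.
        psign (pr i * pr j) * qvar powi (- phi i j) * bvec [j, i] x
      - zvar * (if i = j then 1 else 0) *
          (\<Sum>k\<in>{k \<in> II n. k > i}.
             psign (pr i + pr k) * qvar powi (2 * \<bar>i\<bar> - 2 * \<bar>k\<bar>) * bvec [k, k] x)
      - zvar * (if i = - j then 1 else 0) *
          (\<Sum>k\<in>{k \<in> II n. k > j}.
             psign (pr k) * qvar powi (2 * \<bar>i\<bar> - 2 * \<bar>k\<bar>) * bvec [k, - k] x))"
    by (simp add: Fmor_qclass image_Rmap)
qed

end
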